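(* Let $p$ be a prime number, let $\lambda:\mathbb Z/p\curvearrowright\mathcal G$ be an action by automorphisms on an ample groupoid $\mathcal G$ whose unit space is a Cantor set, free on $\mathcal G^{(0)}$, and put $\mathcal H:=\mathcal G\rtimes_\lambda\mathbb Z/p$. Assume that $\mathcal G$ and $\mathcal H$ are effective, minimal, and each either almost finite or purely infinite. Let $\iota_*:\mathsf F(\mathcal G)\to\mathsf F(\mathcal H)$ be the inclusion. Suppose that $\lambda_a\in\mathsf D(\mathcal H)$ for every $a\in\mathbb Z/p$ (this holds automatically when $p\ge3$). Then \[\mathrm N(\mathsf D(\mathcal H),\mathsf D(\mathcal G))=\bigl(\mathsf F(\mathcal G)\cap\mathsf D(\mathcal H)\bigr)\rtimes_\lambda\mathbb Z/p.\] Moreover, the following conditions are equivalent. (1) The map on abelianizations $H_1(\iota_* ):H_1(\mathsf F(\mathcal G))\to H_1(\mathsf F(\mathcal H))$ is injective. (2) $\mathrm N(\mathsf D(\mathcal H),\mathsf D(\mathcal G))=\mathsf D(\mathcal G)\rtimes_\lambda\mathbb Z/p$. (3) $\mathsf D(\mathcal G)\rtimes_\lambda\mathbb Z/p$ is a maximal subgroup of $\mathsf D(\mathcal H)$.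
   Context: Groupoids. An étale groupoid is a second countable locally compact Hausdorff topological groupoid whose range map is a local homeomorphism; $\mathcal G^{(0)}$ is the unit space, $s(g)=g^{-1}g$, $r(g)=gg^{-1}$. It is ample if $\mathcal G^{(0)}$ is totally disconnected. A bisection is a subset on which $r$ and $s$ are injective. $\mathcal G$ is minimal if every orbit $r(s^{-1}(x))$ is dense in $\mathcal G^{(0)}$; effective if the interior of $\{g\mid r(g)=s(g)\}$ is $\mathcal G^{(0)}$; principal if $\{g\mid r(g)=s(g)\}=\mathcal G^{(0)}$. Full groups. For an effective ample groupoid with compact unit space, a full bisection is a compact open bisection $U$ with $r(U)=s(U)=\mathcal G^{(0)}$; $\theta_U:=r\circ(s|_U)^{-1}\in\mathrm{Homeo}(\mathcal G^{(0)})$. $\mathsf F(\mathcal G)$ is the group of all such $\theta_U$, $\mathsf D(\mathcal G)$ its commutator subgroup. $H_1(\Gamma)$ is the abelianization of a group $\Gamma$; $\mathrm N(\Gamma,S)=\{\alpha\in\Gamma\mid\alpha S\alpha^{-1}=S\}$. Almost finite / purely infinite. An elementary subgroupoid is a compact open principal subgroupoid $\mathcal K\subset\mathcal G$ with $\mathcal K^{(0)}=\mathcal G^{(0)}$; $\mathcal Kx=\{g\in\mathcal K\mid s(g)=x\}$. $\mathcal G$ is almost finite if for every compact $C\subset\mathcal G$ and $\varepsilon>0$ there is an elementary subgroupoid $\mathcal K$ with $\#(C\mathcal Kx\setminus\mathcal Kx)/\#(\mathcal Kx)<\varepsilon$ for all $x\in\mathcal G^{(0)}$. It is purely infinite if for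 every clopen $A\subset\mathcal G^{(0)}$ there are compact open bisections $U,V$ with $s(U)=s(V)=A$, $r(U)\cap r(V)=\emptyset$, $r(U)\cup r(V)\subset A$. Semidirect product. $\mathcal G\rtimes_\lambda\mathbb Z/p$ is $\mathcal G\times\mathbb Z/p$ with the product topology, unit space identified with $\mathcal G^{(0)}$, $r(g,a)=r(g)$, $s(g,a)=\lambda_a^{-1}(s(g))$, $(g,a)(h,b)=(g\lambda_a(h),a+b)$. $\mathcal G$ is identified with $\mathcal G\times\{0\}\subset\mathcal H$, so $\mathsf F(\mathcal G)\subset\mathsf F(\mathcal H)$ and $\mathsf D(\mathcal G)\subset\mathsf D(\mathcal H)$. The restriction of $\lambda_a$ to $\mathcal G^{(0)}$ is an element of $\mathsf F(\mathcal H)$, again written $\lambda_a$. For a subgroup $S\subset\mathsf F(\mathcal G)$ normalized by the $\lambda_a$, $S\rtimes_\lambda\mathbb Z/p$ denotes the subgroup of $\mathsf F(\mathcal H)$ generated by $S$ and $\{\lambda_a\mid a\in\mathbb Z/p\}$ (an internal semidirect product). *)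

theory Defs
  imports
    "HOL-Analysis.Analysis"
    "HOL-Algebra.Elementary_Groups"
    "HOL-Algebra.Group_Action"
    "HOL-Computational_Algebra.Primes"
begin

section \<open>Topological groupoids\<close>

record 'g top_groupoid =
  gtop :: "'g topology"
  gmult :: "'g \<Rightarrow> 'g \<Rightarrow> 'g"
  ginv :: "'g \<Rightarrow> 'g"

text \<open>The underlying set is \<open>topspace (gtop G)\<close>. The product \<open>gmult G g h\<close> is
  meaningful only if \<open>gsrc G g = grng G h\<close>; its values elsewhere are irrelevant.\<close>

abbreviation garrows :: "('g, 'z) top_groupoid_scheme \<Rightarrow> 'g set" where
  "garrows G \<equiv> topspace (gtop G)"

definition gsrc :: "('g, 'z) top_groupoid_scheme \<Rightarrow> 'g \<Rightarrow> 'g" where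
  "gsrc G g = gmult G (ginv G g) g"

definition grng :: "('g, 'z) top_groupoid_scheme \<Rightarrow> 'g \<Rightarrow> 'g" where
  "grng G g = gmult G g (ginv G g)"

definition composable :: "('g, 'z) top_groupoid_scheme \<Rightarrow> ('g \<times> 'g) set" where
  "composable G = {(g, h). g \<in> garrows G \<and> h \<in> garrows G \<and> gsrc G g = grng G h}"

definition gunits :: "('g, 'z) top_groupoid_scheme \<Rightarrow> 'g set" where
  "gunits G = grng G ` garrows G"

abbreviation unit_top :: "('g, 'z) top_groupoid_scheme \<Rightarrow> 'g topology" where
  "unit_top G \<equiv> subtopology (gtop G) (gunits G)"

definition groupoid :: "('g, 'z) top_groupoid_scheme \<Rightarrow> bool" where
  "groupoid G \<longleftrightarrow>
     (\<forall>g \<in> garrows G. ginv G g \<in> garrows G \<and> ginv G (ginv G g) = g) \<and>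
     (\<forall>(g, h) \<in> composable G. gmult G g h \<in> garrows G \<and>
        gsrc G (gmult G g h) = gsrc G h \<and> grng G (gmult G g h) = grng G g \<and>
        gmult G (ginv G g) (gmult G g h) = h \<and> gmult G (gmult G g h) (ginv G h) = g) \<and>
     (\<forall>g h k. (g, h) \<in> composable G \<and> (h, k) \<in> composable G \<longrightarrow>
        gmult G (gmult G g h) k = gmult G g (gmult G h k))"

definition topological_groupoid :: "('g, 'z) top_groupoid_scheme \<Rightarrow> bool" where
  "topological_groupoid G \<longleftrightarrow> groupoid G \<and>
     continuous_map (subtopology (prod_topology (gtop G) (gtop G)) (composable G)) (gtop G)
       (\<lambda>(g, h). gmult G g h) \<and>
     continuous_map (gtop G) (gtop G) (ginv G)"

definition local_homeomorphism_map :: "'a topology \<Rightarrow> 'b topology \<Rightarrow> ('a \<Rightarrow> 'b) \<Rightarrow> bool" where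
  "local_homeomorphism_map X Y f \<longleftrightarrow>
     (\<forall>x \<in> topspace X. \<exists>U. openin X U \<and> x \<in> U \<and> openin Y (f ` U) \<and>
        homeomorphic_map (subtopology X U) (subtopology Y (f ` U)) f)"

definition etale :: "('g, 'z) top_groupoid_scheme \<Rightarrow> bool" where
  "etale G \<longleftrightarrow> topological_groupoid G \<and> second_countable (gtop G) \<and>
     locally_compact_space (gtop G) \<and> Hausdorff_space (gtop G) \<and>
     local_homeomorphism_map (gtop G) (unit_top G) (grng G)"

definition totally_disconnected_space :: "'a topology \<Rightarrow> bool" where
  "totally_disconnected_space X \<longleftrightarrow> (\<forall>S. connectedin X S \<longrightarrow> (\<exists>a. S \<subseteq> {a}))"

definition ample :: "('g, 'z) top_groupoid_scheme \<Rightarrow> bool" where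
  "ample G \<longleftrightarrow> etale G \<and> totally_disconnected_space (unit_top G)"

definition cantor_space :: "'a topology \<Rightarrow> bool" where
  "cantor_space X \<longleftrightarrow>
     X homeomorphic_space product_topology (\<lambda>_::nat. discrete_topology (UNIV :: bool set)) UNIV"

definition minimal_groupoid :: "('g, 'z) top_groupoid_scheme \<Rightarrow> bool" where
  "minimal_groupoid G \<longleftrightarrow>
     (\<forall>x \<in> gunits G. unit_top G closure_of (grng G ` {g \<in> garrows G. gsrc G g = x}) = gunits G)"

definition isotropy :: "('g, 'z) top_groupoid_scheme \<Rightarrow> 'g set" where
  "isotropy G = {g \<in> garrows G. grng G g = gsrc G g}"

definition effective :: "('g, 'z) top_groupoid_scheme \<Rightarrow> bool" where
  "effective G \<longleftrightarrow> gtop G interior_of isotropy G = gunits G"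

definition principal :: "('g, 'z) top_groupoid_scheme \<Rightarrow> bool" where
  "principal G \<longleftrightarrow> isotropy G = gunits G"

definition bisection :: "('g, 'z) top_groupoid_scheme \<Rightarrow> 'g set \<Rightarrow> bool" where
  "bisection G U \<longleftrightarrow> U \<subseteq> garrows G \<and> inj_on (grng G) U \<and> inj_on (gsrc G) U"

definition compact_open_bisection :: "('g, 'z) top_groupoid_scheme \<Rightarrow> 'g set \<Rightarrow> bool" where
  "compact_open_bisection G U \<longleftrightarrow>
     bisection G U \<and> compactin (gtop G) U \<and> openin (gtop G) U"


section \<open>Almost finite and purely infinite groupoids\<close>

definition subgroupoid :: "('g, 'z) top_groupoid_scheme \<Rightarrow> 'g set \<Rightarrow> bool" where
  "subgroupoid G K \<longleftrightarrow> K \<subseteq> garrows G \<and> (\<forall>g \<in> K. ginv G g \<in> K) \<and>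
     (\<forall>(g, h) \<in> composable G. g \<in> K \<longrightarrow> h \<in> K \<longrightarrow> gmult G g h \<in> K)"

definition restrict_groupoid ::
    "('g, 'z) top_groupoid_scheme \<Rightarrow> 'g set \<Rightarrow> ('g, 'z) top_groupoid_scheme" where
  "restrict_groupoid G K = G\<lparr>gtop := subtopology (gtop G) K\<rparr>"

definition elementary_subgroupoid :: "('g, 'z) top_groupoid_scheme \<Rightarrow> 'g set \<Rightarrow> bool" where
  "elementary_subgroupoid G K \<longleftrightarrow>
     subgroupoid G K \<and> compactin (gtop G) K \<and> openin (gtop G) K \<and>
     principal (restrict_groupoid G K) \<and> gunits (restrict_groupoid G K) = gunits G"

definition almost_finite :: "('g, 'z) top_groupoid_scheme \<Rightarrow> bool" where
  "almost_finite G \<longleftrightarrow>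
     (\<forall>C (\<epsilon>::real). compactin (gtop G) C \<and> 0 < \<epsilon> \<longrightarrow>
       (\<exists>K. elementary_subgroupoid G K \<and>
         (\<forall>x \<in> gunits G.
            let Kx = {k \<in> K. gsrc G k = x};
                CKx = {gmult G c k | c k. c \<in> C \<and> k \<in> Kx \<and> (c, k) \<in> composable G}
            in real (card (CKx - Kx)) / real (card Kx) < \<epsilon>)))"

definition purely_infinite :: "('g, 'z) top_groupoid_scheme \<Rightarrow> bool" where
  "purely_infinite G \<longleftrightarrow>
     (\<forall>A. openin (unit_top G) A \<and> closedin (unit_top G) A \<longrightarrow>
       (\<exists>U V. compact_open_bisection G U \<and> compact_open_bisection G V \<and>
          gsrc G ` U = A \<and> gsrc G ` V = A \<and>
          grng G ` U \<inter> grng G ` V = {} \<and> grng G ` U \<union> grng G ` V \<subseteq> A))"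


section \<open>Full groups\<close>

definition full_bisection :: "('g, 'z) top_groupoid_scheme \<Rightarrow> 'g set \<Rightarrow> bool" where
  "full_bisection G U \<longleftrightarrow> compact_open_bisection G U \<and>
     grng G ` U = gunits G \<and> gsrc G ` U = gunits G"

definition bisection_map :: "('g, 'z) top_groupoid_scheme \<Rightarrow> 'g set \<Rightarrow> 'g \<Rightarrow> 'g" where
  "bisection_map G U = (\<lambda>x \<in> gunits G. grng G (the_inv_into U (gsrc G) x))"

definition full_group :: "('g, 'z) top_groupoid_scheme \<Rightarrow> ('g \<Rightarrow> 'g) monoid" where
  "full_group G =
     BijGroup (gunits G)\<lparr>carrier := {bisection_map G U | U. full_bisection G U}\<rparr>"

definition commutator_subgroup :: "('a, 'b) monoid_scheme \<Rightarrow> 'a set" where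
  "commutator_subgroup \<Gamma> = derived \<Gamma> (carrier \<Gamma>)"

definition commutator_full_group :: "('g, 'z) top_groupoid_scheme \<Rightarrow> ('g \<Rightarrow> 'g) monoid" where
  "commutator_full_group G = full_group G\<lparr>carrier := commutator_subgroup (full_group G)\<rparr>"

definition H1 :: "('a, 'b) monoid_scheme \<Rightarrow> 'a set monoid" where
  "H1 \<Gamma> = \<Gamma> Mod commutator_subgroup \<Gamma>"

text \<open>For a homomorphism \<open>\<phi>\<close>, the coset of \<open>g\<close> is sent to the coset of \<open>\<phi> g\<close>.\<close>

definition H1_map ::
    "('a, 'c) monoid_scheme \<Rightarrow> ('b, 'd) monoid_scheme \<Rightarrow> ('a \<Rightarrow> 'b) \<Rightarrow> 'a set \<Rightarrow> 'b set" where
  "H1_map \<Gamma> \<Delta> \<phi> = (\<lambda>X \<in> carrier (H1 \<Gamma>). commutator_subgroup \<Delta> <#>\<^bsub>\<Delta>\<^esub> \<phi> ` X)"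

definition maximal_subgroup :: "'a set \<Rightarrow> ('a, 'b) monoid_scheme \<Rightarrow> bool" where
  "maximal_subgroup M \<Gamma> \<longleftrightarrow> subgroup M \<Gamma> \<and> M \<noteq> carrier \<Gamma> \<and>
     (\<forall>K. subgroup K \<Gamma> \<and> M \<subseteq> K \<longrightarrow> K = M \<or> K = carrier \<Gamma>)"


section \<open>Actions of a cyclic group and semidirect products\<close>

definition groupoid_automorphism :: "('g, 'z) top_groupoid_scheme \<Rightarrow> ('g \<Rightarrow> 'g) \<Rightarrow> bool" where
  "groupoid_automorphism G f \<longleftrightarrow> homeomorphic_map (gtop G) (gtop G) f \<and>
     (\<forall>(g, h) \<in> composable G.
        (f g, f h) \<in> composable G \<and> f (gmult G g h) = gmult G (f g) (f h))"

text \<open>\<open>integer_mod_group p\<close> has carrier \<open>{0..<int p}\<close> for \<open>p > 0\<close>.\<close>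

definition groupoid_action ::
    "nat \<Rightarrow> ('g, 'z) top_groupoid_scheme \<Rightarrow> (int \<Rightarrow> 'g \<Rightarrow> 'g) \<Rightarrow> bool" where
  "groupoid_action p G lam \<longleftrightarrow>
     group_action (integer_mod_group p) (garrows G) lam \<and>
     (\<forall>a \<in> carrier (integer_mod_group p). groupoid_automorphism G (lam a))"

definition free_on_units ::
    "nat \<Rightarrow> ('g, 'z) top_groupoid_scheme \<Rightarrow> (int \<Rightarrow> 'g \<Rightarrow> 'g) \<Rightarrow> bool" where
  "free_on_units p G lam \<longleftrightarrow>
     (\<forall>a \<in> carrier (integer_mod_group p). \<forall>x \<in> gunits G.
        lam a x = x \<longrightarrow> a = \<one>\<^bsub>integer_mod_group p\<^esub>)"

definition semidirect ::
    "nat \<Rightarrow> 'g top_groupoid \<Rightarrow> (int \<Rightarrow> 'g \<Rightarrow> 'g) \<Rightarrow> ('g \<times> int) top_groupoid" where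
  "semidirect p G lam =
     \<lparr>gtop = prod_topology (gtop G) (discrete_topology (carrier (integer_mod_group p))),
      gmult = (\<lambda>(g, a) (h, b). (gmult G g (lam a h), a \<otimes>\<^bsub>integer_mod_group p\<^esub> b)),
      ginv = (\<lambda>(g, a). let a' = inv\<^bsub>integer_mod_group p\<^esub> a in (lam a' (ginv G g), a'))\<rparr>"

text \<open>The unit space of the semidirect product is \<open>gunits G \<times> {0}\<close>, identified with
  \<open>gunits G\<close>. The following map transports a self-map of \<open>gunits G\<close> along \<open>x \<mapsto> (x, 0)\<close>. On
  the full group of \<open>G\<close> it is the inclusion into the full group of the semidirect product, sending
  the homeomorphism of a full bisection \<open>U\<close> to that of \<open>U \<times> {0}\<close>; applied to \<open>lam a\<close> it gives
  the homeomorphism of the full bisection \<open>gunits G \<times> {a}\<close>.\<close>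

definition lift_units ::
    "nat \<Rightarrow> 'g top_groupoid \<Rightarrow> (int \<Rightarrow> 'g \<Rightarrow> 'g) \<Rightarrow> ('g \<Rightarrow> 'g) \<Rightarrow> ('g \<times> int) \<Rightarrow> ('g \<times> int)" where
  "lift_units p G lam f = (\<lambda>y \<in> gunits (semidirect p G lam). (f (fst y), snd y))"

definition internal_semidirect ::
    "nat \<Rightarrow> 'g top_groupoid \<Rightarrow> (int \<Rightarrow> 'g \<Rightarrow> 'g) \<Rightarrow>
      (('g \<times> int) \<Rightarrow> ('g \<times> int)) set \<Rightarrow> (('g \<times> int) \<Rightarrow> ('g \<times> int)) set" where
  "internal_semidirect p G lam S =
     generate (full_group (semidirect p G lam))
       (S \<union> {lift_units p G lam (lam a) | a. a \<in> carrier (integer_mod_group p)})"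

text \<open>The source and range maps of the semidirect product come out as expected.\<close>

lemma semidirect_grng:
  assumes "groupoid_action p G lam" "groupoid G" "g \<in> garrows G"
    and a: "a \<in> carrier (integer_mod_group p)"
  shows "grng (semidirect p G lam) (g, a) = (grng G g, \<one>\<^bsub>integer_mod_group p\<^esub>)"
proof -
  let ?Z = "integer_mod_group p"
  interpret group_action ?Z "garrows G" lam
    using assms(1) by (simp add: groupoid_action_def)
  interpret Z: group ?Z
    using group_hom group_hom.axioms(1) by blast
  have "ginv G g \<in> garrows G"
    using assms(2,3) by (auto simp: groupoid_def)
  then have "lam a (lam (inv\<^bsub>?Z\<^esub> a) (ginv G g)) = ginv G g"
    by (metis Z.inv_closed Z.inv_inv a orbit_sym_aux)
  then show ?thesis
    using Z.r_inv[OF a] by (simp add: grng_def semidirect_def Let_def del: inv_integer_mod_group)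
qed

lemma semidirect_gsrc:
  assumes "groupoid_action p G lam" "groupoid G" "g \<in> garrows G"
    and a: "a \<in> carrier (integer_mod_group p)"
  shows "gsrc (semidirect p G lam) (g, a) =
    (lam (inv\<^bsub>integer_mod_group p\<^esub> a) (gsrc G g), \<one>\<^bsub>integer_mod_group p\<^esub>)"
proof -
  let ?Z = "integer_mod_group p"
  interpret group_action ?Z "garrows G" lam
    using assms(1) by (simp add: groupoid_action_def)
  interpret Z: group ?Z
    using group_hom group_hom.axioms(1) by blast
  have i: "ginv G g \<in> garrows G" "ginv G (ginv G g) = g"
    using assms(2,3) by (auto simp: groupoid_def)
  then have "(ginv G g, g) \<in> composable G"
    using assms(3) by (simp add: composable_def gsrc_def grng_def)
  moreover have "groupoid_automorphism G (lam (inv\<^bsub>?Z\<^esub> a))"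
    using assms(1) Z.inv_closed[OF a] by (auto simp only: groupoid_action_def)
  ultimately have "lam (inv\<^bsub>?Z\<^esub> a) (gsrc G g) =
      gmult G (lam (inv\<^bsub>?Z\<^esub> a) (ginv G g)) (lam (inv\<^bsub>?Z\<^esub> a) g)"
    by (auto simp: groupoid_automorphism_def gsrc_def)
  then show ?thesis
    using Z.l_inv[OF a] by (simp add: gsrc_def semidirect_def Let_def del: inv_integer_mod_group)
qed

lemma semidirect_gunits:
  assumes "groupoid_action p G lam" "groupoid G"
  shows "gunits (semidirect p G lam) = gunits G \<times> {\<one>\<^bsub>integer_mod_group p\<^esub>}"
proof -
  let ?Z = "integer_mod_group p"
  have arr: "garrows (semidirect p G lam) = garrows G \<times> carrier ?Z"
    by (simp add: semidirect_def)
  have "\<one>\<^bsub>?Z\<^esub> \<in> carrier ?Z"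
    by (rule monoid.one_closed) (simp add: group.is_monoid)
  then show ?thesis
    unfolding gunits_def arr using semidirect_grng[OF assms]
    by (force simp del: one_integer_mod_group simp: image_iff)
qed

end

theory Submission
  imports Defs
begin

text \<open>
  An element of \<open>F(H)\<close> is locally an element of the pseudogroup of \<open>G\<close> composed with some \<open>\<lambda>\<^sub>a\<close>, and
  effectiveness of \<open>H\<close> makes the degree \<open>a\<close> at each point well defined. The elements of \<open>F(G)\<close> are
  those of degree 0 everywhere, and those of constant degree form \<open>F(G) \<rtimes> \<int>/p\<close>.

  Suppose that \<open>f\<close> has two different degrees. Conjugating by \<open>f\<close> a small three-cycle of \<open>D(G)\<close> that meets
  both regions gives a three-cycle of nonzero degree. Hence \<open>f\<close> does not normalize \<open>D(G)\<close>, which yields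
  the normalizer. Moreover, by minimality of \<open>G\<close> and since \<open>p\<close> is prime, conjugating three-cycles by
  three-cycles produces every three-cycle of \<open>H\<close> from this one and \<open>D(G)\<close>. So a subgroup of \<open>D(H)\<close>
  containing \<open>D(G)\<close> and \<open>f\<close> is everything, because \<open>D(H)\<close> is generated by three-cycles: two elements
  commute modulo three-cycles as soon as a three-cycle moves the support of one off the support of the
  other. In the purely infinite case \<open>F(H)\<close> is generated by elements that fix a nonempty open set, and
  these can be so moved. In the almost finite case one elementary subgroupoid that is nearly invariant
  under two given elements writes both as products of elements of small support.

  For \<open>p \<ge> 3\<close>, a fundamental domain of the action provides an involution in \<open>F(H)\<close> that inverts every
  \<open>\<lambda>\<^sub>a\<close>, so the squares of the \<open>\<lambda>\<^sub>a\<close> are commutators.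
\<close>

section \<open>Graded pseudogroups on a Boolean space\<close>

text \<open>Near a point only two things matter about an element of \<open>F\<close>: its degree
  there, and which finitely many values have to be kept apart. Hence the argument runs in an
  abstract graded pseudogroup. Whether a three-cycle lies in a subgroup is a local question, because
  cycles over disjoint bases multiply and compactness leaves finitely many pieces. So a three-cycle
  is treated as a triple of germs at one point, recorded by three degrees. Two cycles that share a
  leg conjugate one another into new ones, and a spare leg of any degree exists by minimality and
  the lack of isolated points. From degrees (d, d + c, d + c), with c nonzero modulo p, one reaches
  (d, d, d + k c) for all k, hence every triple since c is invertible modulo p. Three-cycles are
  used instead of swaps because a three-cycle is a commutator of two swaps, whereas a swap need not
  be a product of commutators. Conditions (1) and (2) both unfold to the inclusion of
  \<open>F0 \<inter> D\<close> in \<open>D0\<close>. That (3) implies (2) rests on the normalizer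
  being proper: \<open>D\<close> has an element of mixed degree.\<close>

lemma the_inv_into_image_Int:
  assumes "inj_on f A"
  shows "the_inv_into A f ` (f ` A \<inter> B) = {x \<in> A. f x \<in> B}"
proof -
  have "f ` A \<inter> B = f ` {x \<in> A. f x \<in> B}" by auto
  then show ?thesis using assms by (simp add: image_image the_inv_into_f_f)
qed

text \<open>A compact Hausdorff space with a base of clopen sets and no isolated points, presented
  by its Boolean algebra of clopen sets so that no topology has to be carried along.
  \<open>CL_infinite\<close> encodes the absence of isolated points.\<close>

locale boolean_space =
  fixes X :: "'x set" and CL :: "'x set set"
  assumes CL_subset: "A \<in> CL \<Longrightarrow> A \<subseteq> X"
    and CL_X [simp]: "X \<in> CL"
    and CL_Un: "\<lbrakk>A \<in> CL; B \<in> CL\<rbrakk> \<Longrightarrow> A \<union> B \<in> CL"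
    and CL_Diff: "\<lbrakk>A \<in> CL; B \<in> CL\<rbrakk> \<Longrightarrow> A - B \<in> CL"
    and separation: "\<lbrakk>x \<in> X; y \<in> X; x \<noteq> y\<rbrakk> \<Longrightarrow> \<exists>A \<in> CL. x \<in> A \<and> y \<notin> A"
    and compactness: "\<lbrakk>\<U> \<subseteq> CL; X \<subseteq> \<Union>\<U>\<rbrakk> \<Longrightarrow> \<exists>\<V>. finite \<V> \<and> \<V> \<subseteq> \<U> \<and> X \<subseteq> \<Union>\<V>"
    and CL_infinite: "\<lbrakk>A \<in> CL; A \<noteq> {}\<rbrakk> \<Longrightarrow> infinite A"
    and X_nonempty: "X \<noteq> {}"
begin

lemma CL_Int: "\<lbrakk>A \<in> CL; B \<in> CL\<rbrakk> \<Longrightarrow> A \<inter> B \<in> CL"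
  using CL_Diff[of A "A - B"] CL_Diff[of A B] by (simp add: Diff_Diff_Int)

lemma CL_empty [simp]: "{} \<in> CL"
  using CL_Diff[OF CL_X CL_X] by simp

lemma CL_Union: "\<lbrakk>finite \<V>; \<V> \<subseteq> CL\<rbrakk> \<Longrightarrow> \<Union>\<V> \<in> CL"
  by (induction rule: finite_induct) (auto intro: CL_Un)

text \<open>The local-to-global principle behind most of the development. Finitely many good
  neighbourhoods cover \<open>A\<close>; subtracting from each the union of the earlier ones makes
  them disjoint, and \<open>mono\<close> keeps the remainders good. This is why \<open>union\<close>
  has to treat disjoint sets only.\<close>

lemma clopen_induct [consumes 1, case_names empty local mono union]:
  assumes A: "A \<in> CL" and empty: "Q {}"
    and local: "\<And>x. x \<in> A \<Longrightarrow> \<exists>N \<in> CL. x \<in> N \<and> N \<subseteq> A \<and> Q N"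
    and mono: "\<And>B C. \<lbrakk>B \<in> CL; C \<in> CL; C \<subseteq> B; B \<subseteq> A; Q B\<rbrakk> \<Longrightarrow> Q C"
    and union: "\<And>B C. \<lbrakk>B \<in> CL; C \<in> CL; B \<subseteq> A; C \<subseteq> A; B \<inter> C = {}; Q B; Q C\<rbrakk> \<Longrightarrow> Q (B \<union> C)"
  shows "Q A"
proof -
  let ?\<U> = "{N \<in> CL. N \<subseteq> A \<and> Q N}"
  \<comment> \<open>Compactness is stated for covers of \<open>X\<close> only, so the complement of
    \<open>A\<close> joins the cover and is dropped again at the end.\<close>
  have cov: "X \<subseteq> \<Union>(insert (X - A) ?\<U>)"
  proof
    fix x assume x: "x \<in> X"
    show "x \<in> \<Union>(insert (X - A) ?\<U>)"
    proof (cases "x \<in> A")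
      case True
      then obtain N where "N \<in> CL" "x \<in> N" "N \<subseteq> A" "Q N" using local[OF True] by blast
      then show ?thesis by (intro UnionI[of N]) simp_all
    next
      case False
      then show ?thesis using x by simp
    qed
  qed
  have sub: "insert (X - A) ?\<U> \<subseteq> CL" using CL_Diff[OF CL_X A] by simp
  obtain \<V> where \<V>: "finite \<V>" "\<V> \<subseteq> insert (X - A) ?\<U>" "X \<subseteq> \<Union>\<V>"
    using compactness[OF sub cov] by (elim exE conjE) (rule that)
  have *: "\<Union>\<W> \<in> CL \<and> \<Union>\<W> \<subseteq> A \<and> Q (\<Union>\<W>)" if "finite \<W>" "\<W> \<subseteq> ?\<U>" for \<W>
    using that
  proof (induction rule: finite_induct)
    case empty then show ?case using assms(2) by simp
  next
    case (insert N \<W>)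
    then have N: "N \<in> CL" "N \<subseteq> A" "Q N" and W: "\<Union>\<W> \<in> CL" "\<Union>\<W> \<subseteq> A" "Q (\<Union>\<W>)" by auto
    let ?D = "N - \<Union>\<W>"
    have D: "?D \<in> CL" "?D \<subseteq> A" using CL_Diff[OF N(1) W(1)] N(2) by auto
    then have "Q ?D" using mono[OF N(1) D(1) _ N(2,3)] by simp
    then have "Q (\<Union>\<W> \<union> ?D)" using union[OF W(1) D(1) W(2) D(2) _ W(3)] by simp
    moreover have "\<Union>\<W> \<union> ?D = \<Union>(insert N \<W>)" by auto
    ultimately have "Q (\<Union>(insert N \<W>))" by simp
    moreover have "\<Union>(insert N \<W>) \<in> CL" using CL_Un[OF N(1) W(1)] by simp
    ultimately show ?case using N(2) W(2) by simp
  qed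
  let ?\<W> = "\<V> - {X - A}"
  have "?\<W> \<subseteq> ?\<U>" 
  proof
    fix N assume "N \<in> ?\<W>"
    then have "N \<in> insert (X - A) ?\<U>" "N \<noteq> X - A" using \<V>(2) by auto
    then show "N \<in> ?\<U>" by simp
  qed
  then have W: "\<Union>?\<W> \<subseteq> A" "Q (\<Union>?\<W>)" using *[of ?\<W>] \<V>(1) by simp_all
  have "A \<subseteq> \<Union>?\<W>"
  proof
    fix x assume x: "x \<in> A"
    then obtain N where "N \<in> \<V>" "x \<in> N" using \<V>(3) CL_subset[OF A] by blast
    then show "x \<in> \<Union>?\<W>" using x by (intro UnionI[of N]) auto
  qed
  then have "\<Union>?\<W> = A" using W(1) by simp
  then show ?thesis using W(2) by simp
qed

lemma separate_finite:
  assumes "finite F" "x \<in> X" "x \<notin> F"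
  shows "\<exists>A \<in> CL. x \<in> A \<and> A \<inter> F = {}"
  using assms
proof (induction rule: finite_induct)
  case empty then show ?case using CL_X by blast
next
  case (insert y F)
  then obtain A where A: "A \<in> CL" "x \<in> A" "A \<inter> F = {}" by auto
  obtain B where "B \<in> CL" "x \<in> B" "y \<notin> B"
  proof (cases "y \<in> X")
    case True then show ?thesis using separation[of x y] insert.prems that by (metis insertI1)
  next
    case False then show ?thesis using that[OF CL_X] insert.prems(1) by simp
  qed
  with A show ?case by (intro bexI[of _ "A \<inter> B"] CL_Int) auto
qed

text \<open>The source of free room: points and levels can always be chosen away from finitely many
  positions already in use.\<close>

lemma clopen_avoiding:
  assumes "B \<in> CL" "B \<noteq> {}" "finite F"
  shows "\<exists>A \<in> CL. A \<noteq> {} \<and> A \<subseteq> B \<and> A \<inter> F = {}"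
proof -
  have "\<not> B \<subseteq> F" using CL_infinite[OF assms(1,2)] finite_subset[OF _ assms(3)] by metis
  then obtain b where b: "b \<in> B" "b \<notin> F" by auto
  have "b \<in> X" using b(1) CL_subset[OF assms(1)] by auto
  from separate_finite[OF assms(3) this b(2)]
  obtain A where "A \<in> CL" "b \<in> A" "A \<inter> F = {}" by (elim bexE conjE)
  then show ?thesis using CL_Int[OF assms(1), of A] b by (intro bexI[of _ "B \<inter> A"]) auto
qed

lemma disjoint_neighbourhoods:
  assumes "x \<in> X" "y \<in> X" "x \<noteq> y"
  shows "\<exists>A \<in> CL. \<exists>B \<in> CL. x \<in> A \<and> y \<in> B \<and> A \<inter> B = {}"
proof -
  obtain A where "A \<in> CL" "x \<in> A" "y \<notin> A" using separation assms by blast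
  moreover have "X - A \<in> CL" using CL_Diff[OF CL_X \<open>A \<in> CL\<close>] .
  moreover have "y \<in> X - A" "A \<inter> (X - A) = {}" using assms(2) \<open>y \<notin> A\<close> by auto
  ultimately show ?thesis by metis
qed

end

text \<open>\<open>P c A f\<close> says that on the clopen set \<open>A\<close> the map \<open>f\<close> is given by an element of degree \<open>c\<close> of the
  pseudogroup, where degrees are integers modulo \<open>p\<close>; the values of \<open>f\<close> outside \<open>A\<close> are irrelevant.\<close>

locale graded_pseudogroup = boolean_space X CL for X :: "'x set" and CL +
  fixes p :: nat
    and P :: "int \<Rightarrow> 'x set \<Rightarrow> ('x \<Rightarrow> 'x) \<Rightarrow> bool"
    and L :: "int \<Rightarrow> 'x \<Rightarrow> 'x"
  assumes prime_p: "prime p"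
    and P_clopen: "P c A f \<Longrightarrow> A \<in> CL"
    and P_image: "P c A f \<Longrightarrow> f ` A \<in> CL"
    and P_inj: "P c A f \<Longrightarrow> inj_on f A"
    and P_restrict: "\<lbrakk>P c A f; B \<in> CL; B \<subseteq> A\<rbrakk> \<Longrightarrow> P c B f"
    and P_cong: "\<lbrakk>P c A f; \<And>x. x \<in> A \<Longrightarrow> g x = f x\<rbrakk> \<Longrightarrow> P c A g"
    and P_comp: "\<lbrakk>P c A f; P d (f ` A) g\<rbrakk> \<Longrightarrow> P (c + d) A (\<lambda>x. g (f x))"
    and P_inv: "\<lbrakk>P c A f; \<And>x. x \<in> A \<Longrightarrow> g (f x) = x\<rbrakk> \<Longrightarrow> P (- c) (f ` A) g"
    and P_id: "A \<in> CL \<Longrightarrow> P 0 A (\<lambda>x. x)"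
    and P_Un: "\<lbrakk>P c A f; P c B f; inj_on f (A \<union> B); A \<inter> B = {}\<rbrakk> \<Longrightarrow> P c (A \<union> B) f"
    and P_dvd: "\<lbrakk>P c A f; int p dvd c - d\<rbrakk> \<Longrightarrow> P d A f"
    and P_unique: "\<lbrakk>P c A f; P d A f; A \<noteq> {}\<rbrakk> \<Longrightarrow> int p dvd c - d"
    and P_minimal: "\<lbrakk>x \<in> X; B \<in> CL; B \<noteq> {}\<rbrakk> \<Longrightarrow> \<exists>A f. x \<in> A \<and> P 0 A f \<and> f x \<in> B"
    and L_P: "P a X (L a)"
    and L_extensional: "L a \<in> extensional X"
    and L_image: "L a ` X = X"
    and L_add: "x \<in> X \<Longrightarrow> L (a + b) x = L a (L b x)"
    and L_0: "x \<in> X \<Longrightarrow> L 0 x = x"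
    and L_free: "\<lbrakk>x \<in> X; L a x = x\<rbrakk> \<Longrightarrow> int p dvd a"
    and L_dvd: "\<lbrakk>int p dvd a; x \<in> X\<rbrakk> \<Longrightarrow> L a x = x"
begin

text \<open>A relation and not a function: by \<open>deg_at_dvd\<close> and
  \<open>deg_at_unique\<close> the degrees of a germ form exactly one residue class modulo
  \<open>p\<close>.\<close>

definition deg_at :: "int \<Rightarrow> ('x \<Rightarrow> 'x) \<Rightarrow> 'x \<Rightarrow> bool" where
  "deg_at c f x \<longleftrightarrow> (\<exists>N. x \<in> N \<and> P c N f)"

text \<open>The ungraded pseudogroup: in contrast to \<open>P\<close>, the degree may change from
  point to point.\<close>

definition Q :: "'x set \<Rightarrow> ('x \<Rightarrow> 'x) \<Rightarrow> bool" where
  "Q A f \<longleftrightarrow> A \<in> CL \<and> inj_on f A \<and> (\<forall>x \<in> A. \<exists>c. deg_at c f x)"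

text \<open>In the instance at the end this becomes the full group of the semidirect product, and
  \<open>F0\<close> becomes the image of the full group of \<open>G\<close>.\<close>

definition F :: "('x \<Rightarrow> 'x) set" where
  "F = {f \<in> extensional X. bij_betw f X X \<and> (\<forall>x \<in> X. \<exists>c. deg_at c f x)}"

definition F0 :: "('x \<Rightarrow> 'x) set" where
  "F0 = {f \<in> F. \<forall>x \<in> X. deg_at 0 f x}"

lemma P_imp_deg_at: "\<lbrakk>P c A f; x \<in> A\<rbrakk> \<Longrightarrow> deg_at c f x"
  by (auto simp: deg_at_def)

lemma P_imp_Q: "P c A f \<Longrightarrow> Q A f"
  by (auto simp: Q_def P_clopen P_inj intro: P_imp_deg_at)

lemma deg_at_nbhd:
  assumes "deg_at c f x" "M \<in> CL" "x \<in> M"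
  shows "\<exists>N. x \<in> N \<and> N \<subseteq> M \<and> N \<in> CL \<and> P c N f"
proof -
  obtain N where N: "x \<in> N" "P c N f" using assms by (auto simp: deg_at_def)
  then have "P c (N \<inter> M) f" using P_restrict CL_Int P_clopen assms(2) by (meson Int_lower1)
  then show ?thesis using N assms P_clopen by blast
qed

lemma deg_at_in_X: "deg_at c f x \<Longrightarrow> x \<in> X"
  unfolding deg_at_def using P_clopen CL_subset by blast

lemma deg_at_image_in_X: "deg_at c f x \<Longrightarrow> f x \<in> X"
  unfolding deg_at_def using P_image CL_subset by blast

lemma deg_at_cong:
  assumes "deg_at c f x" "M \<in> CL" "x \<in> M" "\<And>y. y \<in> M \<Longrightarrow> g y = f y"
  shows "deg_at c g x"
  using deg_at_nbhd[OF assms(1-3)] P_cong assms(4) unfolding deg_at_def by blast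

text \<open>The axioms provide images, not preimages; the preimage is the image of a clopen set
  under the inverse partial map.\<close>

lemma P_preimage:
  assumes "P c A f" "B \<in> CL"
  shows "{x \<in> A. f x \<in> B} \<in> CL"
proof -
  let ?g = "the_inv_into A f"
  have inj: "inj_on f A" using P_inj assms(1) .
  have "P (- c) (f ` A) ?g" using P_inv[OF assms(1)] the_inv_into_f_f[OF inj] by blast
  from P_restrict[OF this CL_Int[OF P_image[OF assms(1)] assms(2)] Int_lower1]
  have "P (- c) (f ` A \<inter> B) ?g" .
  then have "?g ` (f ` A \<inter> B) \<in> CL" by (rule P_image)
  moreover have "?g ` (f ` A \<inter> B) = {x \<in> A. f x \<in> B}"
    by (rule the_inv_into_image_Int[OF inj])
  ultimately show ?thesis by simp
qed

lemma deg_at_comp: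
  assumes "deg_at c f x" "deg_at d g (f x)"
  shows "deg_at (c + d) (\<lambda>x. g (f x)) x"
proof -
  obtain N where N: "x \<in> N" "P c N f" using assms(1) unfolding deg_at_def by metis
  obtain M where M: "f x \<in> M" "P d M g" using assms(2) unfolding deg_at_def by metis
  let ?N = "{y \<in> N. f y \<in> M}"
  have c: "?N \<in> CL" using P_preimage N M P_clopen by blast
  then have 1: "P c ?N f" using P_restrict N(2) by blast
  then have "P d (f ` ?N) g" using P_restrict[OF M(2)] P_image by blast
  then have "P (c + d) ?N (\<lambda>x. g (f x))" by (rule P_comp[OF 1])
  moreover have "x \<in> ?N" using N M by blast
  ultimately show ?thesis unfolding deg_at_def by metis
qed

lemma deg_at_inv:
  assumes "deg_at c f x" "M \<in> CL" "x \<in> M" "\<And>y. y \<in> M \<Longrightarrow> g (f y) = y"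
  shows "deg_at (- c) g (f x)"
  using deg_at_nbhd[OF assms(1-3)] P_inv assms(4) unfolding deg_at_def by (metis imageI subsetD)

lemma deg_at_id: "x \<in> X \<Longrightarrow> deg_at 0 (\<lambda>x. x) x"
  using P_id[OF CL_X] by (auto simp: deg_at_def)

lemma deg_at_dvd: "\<lbrakk>deg_at c f x; int p dvd c - d\<rbrakk> \<Longrightarrow> deg_at d f x"
  using P_dvd by (auto simp: deg_at_def)

lemma deg_at_unique:
  assumes "deg_at c f x" "deg_at d f x"
  shows "int p dvd c - d"
proof -
  obtain N where N: "x \<in> N" "P c N f" using assms by (auto simp: deg_at_def)
  then obtain M where "x \<in> M" "M \<subseteq> N" "M \<in> CL" "P d M f" using deg_at_nbhd[OF assms(2)] P_clopen
    by metis
  then show ?thesis using P_unique[of c M f d] P_restrict[OF N(2)] by blast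
qed

lemma deg_at_L: "x \<in> X \<Longrightarrow> deg_at a (L a) x"
  using L_P by (auto simp: deg_at_def)

text \<open>Having degree \<open>c\<close> is a local property: pieces of degree \<open>c\<close>
  are glued by \<open>P_Un\<close>. From here on degrees are checked point by point.\<close>

lemma P_iff: "P c A f \<longleftrightarrow> A \<in> CL \<and> inj_on f A \<and> (\<forall>x \<in> A. deg_at c f x)"
proof
  assume "P c A f" then show "A \<in> CL \<and> inj_on f A \<and> (\<forall>x \<in> A. deg_at c f x)"
    using P_clopen P_inj P_imp_deg_at by simp
next
  assume R: "A \<in> CL \<and> inj_on f A \<and> (\<forall>x \<in> A. deg_at c f x)"
  then have "A \<in> CL" by blast
  then show "P c A f"
  proof (induction rule: clopen_induct)
    case empty
    \<comment> \<open>The empty map has every degree; \<open>L c\<close> is an element of degree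
      \<open>c\<close> at hand to restrict.\<close>
    have "P c {} (L c)" using P_restrict[OF L_P, of "{}"] by simp
    then show ?case by (rule P_cong) simp
  next
    case (local x)
    then show ?case using deg_at_nbhd[of c f x A] R by metis
  next
    case (mono B C)
    then show ?case using P_restrict[of c B f C] by simp
  next
    case (union B C)
    moreover have "inj_on f (B \<union> C)" using R union(3,4) by (auto intro: inj_on_subset)
    ultimately show ?case using P_Un by simp
  qed
qed

lemma Q_clopen: "Q A f \<Longrightarrow> A \<in> CL"
  and Q_inj: "Q A f \<Longrightarrow> inj_on f A"
  and Q_deg_at: "\<lbrakk>Q A f; x \<in> A\<rbrakk> \<Longrightarrow> \<exists>c. deg_at c f x"
  by (auto simp: Q_def)

lemma Q_restrict: "\<lbrakk>Q A f; B \<in> CL; B \<subseteq> A\<rbrakk> \<Longrightarrow> Q B f"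
  by (auto simp: Q_def intro: inj_on_subset)

lemma Q_image:
  assumes "Q A f"
  shows "f ` A \<in> CL"
proof -
  have "A \<in> CL" using Q_clopen assms .
  \<comment> \<open>The claim is made for all clopen subsets at once, which makes it hereditary as
    the induction demands.\<close>
  then have "\<forall>B \<in> CL. B \<subseteq> A \<longrightarrow> f ` B \<in> CL"
  proof (induction rule: clopen_induct)
    case (local x)
    then obtain c where c: "deg_at c f x" using Q_deg_at[OF assms] by metis
    obtain N where N: "x \<in> N" "N \<subseteq> A" "N \<in> CL" "P c N f"
      using deg_at_nbhd[OF c Q_clopen[OF assms] local] by (elim exE conjE) (rule that)
    then have "\<forall>B \<in> CL. B \<subseteq> N \<longrightarrow> f ` B \<in> CL" using P_restrict[OF N(4)] P_image by metis
    then show ?case using N by blast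
  next
    case (union B C)
    show ?case
    proof (intro ballI impI)
      fix D assume D: "D \<in> CL" "D \<subseteq> B \<union> C"
      then have "f ` D = f ` (D \<inter> B) \<union> f ` (D \<inter> C)" by blast
      moreover have "D \<inter> B \<in> CL" "D \<inter> C \<in> CL" using CL_Int D union by auto
      ultimately show "f ` D \<in> CL" using union CL_Un by auto
    qed
  qed auto
  then show ?thesis using Q_clopen assms by blast
qed

lemma Q_cong:
  assumes "Q A f" "\<And>x. x \<in> A \<Longrightarrow> g x = f x"
  shows "Q A g"
proof -
  have "inj_on g A" using assms inj_on_cong[of A g f] Q_inj by blast
  moreover have "\<exists>c. deg_at c g x" if "x \<in> A" for x
    using Q_deg_at[OF assms(1) that] deg_at_cong[OF _ Q_clopen[OF assms(1)] that, of _ f g]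
      assms(2) by metis
  ultimately show ?thesis using assms by (auto simp: Q_def)
qed

lemma Q_comp:
  assumes "Q A f" "Q B g" "f ` A \<subseteq> B"
  shows "Q A (\<lambda>x. g (f x))"
proof -
  have "inj_on (g \<circ> f) A"
    by (rule comp_inj_on[OF Q_inj[OF assms(1)] inj_on_subset[OF Q_inj[OF assms(2)] assms(3)]])
  then have "inj_on (\<lambda>x. g (f x)) A" by (simp add: comp_def)
  then show ?thesis using assms deg_at_comp unfolding Q_def by (metis image_subset_iff)
qed

lemma Q_id: "A \<in> CL \<Longrightarrow> Q A (\<lambda>x. x)"
  using P_id P_imp_Q by blast

lemma Q_inverse:
  assumes "Q A f" "\<And>x. x \<in> A \<Longrightarrow> g (f x) = x"
  shows "Q (f ` A) g"
  unfolding Q_def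
proof (intro conjI ballI)
  show "f ` A \<in> CL" using Q_image assms(1) .
  show "inj_on g (f ` A)" using assms(2) by (auto intro: inj_onI)
  fix y assume "y \<in> f ` A"
  then obtain x where x: "x \<in> A" "y = f x" by auto
  then obtain c where "deg_at c f x" using Q_deg_at[OF assms(1)] by metis
  from deg_at_inv[OF this Q_clopen[OF assms(1)] x(1), of g] show "\<exists>c. deg_at c g y"
    using assms(2) x(2) by auto
qed

lemma Q_Un: "\<lbrakk>Q A f; Q B f; inj_on f (A \<union> B)\<rbrakk> \<Longrightarrow> Q (A \<union> B) f"
  using CL_Un by (auto simp: Q_def)

lemma Q_preimage:
  assumes "Q A f" "B \<in> CL"
  shows "{x \<in> A. f x \<in> B} \<in> CL"
proof -
  let ?g = "the_inv_into A f"
  have inj: "inj_on f A" using Q_inj assms(1) .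
  have "Q (f ` A) ?g" using Q_inverse[OF assms(1)] the_inv_into_f_f[OF inj] by blast
  from Q_restrict[OF this CL_Int[OF Q_image[OF assms(1)] assms(2)] Int_lower1]
  have "Q (f ` A \<inter> B) ?g" .
  then have "?g ` (f ` A \<inter> B) \<in> CL" by (rule Q_image)
  moreover have "?g ` (f ` A \<inter> B) = {x \<in> A. f x \<in> B}"
    by (rule the_inv_into_image_Int[OF inj])
  ultimately show ?thesis by simp
qed

end

section \<open>The group of global elements of the pseudogroup\<close>

lemma commutator_in_derived:
  assumes "a \<in> S" "b \<in> S"
  shows "a \<otimes>\<^bsub>\<Gamma>\<^esub> b \<otimes>\<^bsub>\<Gamma>\<^esub> inv\<^bsub>\<Gamma>\<^esub> a \<otimes>\<^bsub>\<Gamma>\<^esub> inv\<^bsub>\<Gamma>\<^esub> b \<in> derived \<Gamma> S"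
  unfolding derived_def using assms by (intro generate.incl) auto

context graded_pseudogroup
begin

definition FG :: "('x \<Rightarrow> 'x) monoid" where
  "FG = (BijGroup X)\<lparr>carrier := F\<rparr>"

lemma carrier_FG [simp]: "carrier FG = F"
  by (simp add: FG_def)

lemma F_Bij: "f \<in> F \<Longrightarrow> f \<in> Bij X"
  by (simp add: F_def Bij_def)

lemma F_in_X: "\<lbrakk>f \<in> F; x \<in> X\<rbrakk> \<Longrightarrow> f x \<in> X"
  by (auto simp: F_def bij_betw_def)

lemma F_inj: "\<lbrakk>f \<in> F; x \<in> X; y \<in> X\<rbrakk> \<Longrightarrow> f x = f y \<longleftrightarrow> x = y"
  by (auto simp: F_def bij_betw_def inj_on_def)

lemma F_deg_at: "\<lbrakk>f \<in> F; x \<in> X\<rbrakk> \<Longrightarrow> \<exists>c. deg_at c f x"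
  by (auto simp: F_def)

lemma F_Q:
  assumes "f \<in> F" "A \<in> CL"
  shows "Q A f"
  unfolding Q_def
proof (intro conjI ballI)
  note A = CL_subset[OF assms(2)]
  have "inj_on f X" using assms(1) by (simp add: F_def bij_betw_def)
  then show "inj_on f A" using A by (rule inj_on_subset)
  show "\<exists>c. deg_at c f x" if "x \<in> A" for x using F_deg_at[OF assms(1) subsetD[OF A that]] .
qed (rule assms)

lemma F_eqI: "\<lbrakk>f \<in> F; g \<in> F; \<And>x. x \<in> X \<Longrightarrow> f x = g x\<rbrakk> \<Longrightarrow> f = g"
  by (rule extensionalityI[of f X g]) (simp_all add: F_def)

lemma F_surj: "\<lbrakk>f \<in> F; y \<in> X\<rbrakk> \<Longrightarrow> \<exists>x \<in> X. f x = y"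
  using bij_betw_imp_surj_on[of f X X] by (simp add: F_def set_eq_iff image_iff) metis

lemma F_I:
  assumes "f \<in> extensional X" "\<And>x. x \<in> X \<Longrightarrow> f x \<in> X" "\<And>x. x \<in> X \<Longrightarrow> g x \<in> X"
    "\<And>x. x \<in> X \<Longrightarrow> g (f x) = x" "\<And>x. x \<in> X \<Longrightarrow> f (g x) = x"
    "\<And>x. x \<in> X \<Longrightarrow> \<exists>c. deg_at c f x"
  shows "f \<in> F"
proof -
  have "bij_betw f X X"
    by (rule bij_betw_byWitness[where f' = g]) (use assms(2-5) in auto)
  then show ?thesis using assms(1,6) by (simp add: F_def)
qed

lemma compose_F:
  assumes "f \<in> F" "g \<in> F"
  shows "compose X f g \<in> F"
proof -
  have "\<exists>c. deg_at c (compose X f g) x" if x: "x \<in> X" for x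
  proof -
    obtain c where "deg_at c g x" using F_deg_at[OF assms(2) x] by blast
    moreover obtain d where "deg_at d f (g x)" using F_deg_at[OF assms(1) F_in_X[OF assms(2) x]]
      by blast
    ultimately have "deg_at (c + d) (\<lambda>x. f (g x)) x" by (rule deg_at_comp)
    then have "deg_at (c + d) (compose X f g) x" by (rule deg_at_cong[OF _ CL_X x]) (simp add:
      compose_def)
    then show ?thesis by blast
  qed
  then show ?thesis using compose_Bij[OF F_Bij[OF assms(1)] F_Bij[OF assms(2)]]
    by (simp add: F_def Bij_def)
qed

lemma F_deg_at_inv:
  assumes "f \<in> F" "x \<in> X" "deg_at c f x"
  shows "deg_at (- c) (\<lambda>x\<in>X. inv_into X f x) (f x)"
proof (rule deg_at_inv[OF assms(3) CL_X assms(2)])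
  fix y assume "y \<in> X"
  moreover have "f y \<in> X" "inj_on f X" using F_in_X[OF assms(1) \<open>y \<in> X\<close>] assms(1)
    by (auto simp: F_def bij_betw_def)
  ultimately show "(\<lambda>x\<in>X. inv_into X f x) (f y) = y" by simp
qed

lemma subgroup_F: "subgroup F (BijGroup X)"
proof (rule group.subgroupI[OF group_BijGroup])
  show "F \<subseteq> carrier (BijGroup X)" by (auto simp: BijGroup_def F_Bij)
  have "(\<lambda>x\<in>X. x) \<in> F"
  proof (rule F_I[where g = "\<lambda>x. x"])
    show "\<exists>c. deg_at c (\<lambda>x\<in>X. x) x" if "x \<in> X" for x
      using deg_at_cong[OF deg_at_id[OF that] CL_X that, of "\<lambda>x\<in>X. x"] by auto
  qed auto
  then show "F \<noteq> {}" by blast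
next
  fix f assume f: "f \<in> F"
  then have inv: "inv\<^bsub>BijGroup X\<^esub> f = (\<lambda>x\<in>X. inv_into X f x)"
    by (simp add: inv_BijGroup F_Bij)
  have "bij_betw (inv_into X f) X X" using f by (simp add: F_def bij_betw_inv_into)
  then have b: "bij_betw (\<lambda>x\<in>X. inv_into X f x) X X" by (simp cong: bij_betw_cong)
  have "\<exists>c. deg_at c (\<lambda>x\<in>X. inv_into X f x) y" if "y \<in> X" for y
    using F_surj[OF f that] F_deg_at[OF f] F_deg_at_inv[OF f] by metis
  then show "inv\<^bsub>BijGroup X\<^esub> f \<in> F" unfolding inv using b by (simp add: F_def)
next
  fix f g assume "f \<in> F" "g \<in> F"
  then show "f \<otimes>\<^bsub>BijGroup X\<^esub> g \<in> F" using compose_F by (simp add: BijGroup_def F_Bij)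
qed

sublocale FG: group FG
  unfolding FG_def using group.subgroup_imp_group[OF group_BijGroup subgroup_F] .

lemma FG_mult: "\<lbrakk>f \<in> F; g \<in> F\<rbrakk> \<Longrightarrow> f \<otimes>\<^bsub>FG\<^esub> g = compose X f g"
  by (simp add: FG_def BijGroup_def F_Bij)

lemma FG_apply [simp]: "\<lbrakk>f \<in> F; g \<in> F; x \<in> X\<rbrakk> \<Longrightarrow> (f \<otimes>\<^bsub>FG\<^esub> g) x = f (g x)"
  by (simp add: FG_mult compose_def)

lemma FG_one: "\<one>\<^bsub>FG\<^esub> = (\<lambda>x\<in>X. x)"
  by (simp add: FG_def BijGroup_def)

lemma FG_one_apply [simp]: "x \<in> X \<Longrightarrow> \<one>\<^bsub>FG\<^esub> x = x"
  by (simp add: FG_one)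

lemma F_closed [simp]: "\<lbrakk>f \<in> F; g \<in> F\<rbrakk> \<Longrightarrow> f \<otimes>\<^bsub>FG\<^esub> g \<in> F"
  and F_inv_closed [simp]: "f \<in> F \<Longrightarrow> inv\<^bsub>FG\<^esub> f \<in> F"
  and F_one [simp]: "\<one>\<^bsub>FG\<^esub> \<in> F"
  using FG.m_closed FG.inv_closed FG.one_closed by auto

lemma FG_inv_apply [simp]:
  assumes "f \<in> F" "x \<in> X"
  shows "(inv\<^bsub>FG\<^esub> f) (f x) = x" "f ((inv\<^bsub>FG\<^esub> f) x) = x"
proof -
  have i: "inv\<^bsub>FG\<^esub> f \<in> F" using assms(1) by simp
  have "(inv\<^bsub>FG\<^esub> f) (f x) = (inv\<^bsub>FG\<^esub> f \<otimes>\<^bsub>FG\<^esub> f) x" by (rule FG_apply[OF i assms, symmetric])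
  then show "(inv\<^bsub>FG\<^esub> f) (f x) = x" using FG.l_inv[of f] assms by simp
  have "f ((inv\<^bsub>FG\<^esub> f) x) = (f \<otimes>\<^bsub>FG\<^esub> inv\<^bsub>FG\<^esub> f) x" by (rule FG_apply[OF assms(1) i assms(2),
    symmetric])
  then show "f ((inv\<^bsub>FG\<^esub> f) x) = x" using FG.r_inv[of f] assms by simp
qed

lemma L_F: "L a \<in> F"
proof (rule F_I[where g = "L (- a)"])
  fix x assume x: "x \<in> X"
  show in_X: "L a x \<in> X" "L (- a) x \<in> X" using L_image x by blast+
  show "L (- a) (L a x) = x" "L a (L (- a) x) = x"
    using L_add[OF x, of "- a" a] L_add[OF x, of a "- a"] L_0[OF x] by simp_all
  show "\<exists>c. deg_at c (L a) x" using deg_at_L[OF x] by blast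
qed (rule L_extensional)

lemma F0_subset: "F0 \<subseteq> F"
  by (auto simp: F0_def)

lemma subgroup_F0: "subgroup F0 FG"
proof (rule FG.subgroupI)
  show "F0 \<subseteq> carrier FG" using F0_subset by simp
  have "deg_at 0 \<one>\<^bsub>FG\<^esub> x" if "x \<in> X" for x
    unfolding FG_one by (rule deg_at_cong[OF deg_at_id[OF that] CL_X that]) simp
  then show "F0 \<noteq> {}" using F_one unfolding F0_def by blast
next
  fix f assume "f \<in> F0"
  then have f: "f \<in> F" "\<And>x. x \<in> X \<Longrightarrow> deg_at 0 f x" by (auto simp: F0_def)
  have "deg_at 0 (inv\<^bsub>FG\<^esub> f) y" if "y \<in> X" for y
  proof -
    obtain x where x: "x \<in> X" "f x = y" using F_surj[OF f(1) \<open>y \<in> X\<close>] by blast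
    have "deg_at (- 0) (inv\<^bsub>FG\<^esub> f) (f x)"
      by (rule deg_at_inv[OF f(2)[OF x(1)] CL_X x(1)]) (use f in simp)
    then show ?thesis using x by simp
  qed
  then show "inv\<^bsub>FG\<^esub> f \<in> F0" using f by (simp add: F0_def)
next
  fix f g assume "f \<in> F0" "g \<in> F0"
  then have fg: "f \<in> F" "g \<in> F" "\<And>x. x \<in> X \<Longrightarrow> deg_at 0 f x" "\<And>x. x \<in> X \<Longrightarrow> deg_at 0 g x"
    by (auto simp: F0_def)
  have "deg_at 0 (f \<otimes>\<^bsub>FG\<^esub> g) x" if x: "x \<in> X" for x
  proof -
    have "deg_at (0 + 0) (\<lambda>x. f (g x)) x" using fg F_in_X x by (intro deg_at_comp) auto
    then have "deg_at (0 + 0) (f \<otimes>\<^bsub>FG\<^esub> g) x" by (rule deg_at_cong[OF _ CL_X x]) (use fg in simp)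
    then show ?thesis by simp
  qed
  then show "f \<otimes>\<^bsub>FG\<^esub> g \<in> F0" using fg by (simp add: F0_def)
qed

section \<open>Three-cycles\<close>

text \<open>The set \<open>A\<close> is an abstract base and \<open>e0\<close>, \<open>e1\<close>
  are its two legs, so that \<open>e0 a\<close> and \<open>e1 a\<close> are exchanged. Working with
  legs over a base, and not with a partial map from one level to the other, treats all levels alike
  and turns conjugation into composition with the legs.\<close>

definition swap :: "'x set \<Rightarrow> ('x \<Rightarrow> 'x) \<Rightarrow> ('x \<Rightarrow> 'x) \<Rightarrow> 'x \<Rightarrow> 'x" where
  "swap A e0 e1 = (\<lambda>x\<in>X. if x \<in> e0 ` A then e1 (the_inv_into A e0 x)
     else if x \<in> e1 ` A then e0 (the_inv_into A e1 x) else x)"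

definition levels2 :: "'x set \<Rightarrow> ('x \<Rightarrow> 'x) \<Rightarrow> ('x \<Rightarrow> 'x) \<Rightarrow> bool" where
  "levels2 A e0 e1 \<longleftrightarrow> Q A e0 \<and> Q A e1 \<and> e0 ` A \<inter> e1 ` A = {}"

definition levels3 :: "'x set \<Rightarrow> ('x \<Rightarrow> 'x) \<Rightarrow> ('x \<Rightarrow> 'x) \<Rightarrow> ('x \<Rightarrow> 'x) \<Rightarrow> bool" where
  "levels3 A e0 e1 e2 \<longleftrightarrow> Q A e0 \<and> Q A e1 \<and> Q A e2 \<and>
     e0 ` A \<inter> e1 ` A = {} \<and> e0 ` A \<inter> e2 ` A = {} \<and> e1 ` A \<inter> e2 ` A = {}"

text \<open>The right factor acts first, so the levels are moved in the order 0, 1, 2, 0.\<close>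

definition tri :: "'x set \<Rightarrow> ('x \<Rightarrow> 'x) \<Rightarrow> ('x \<Rightarrow> 'x) \<Rightarrow> ('x \<Rightarrow> 'x) \<Rightarrow> 'x \<Rightarrow> 'x" where
  "tri A e0 e1 e2 = swap A e0 e1 \<otimes>\<^bsub>FG\<^esub> swap A e1 e2"

lemma Q_in_X: "\<lbrakk>Q A e; a \<in> A\<rbrakk> \<Longrightarrow> e a \<in> X"
  using CL_subset[OF Q_image] by blast

lemma swap_eval:
  assumes "levels2 A e0 e1"
  shows "a \<in> A \<Longrightarrow> swap A e0 e1 (e0 a) = e1 a" "a \<in> A \<Longrightarrow> swap A e0 e1 (e1 a) = e0 a"
    "\<lbrakk>x \<in> X; x \<notin> e0 ` A; x \<notin> e1 ` A\<rbrakk> \<Longrightarrow> swap A e0 e1 x = x"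
proof -
  have inj: "inj_on e0 A" "inj_on e1 A" using assms by (auto simp: levels2_def Q_inj)
  show "a \<in> A \<Longrightarrow> swap A e0 e1 (e0 a) = e1 a"
    using assms Q_in_X[of A e0 a] by (simp add: swap_def the_inv_into_f_f[OF inj(1)] levels2_def)
  assume a: "a \<in> A"
  then have "e1 a \<notin> e0 ` A" using assms by (auto simp: levels2_def)
  then show "swap A e0 e1 (e1 a) = e0 a"
    using assms a Q_in_X[of A e1 a] by (simp add: swap_def the_inv_into_f_f[OF inj(2)] levels2_def)
next
  show "\<lbrakk>x \<in> X; x \<notin> e0 ` A; x \<notin> e1 ` A\<rbrakk> \<Longrightarrow> swap A e0 e1 x = x" by (simp add: swap_def)
qed

text \<open>Near \<open>e0 a\<close> the map \<open>g\<close> is \<open>e1\<close> after the inverse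
  of \<open>e0\<close>, and degrees are additive.\<close>

lemma deg_at_transfer:
  assumes "Q A e0" "a \<in> A" "deg_at c e0 a" "deg_at d e1 a" "\<And>b. b \<in> A \<Longrightarrow> g (e0 b) = e1 b"
  shows "deg_at (d - c) g (e0 a)"
proof -
  let ?i = "the_inv_into A e0"
  have i: "?i (e0 b) = b" if "b \<in> A" for b using the_inv_into_f_f[OF Q_inj[OF assms(1)] that] .
  have "deg_at (- c) ?i (e0 a)" by (rule deg_at_inv[OF assms(3) Q_clopen[OF assms(1)] assms(2)])
    (rule i)
  then have "deg_at (- c + d) (\<lambda>x. e1 (?i x)) (e0 a)"
    by (rule deg_at_comp) (simp add: i assms(2,4))
  then have "deg_at (- c + d) g (e0 a)"
    by (rule deg_at_cong[OF _ Q_image[OF assms(1)]]) (use i assms(2,5) in auto)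
  then show ?thesis by (simp add: algebra_simps)
qed

lemma deg_at_fixed:
  assumes "A \<in> CL" "x \<in> X" "x \<notin> A" "\<And>y. \<lbrakk>y \<in> X; y \<notin> A\<rbrakk> \<Longrightarrow> f y = y"
  shows "deg_at 0 f x"
  by (rule deg_at_cong[OF deg_at_id[OF assms(2)] CL_Diff[OF CL_X assms(1)]]) (use assms in auto)

text \<open>The predicate \<open>R\<close> lets one case analysis serve twice: with no restriction
  on the degree in \<open>swap_F\<close>, and with degree 0 in \<open>swap_F0\<close>.\<close>

lemma swap_deg_at:
  assumes "levels2 A e0 e1" "x \<in> X"
    and "\<And>a. a \<in> A \<Longrightarrow> \<exists>c d. deg_at c e0 a \<and> deg_at d e1 a \<and> R (d - c) \<and> R (c - d)" "R 0"
  shows "\<exists>c. R c \<and> deg_at c (swap A e0 e1) x"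
proof -
  have Q: "Q A e0" "Q A e1" using assms(1) by (auto simp: levels2_def)
  consider a where "a \<in> A" "x = e0 a" | a where "a \<in> A" "x = e1 a" | "x \<notin> e0 ` A \<union> e1 ` A" by blast
  then show ?thesis
  proof cases
    case 1
    then obtain c d where cd: "deg_at c e0 a" "deg_at d e1 a" "R (d - c)" using assms(3) by blast
    have "deg_at (d - c) (swap A e0 e1) (e0 a)"
      by (rule deg_at_transfer[OF Q(1) 1(1) cd(1,2)]) (rule swap_eval(1)[OF assms(1)])
    then show ?thesis using 1 cd by blast
  next
    case 2
    then obtain c d where cd: "deg_at c e0 a" "deg_at d e1 a" "R (c - d)" using assms(3) by blast
    have "deg_at (c - d) (swap A e0 e1) (e1 a)"
      by (rule deg_at_transfer[OF Q(2) 2(1) cd(2,1)]) (rule swap_eval(2)[OF assms(1)])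
    then show ?thesis using 2 cd by blast
  next
    case 3
    have "e0 ` A \<union> e1 ` A \<in> CL" using CL_Un Q_image Q by blast
    from deg_at_fixed[OF this assms(2) 3, of "swap A e0 e1"] show ?thesis
      using swap_eval(3)[OF assms(1)] assms(4) by blast
  qed
qed

lemma swap_involution:
  assumes "levels2 A e0 e1" "x \<in> X"
  shows "swap A e0 e1 x \<in> X" "swap A e0 e1 (swap A e0 e1 x) = x"
proof -
  have Q: "Q A e0" "Q A e1" using assms(1) by (auto simp: levels2_def)
  consider a where "a \<in> A" "x = e0 a" | a where "a \<in> A" "x = e1 a" | "x \<notin> e0 ` A \<union> e1 ` A" by blast
  then have "swap A e0 e1 x \<in> X \<and> swap A e0 e1 (swap A e0 e1 x) = x"
    by cases (use swap_eval[OF assms(1)] Q_in_X Q assms(2) in auto)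
  then show "swap A e0 e1 x \<in> X" "swap A e0 e1 (swap A e0 e1 x) = x" by auto
qed

lemma swap_F:
  assumes "levels2 A e0 e1"
  shows "swap A e0 e1 \<in> F"
proof (rule F_I[where g = "swap A e0 e1"])
  show "swap A e0 e1 \<in> extensional X" by (simp add: swap_def)
  fix x assume x: "x \<in> X"
  have "\<exists>c. True \<and> deg_at c (swap A e0 e1) x"
    by (rule swap_deg_at[OF assms x]) (use assms Q_deg_at in \<open>auto simp: levels2_def\<close>)
  then show "\<exists>c. deg_at c (swap A e0 e1) x" by simp
qed (use swap_involution[OF assms] in auto)

lemma swap_inv: "levels2 A e0 e1 \<Longrightarrow> inv\<^bsub>FG\<^esub> (swap A e0 e1) = swap A e0 e1"
  by (rule FG.inv_equality, rule F_eqI) (simp_all add: swap_F swap_involution)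

lemma swap_F0:
  assumes "levels2 A e0 e1" "P c A e0" "P c A e1"
  shows "swap A e0 e1 \<in> F0"
proof -
  have "deg_at 0 (swap A e0 e1) x" if "x \<in> X" for x
  proof -
    have "\<exists>d. d = 0 \<and> deg_at d (swap A e0 e1) x"
    proof (rule swap_deg_at[OF assms(1) that])
      fix a assume "a \<in> A"
      then have "deg_at c e0 a" "deg_at c e1 a" using assms(2,3) P_imp_deg_at by simp_all
      then show "\<exists>c d. deg_at c e0 a \<and> deg_at d e1 a \<and> d - c = 0 \<and> c - d = 0" by auto
    qed simp
    then show ?thesis by simp
  qed
  then show ?thesis using swap_F[OF assms(1)] by (simp add: F0_def)
qed

lemma levels3_levels2:
  assumes "levels3 A e0 e1 e2"
  shows "levels2 A e0 e1" "levels2 A e1 e2" "levels2 A e0 e2"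
  using assms by (auto simp: levels2_def levels3_def)

lemma levels3_Q:
  assumes "levels3 A e0 e1 e2"
  shows "Q A e0" "Q A e1" "Q A e2"
  using assms by (auto simp: levels3_def)

lemma levels3_rot: "levels3 A e0 e1 e2 \<Longrightarrow> levels3 A e1 e2 e0"
  by (auto simp: levels3_def)

lemma tri_F: "levels3 A e0 e1 e2 \<Longrightarrow> tri A e0 e1 e2 \<in> F"
  unfolding tri_def using levels3_levels2 swap_F by simp

lemma tri_eval:
  assumes l: "levels3 A e0 e1 e2"
  shows "a \<in> A \<Longrightarrow> tri A e0 e1 e2 (e0 a) = e1 a" "a \<in> A \<Longrightarrow> tri A e0 e1 e2 (e1 a) = e2 a"
    "a \<in> A \<Longrightarrow> tri A e0 e1 e2 (e2 a) = e0 a"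
    "\<lbrakk>x \<in> X; x \<notin> e0 ` A; x \<notin> e1 ` A; x \<notin> e2 ` A\<rbrakk> \<Longrightarrow> tri A e0 e1 e2 x = x"
proof -
  note l2 = levels3_levels2[OF l] and Q = levels3_Q[OF l]
  have d: "e0 ` A \<inter> e1 ` A = {}" "e0 ` A \<inter> e2 ` A = {}" "e1 ` A \<inter> e2 ` A = {}"
    using l by (auto simp: levels3_def)
  have e: "tri A e0 e1 e2 x = swap A e0 e1 (swap A e1 e2 x)" if "x \<in> X" for x
    unfolding tri_def using swap_F l2 that by simp
  show "\<lbrakk>x \<in> X; x \<notin> e0 ` A; x \<notin> e1 ` A; x \<notin> e2 ` A\<rbrakk> \<Longrightarrow> tri A e0 e1 e2 x = x"
    using e swap_eval(3)[OF l2(1)] swap_eval(3)[OF l2(2)] by simp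
  assume a: "a \<in> A"
  have n: "e0 a \<notin> e1 ` A" "e0 a \<notin> e2 ` A" "e2 a \<notin> e0 ` A" "e2 a \<notin> e1 ` A"
    using d a by blast+
  have X: "e0 a \<in> X" "e1 a \<in> X" "e2 a \<in> X" using Q_in_X Q a by auto
  show "tri A e0 e1 e2 (e0 a) = e1 a"
    using e[OF X(1)] swap_eval(3)[OF l2(2) X(1) n(1,2)] swap_eval(1)[OF l2(1) a] by simp
  show "tri A e0 e1 e2 (e1 a) = e2 a"
    using e[OF X(2)] swap_eval(1)[OF l2(2) a] swap_eval(3)[OF l2(1) X(3) n(3,4)] by simp
  show "tri A e0 e1 e2 (e2 a) = e0 a"
    using e[OF X(3)] swap_eval(2)[OF l2(2) a] swap_eval(2)[OF l2(1) a] by simp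
qed

lemma tri_eqI:
  assumes l: "levels3 A e0 e1 e2" and f: "f \<in> F"
    and "\<And>a. a \<in> A \<Longrightarrow> f (e0 a) = e1 a" "\<And>a. a \<in> A \<Longrightarrow> f (e1 a) = e2 a"
    "\<And>a. a \<in> A \<Longrightarrow> f (e2 a) = e0 a"
    "\<And>x. \<lbrakk>x \<in> X; x \<notin> e0 ` A; x \<notin> e1 ` A; x \<notin> e2 ` A\<rbrakk> \<Longrightarrow> f x = x"
  shows "f = tri A e0 e1 e2"
proof (rule F_eqI[OF f tri_F[OF l]])
  fix x assume "x \<in> X"
  then consider a where "a \<in> A" "x = e0 a" | a where "a \<in> A" "x = e1 a"
    | a where "a \<in> A" "x = e2 a" | "x \<in> X" "x \<notin> e0 ` A" "x \<notin> e1 ` A" "x \<notin> e2 ` A" by blast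
  then show "f x = tri A e0 e1 e2 x"
    by cases (simp_all add: assms tri_eval[OF l])
qed

lemma tri_rot: "levels3 A e0 e1 e2 \<Longrightarrow> tri A e1 e2 e0 = tri A e0 e1 e2"
  by (rule tri_eqI) (simp_all add: tri_F levels3_rot tri_eval[OF levels3_rot])

lemma levels3_image:
  assumes l: "levels3 A e0 e1 e2" and d: "d \<in> F"
  shows "levels3 A (\<lambda>x. d (e0 x)) (\<lambda>x. d (e1 x)) (\<lambda>x. d (e2 x))"
proof -
  note Q = levels3_Q[OF l]
  have "Q A (\<lambda>x. d (e x))" if "Q A e" for e
    by (rule Q_comp[OF that F_Q[OF d CL_X]]) (use Q_in_X[OF that] in auto)
  moreover have "(\<lambda>x. d (e x)) ` A \<inter> (\<lambda>x. d (e' x)) ` A = {}"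
    if "Q A e" "Q A e'" "e ` A \<inter> e' ` A = {}" for e e'
    using that F_inj[OF d] Q_in_X by (auto 0 4 simp: disjoint_iff)
  ultimately show ?thesis using l by (simp add: levels3_def)
qed

lemma tri_conj:
  assumes l: "levels3 A e0 e1 e2" and d: "d \<in> F"
  shows "d \<otimes>\<^bsub>FG\<^esub> tri A e0 e1 e2 \<otimes>\<^bsub>FG\<^esub> inv\<^bsub>FG\<^esub> d =
    tri A (\<lambda>x. d (e0 x)) (\<lambda>x. d (e1 x)) (\<lambda>x. d (e2 x))"
proof (rule tri_eqI[OF levels3_image[OF l d]])
  let ?t = "tri A e0 e1 e2" and ?d' = "inv\<^bsub>FG\<^esub> d"
  let ?f = "d \<otimes>\<^bsub>FG\<^esub> ?t \<otimes>\<^bsub>FG\<^esub> ?d'"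
  note Q = levels3_Q[OF l] and t = tri_F[OF l]
  show "?f \<in> F" using d t by simp
  have f: "?f (d x) = d (?t x)" if "x \<in> X" for x
    using that d t F_in_X[OF d that] by simp
  show "?f (d (e0 a)) = d (e1 a)" if "a \<in> A" for a
    using f[OF Q_in_X[OF Q(1) that]] tri_eval(1)[OF l that] by simp
  show "?f (d (e1 a)) = d (e2 a)" if "a \<in> A" for a
    using f[OF Q_in_X[OF Q(2) that]] tri_eval(2)[OF l that] by simp
  show "?f (d (e2 a)) = d (e0 a)" if "a \<in> A" for a
    using f[OF Q_in_X[OF Q(3) that]] tri_eval(3)[OF l that] by simp
  fix x assume x: "x \<in> X" "x \<notin> (\<lambda>x. d (e0 x)) ` A" "x \<notin> (\<lambda>x. d (e1 x)) ` A"
    "x \<notin> (\<lambda>x. d (e2 x)) ` A"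
  obtain y where y: "y \<in> X" "d y = x" using F_surj[OF d x(1)] by blast
  then have "y \<notin> e0 ` A" "y \<notin> e1 ` A" "y \<notin> e2 ` A" using x by auto
  then show "?f x = x" using f[OF y(1)] tri_eval(4)[OF l y(1)] y by simp
qed

lemma levels3_cong:
  assumes "levels3 A e0 e1 e2"
    "\<And>a. a \<in> A \<Longrightarrow> f0 a = e0 a" "\<And>a. a \<in> A \<Longrightarrow> f1 a = e1 a" "\<And>a. a \<in> A \<Longrightarrow> f2 a = e2 a"
  shows "levels3 A f0 f1 f2" "tri A f0 f1 f2 = tri A e0 e1 e2"
proof -
  have i: "f0 ` A = e0 ` A" "f1 ` A = e1 ` A" "f2 ` A = e2 ` A" using assms by auto
  show l: "levels3 A f0 f1 f2"
    unfolding levels3_def i using assms Q_cong[of A e0 f0] Q_cong[of A e1 f1] Q_cong[of A e2 f2]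
    by (simp add: levels3_def)
  show "tri A f0 f1 f2 = tri A e0 e1 e2"
    by (rule tri_eqI[OF assms(1) tri_F[OF l]])
      (use tri_eval[OF l] assms(2-4) i in auto)
qed

lemma levels3_restrict:
  assumes "levels3 A e0 e1 e2" "B \<in> CL" "B \<subseteq> A"
  shows "levels3 B e0 e1 e2"
proof -
  have "e ` B \<inter> e' ` B = {}" if "e ` A \<inter> e' ` A = {}" for e e' :: "'x \<Rightarrow> 'x"
    using that assms(3) by blast
  then show ?thesis using assms Q_restrict[of A _ B] by (simp add: levels3_def)
qed

text \<open>Cycles over disjoint bases have disjoint supports, so at each point at most one factor
  acts. This makes membership of a three-cycle in a subgroup a local question on its base.\<close>

lemma tri_Un:
  assumes l: "levels3 (A \<union> B) e0 e1 e2" and AB: "A \<in> CL" "B \<in> CL" "A \<inter> B = {}"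
  shows "tri A e0 e1 e2 \<otimes>\<^bsub>FG\<^esub> tri B e0 e1 e2 = tri (A \<union> B) e0 e1 e2"
proof (rule tri_eqI[OF l])
  have lA: "levels3 A e0 e1 e2" and lB: "levels3 B e0 e1 e2"
    using levels3_restrict[OF l] AB by auto
  show "tri A e0 e1 e2 \<otimes>\<^bsub>FG\<^esub> tri B e0 e1 e2 \<in> F" using tri_F lA lB by simp
  have Q: "Q (A \<union> B) e0" "Q (A \<union> B) e1" "Q (A \<union> B) e2" using levels3_Q[OF l] .
  have d: "e0 ` (A \<union> B) \<inter> e1 ` (A \<union> B) = {}" "e0 ` (A \<union> B) \<inter> e2 ` (A \<union> B) = {}"
    "e1 ` (A \<union> B) \<inter> e2 ` (A \<union> B) = {}" using l by (auto simp: levels3_def)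
  have i: "e a \<notin> e ` C" if "Q (A \<union> B) e" "a \<in> A \<union> B" "a \<notin> C" "C \<subseteq> A \<union> B" for e a C
    using that by (auto simp: Q_def inj_on_def)
  have n: "e a \<notin> e' ` C" if "e ` (A \<union> B) \<inter> e' ` (A \<union> B) = {}" "a \<in> A \<union> B" "C \<subseteq> A \<union> B" for e e' a C
    using that by auto
  have f: "(tri A e0 e1 e2 \<otimes>\<^bsub>FG\<^esub> tri B e0 e1 e2) x = tri A e0 e1 e2 (tri B e0 e1 e2 x)" if "x \<in> X"
    for x
    using that tri_F lA lB by simp
  have step: "(tri A e0 e1 e2 \<otimes>\<^bsub>FG\<^esub> tri B e0 e1 e2) (u a) = v a"
    if a: "a \<in> A \<union> B" and uv: "Q (A \<union> B) u" "Q (A \<union> B) v"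
      and tA: "\<And>a. a \<in> A \<Longrightarrow> tri A e0 e1 e2 (u a) = v a"
      and tB: "\<And>a. a \<in> B \<Longrightarrow> tri B e0 e1 e2 (u a) = v a"
      and nA: "\<And>a. a \<in> B \<Longrightarrow> v a \<notin> e0 ` A \<and> v a \<notin> e1 ` A \<and> v a \<notin> e2 ` A"
      and nB: "\<And>a. a \<in> A \<Longrightarrow> u a \<notin> e0 ` B \<and> u a \<notin> e1 ` B \<and> u a \<notin> e2 ` B" for a u v
  proof (cases "a \<in> A")
    case True
    then show ?thesis using f Q_in_X[OF uv(1) a] tA tri_eval(4)[OF lB] nB by simp
  next
    case False
    then have "a \<in> B" using a by simp
    then show ?thesis using f Q_in_X[OF uv(1) a] Q_in_X[OF uv(2) a] tB tri_eval(4)[OF lA] nA by simp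
  qed
  have d': "e1 ` (A \<union> B) \<inter> e0 ` (A \<union> B) = {}" "e2 ` (A \<union> B) \<inter> e0 ` (A \<union> B) = {}"
    "e2 ` (A \<union> B) \<inter> e1 ` (A \<union> B) = {}" using d by (simp_all only: Int_commute)
  have m: "e0 a \<notin> e0 ` C" "e0 a \<notin> e1 ` C" "e0 a \<notin> e2 ` C" "e1 a \<notin> e0 ` C" "e1 a \<notin> e1 ` C"
    "e1 a \<notin> e2 ` C" "e2 a \<notin> e0 ` C" "e2 a \<notin> e1 ` C" "e2 a \<notin> e2 ` C"
    if "a \<in> A \<union> B" "a \<notin> C" "C \<subseteq> A \<union> B" for a C
    by (rule i[OF Q(1) that] i[OF Q(2) that] i[OF Q(3) that] n[OF d(1) that(1,3)] n[OF d(2)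
      that(1,3)]
      n[OF d(3) that(1,3)] n[OF d'(1) that(1,3)] n[OF d'(2) that(1,3)] n[OF d'(3) that(1,3)])+
  have AB': "a \<notin> A" if "a \<in> B" for a using AB(3) that by auto
  have BA': "a \<notin> B" if "a \<in> A" for a using AB(3) that by auto
  show "(tri A e0 e1 e2 \<otimes>\<^bsub>FG\<^esub> tri B e0 e1 e2) (e0 a) = e1 a" if "a \<in> A \<union> B" for a
    by (rule step[OF that Q(1,2) tri_eval(1)[OF lA] tri_eval(1)[OF lB]]) (simp_all add: m AB' BA')
  show "(tri A e0 e1 e2 \<otimes>\<^bsub>FG\<^esub> tri B e0 e1 e2) (e1 a) = e2 a" if "a \<in> A \<union> B" for a
    by (rule step[OF that Q(2,3) tri_eval(2)[OF lA] tri_eval(2)[OF lB]]) (simp_all add: m AB' BA')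
  show "(tri A e0 e1 e2 \<otimes>\<^bsub>FG\<^esub> tri B e0 e1 e2) (e2 a) = e0 a" if "a \<in> A \<union> B" for a
    by (rule step[OF that Q(3,1) tri_eval(3)[OF lA] tri_eval(3)[OF lB]]) (simp_all add: m AB' BA')
  show "(tri A e0 e1 e2 \<otimes>\<^bsub>FG\<^esub> tri B e0 e1 e2) x = x"
    if "x \<in> X" "x \<notin> e0 ` (A \<union> B)" "x \<notin> e1 ` (A \<union> B)" "x \<notin> e2 ` (A \<union> B)" for x
    using f[OF that(1)] tri_eval(4)[OF lA] tri_eval(4)[OF lB] that by (simp add: image_Un)
qed

text \<open>As in a symmetric group, the commutator of two transpositions with one point in common
  is a three-cycle. If the legs have one common degree, both swaps lie in \<open>F0\<close> and the
  cycle lies in \<open>D0\<close>.\<close>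

lemma tri_commutator:
  assumes l: "levels3 A e0 e1 e2"
  shows "swap A e0 e1 \<otimes>\<^bsub>FG\<^esub> swap A e0 e2 \<otimes>\<^bsub>FG\<^esub> inv\<^bsub>FG\<^esub> (swap A e0 e1) \<otimes>\<^bsub>FG\<^esub> inv\<^bsub>FG\<^esub> (swap A e0 e2)
    = tri A e0 e1 e2" (is "?c = _")
proof (rule tri_eqI[OF l])
  note l2 = levels3_levels2[OF l] and Q = levels3_Q[OF l]
  let ?s = "swap A e0 e1" and ?t = "swap A e0 e2"
  have st: "?s \<in> F" "?t \<in> F" using swap_F l2 by auto
  show "?c \<in> F" using st by simp
  have c: "?c x = ?s (?t (?s (?t x)))" if "x \<in> X" for x
    using st that F_in_X by (simp add: swap_inv[OF l2(1)] swap_inv[OF l2(3)])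
  have s2: "?s (e2 a) = e2 a" and t1: "?t (e1 a) = e1 a" if "a \<in> A" for a
  proof -
    have "e2 a \<notin> e0 ` A" "e2 a \<notin> e1 ` A" "e1 a \<notin> e0 ` A" "e1 a \<notin> e2 ` A"
      using l that unfolding levels3_def by blast+
    then show "?s (e2 a) = e2 a" "?t (e1 a) = e1 a"
      using swap_eval(3)[OF l2(1)] swap_eval(3)[OF l2(3)] Q_in_X[OF Q(3) that] Q_in_X[OF Q(2)
        that] by auto
  qed
  note ev = swap_eval(1,2)[OF l2(1)] swap_eval(1,2)[OF l2(3)]
  show "?c (e0 a) = e1 a" if "a \<in> A" for a
    using c[OF Q_in_X[OF Q(1) that]] by (simp add: ev s2 t1 that)
  show "?c (e1 a) = e2 a" if "a \<in> A" for a
    using c[OF Q_in_X[OF Q(2) that]] by (simp add: ev s2 t1 that)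
  show "?c (e2 a) = e0 a" if "a \<in> A" for a
    using c[OF Q_in_X[OF Q(3) that]] by (simp add: ev s2 t1 that)
  show "?c x = x" if "x \<in> X" "x \<notin> e0 ` A" "x \<notin> e1 ` A" "x \<notin> e2 ` A" for x
    using c[OF that(1)] swap_eval(3)[OF l2(1)] swap_eval(3)[OF l2(3)] that by simp
qed

section \<open>Commutator subgroups and the subgroup generated by three-cycles\<close>

definition D :: "('x \<Rightarrow> 'x) set" where "D = derived FG F"
definition D0 :: "('x \<Rightarrow> 'x) set" where "D0 = derived FG F0"
text \<open>The alternating full group; the legs may have arbitrary, also varying, degrees.\<close>

definition Alt :: "('x \<Rightarrow> 'x) set" where
  "Alt = generate FG {tri A e0 e1 e2 | A e0 e1 e2. levels3 A e0 e1 e2}"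

lemma subgroup_D: "subgroup D FG" and subgroup_D0: "subgroup D0 FG"
  unfolding D_def D0_def using FG.derived_is_subgroup F0_subset by auto

lemma D_subset: "D \<subseteq> F"
  using subgroup.subset[OF subgroup_D] by simp

lemma D0_subset: "D0 \<subseteq> F0"
  unfolding D0_def using FG.derived_incl[OF subset_refl subgroup_F0] .

lemma D0_subset_D: "D0 \<subseteq> D"
  unfolding D0_def D_def using FG.mono_derived[OF F0_subset] .

lemma tri_D: "levels3 A e0 e1 e2 \<Longrightarrow> tri A e0 e1 e2 \<in> D"
  unfolding D_def tri_commutator[symmetric]
  by (intro commutator_in_derived swap_F levels3_levels2)

lemma tri_D0:
  assumes "levels3 A e0 e1 e2" "P c A e0" "P c A e1" "P c A e2"
  shows "tri A e0 e1 e2 \<in> D0"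
  unfolding D0_def tri_commutator[OF assms(1), symmetric]
  by (intro commutator_in_derived swap_F0[OF levels3_levels2(1)[OF assms(1)] assms(2,3)]
      swap_F0[OF levels3_levels2(3)[OF assms(1)] assms(2,4)])

lemma Alt_gen_subset: "{tri A e0 e1 e2 | A e0 e1 e2. levels3 A e0 e1 e2} \<subseteq> carrier FG"
  using tri_F by auto

lemma tri_Alt: "levels3 A e0 e1 e2 \<Longrightarrow> tri A e0 e1 e2 \<in> Alt"
  unfolding Alt_def by (rule generate.incl) blast

text \<open>By \<open>tri_conj\<close> the generating set itself is invariant under
  conjugation.\<close>

lemma normal_Alt: "Alt \<lhd> FG"
  unfolding Alt_def
proof (rule FG.normal_generateI[OF Alt_gen_subset])
  fix h g assume "h \<in> {tri A e0 e1 e2 | A e0 e1 e2. levels3 A e0 e1 e2}" and g: "g \<in> carrier FG"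
  then obtain A e0 e1 e2 where h: "h = tri A e0 e1 e2" "levels3 A e0 e1 e2" by blast
  have g: "g \<in> F" using g by simp
  have "g \<otimes>\<^bsub>FG\<^esub> h \<otimes>\<^bsub>FG\<^esub> inv\<^bsub>FG\<^esub> g = tri A (\<lambda>x. g (e0 x)) (\<lambda>x. g (e1 x)) (\<lambda>x. g (e2 x))"
    unfolding h(1) by (rule tri_conj[OF h(2) g])
  moreover have "levels3 A (\<lambda>x. g (e0 x)) (\<lambda>x. g (e1 x)) (\<lambda>x. g (e2 x))"
    by (rule levels3_image[OF h(2) g])
  ultimately show "g \<otimes>\<^bsub>FG\<^esub> h \<otimes>\<^bsub>FG\<^esub> inv\<^bsub>FG\<^esub> g \<in> {tri A e0 e1 e2 | A e0 e1 e2. levels3 A e0 e1 e2}"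
    by blast
qed

section \<open>Subgroups containing an element of mixed degree\<close>

lemma deg_at_separate:
  assumes "deg_at c f y" "deg_at d g y" "f y \<noteq> g y" "M \<in> CL" "y \<in> M"
  shows "\<exists>N. N \<in> CL \<and> y \<in> N \<and> N \<subseteq> M \<and> P c N f \<and> P d N g \<and> f ` N \<inter> g ` N = {}"
proof -
  obtain U V where UV: "U \<in> CL" "V \<in> CL" "f y \<in> U" "g y \<in> V" "U \<inter> V = {}"
    using disjoint_neighbourhoods[OF deg_at_image_in_X[OF assms(1)] deg_at_image_in_X[OF assms(2)]
      assms(3)]
    by auto
  obtain N1 where N1: "y \<in> N1" "N1 \<subseteq> M" "N1 \<in> CL" "P c N1 f"
    using deg_at_nbhd[OF assms(1,4,5)] by auto
  obtain N2 where N2: "y \<in> N2" "N2 \<subseteq> N1" "N2 \<in> CL" "P d N2 g"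
    using deg_at_nbhd[OF assms(2) N1(3,1)] by auto
  have f2: "P c N2 f" using P_restrict[OF N1(4) N2(3,2)] .
  let ?N = "{x \<in> N2. f x \<in> U} \<inter> {x \<in> N2. g x \<in> V}"
  have N: "?N \<in> CL" using CL_Int[OF P_preimage[OF f2 UV(1)] P_preimage[OF N2(4) UV(2)]] .
  moreover have "P c ?N f" "P d ?N g" using P_restrict[OF f2 N] P_restrict[OF N2(4) N] by auto
  moreover have "y \<in> ?N" using N2(1) UV by simp
  moreover have "?N \<subseteq> M" using N2(2) N1(2) by auto
  moreover have "f ` ?N \<inter> g ` ?N = {}" using UV(5) by auto
  ultimately show ?thesis by (intro exI[of _ ?N] conjI)
qed

lemma image_disjoint_mono: "\<lbrakk>f ` A \<inter> g ` A = {}; B \<subseteq> A\<rbrakk> \<Longrightarrow> f ` B \<inter> g ` B = {}"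
  by blast

text \<open>Three germs with distinct values at \<open>y\<close> are the legs of a genuine
  three-cycle once the base is small enough. This is what permits arguing with germs.\<close>

lemma levels3_germ:
  assumes "deg_at c0 e0 y" "deg_at c1 e1 y" "deg_at c2 e2 y" "e0 y \<noteq> e1 y" "e0 y \<noteq> e2 y"
    "e1 y \<noteq> e2 y"
    "M \<in> CL" "y \<in> M"
  shows "\<exists>N. N \<in> CL \<and> y \<in> N \<and> N \<subseteq> M \<and> levels3 N e0 e1 e2 \<and> P c0 N e0 \<and> P c1 N e1 \<and> P c2 N e2"
proof -
  obtain N1 where N1: "N1 \<in> CL" "y \<in> N1" "N1 \<subseteq> M" "e0 ` N1 \<inter> e1 ` N1 = {}"
    using deg_at_separate[OF assms(1,2,4,7,8)] by auto
  obtain N2 where N2: "N2 \<in> CL" "y \<in> N2" "N2 \<subseteq> N1" "e0 ` N2 \<inter> e2 ` N2 = {}" "P c0 N2 e0"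
    using deg_at_separate[OF assms(1,3,5) N1(1,2)] by auto
  obtain N3 where N3: "N3 \<in> CL" "y \<in> N3" "N3 \<subseteq> N2" "e1 ` N3 \<inter> e2 ` N3 = {}" "P c1 N3 e1"
    "P c2 N3 e2"
    using deg_at_separate[OF assms(2,3,6) N2(1,2)] by auto
  have P0: "P c0 N3 e0" using P_restrict[OF N2(5) N3(1,3)] .
  have s: "N3 \<subseteq> N1" using N3(3) N2(3) by auto
  have "levels3 N3 e0 e1 e2"
    unfolding levels3_def
    using P_imp_Q[OF P0] P_imp_Q[OF N3(5)] P_imp_Q[OF N3(6)] N3(4)
      image_disjoint_mono[OF N1(4) s] image_disjoint_mono[OF N2(4) N3(3)] by simp
  moreover have "N3 \<subseteq> M" using s N1(3) by simp
  ultimately show ?thesis using N3 P0 by metis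
qed

text \<open>First \<open>L c\<close> provides the degree; then minimality supplies a degree 0
  element that moves the value into a clopen set off \<open>S\<close>. All auxiliary legs below come
  from here.\<close>

lemma fresh_germ:
  assumes "y \<in> X" "finite S"
  shows "\<exists>f. deg_at c f y \<and> f y \<notin> S"
proof -
  obtain B where B: "B \<in> CL" "B \<noteq> {}" "B \<inter> S = {}" using clopen_avoiding[OF CL_X X_nonempty
    assms(2)] by auto
  obtain A g where g: "L c y \<in> A" "P 0 A g" "g (L c y) \<in> B"
    using P_minimal[OF F_in_X[OF L_F assms(1)] B(1,2)] by blast
  have "deg_at (c + 0) (\<lambda>x. g (L c x)) y"
    by (rule deg_at_comp[OF deg_at_L[OF assms(1)] P_imp_deg_at[OF g(2,1)]])
  then show ?thesis using g(3) B(3) by (intro exI[of _ "\<lambda>x. g (L c x)"]) auto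
qed

definition cycles_near :: "('x \<Rightarrow> 'x) set \<Rightarrow> 'x \<Rightarrow> ('x \<Rightarrow> 'x) \<Rightarrow> ('x \<Rightarrow> 'x) \<Rightarrow> ('x \<Rightarrow> 'x) \<Rightarrow> bool" where
  "cycles_near K y e0 e1 e2 \<longleftrightarrow> (\<exists>N. N \<in> CL \<and> y \<in> N \<and> levels3 N e0 e1 e2 \<and>
     (\<forall>M \<in> CL. M \<subseteq> N \<longrightarrow> tri M e0 e1 e2 \<in> K))"

lemma cycles_near_rot:
  assumes "cycles_near K y e0 e1 e2"
  shows "cycles_near K y e1 e2 e0"
proof -
  obtain N where N: "N \<in> CL" "y \<in> N" "levels3 N e0 e1 e2"
    "\<And>M. \<lbrakk>M \<in> CL; M \<subseteq> N\<rbrakk> \<Longrightarrow> tri M e0 e1 e2 \<in> K" using assms unfolding cycles_near_def by auto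
  have "tri M e1 e2 e0 \<in> K" if "M \<in> CL" "M \<subseteq> N" for M
    using N(4)[OF that] tri_rot[OF levels3_restrict[OF N(3) that]] by simp
  then show ?thesis unfolding cycles_near_def using N(1,2) levels3_rot[OF N(3)] by auto
qed

lemma cycles_near_deg_at:
  assumes "cycles_near K y e0 e1 e2"
  shows "\<exists>c. deg_at c e0 y" "\<exists>c. deg_at c e1 y" "\<exists>c. deg_at c e2 y"
    "e0 y \<noteq> e1 y" "e0 y \<noteq> e2 y" "e1 y \<noteq> e2 y"
proof -
  obtain N where N: "y \<in> N" "levels3 N e0 e1 e2" using assms unfolding cycles_near_def by auto
  show "\<exists>c. deg_at c e0 y" "\<exists>c. deg_at c e1 y" "\<exists>c. deg_at c e2 y"
    using Q_deg_at[OF _ N(1)] levels3_Q[OF N(2)] by auto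
  show "e0 y \<noteq> e1 y" "e0 y \<noteq> e2 y" "e1 y \<noteq> e2 y" using N unfolding levels3_def by auto
qed

lemma cycles_near_in_X: "cycles_near K y e0 e1 e2 \<Longrightarrow> y \<in> X"
  using cycles_near_deg_at(1) deg_at_in_X by blast

text \<open>Conjugation by an element of \<open>K\<close> keeps cycles in \<open>K\<close> and moves
  their legs. As the base may be shrunk, it suffices to know how \<open>d\<close> acts on the three
  legs near \<open>y\<close>.\<close>

lemma cycles_near_conj:
  assumes K: "subgroup K FG" and d: "d \<in> K" and b: "cycles_near K y b0 b1 b2"
    and N: "N \<in> CL" "y \<in> N"
    and f: "\<And>x. x \<in> N \<Longrightarrow> d (b0 x) = f0 x" "\<And>x. x \<in> N \<Longrightarrow> d (b1 x) = f1 x"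
      "\<And>x. x \<in> N \<Longrightarrow> d (b2 x) = f2 x"
  shows "cycles_near K y f0 f1 f2"
proof -
  obtain N' where N': "N' \<in> CL" "y \<in> N'" "levels3 N' b0 b1 b2"
    "\<And>M. \<lbrakk>M \<in> CL; M \<subseteq> N'\<rbrakk> \<Longrightarrow> tri M b0 b1 b2 \<in> K" using b unfolding cycles_near_def by auto
  have dF: "d \<in> F" using subgroup.subset[OF K] d by auto
  have l: "levels3 M f0 f1 f2" "tri M f0 f1 f2 \<in> K" if M: "M \<in> CL" "M \<subseteq> N \<inter> N'" for M
  proof -
    have M': "M \<subseteq> N'" and MN: "\<And>x. x \<in> M \<Longrightarrow> x \<in> N" using M(2) by auto
    have l: "levels3 M b0 b1 b2" using levels3_restrict[OF N'(3) M(1) M'] .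
    note c = levels3_cong[OF levels3_image[OF l dF], of f0 f1 f2]
    show "levels3 M f0 f1 f2" by (rule c(1)) (use f MN in auto)
    have "tri M f0 f1 f2 = d \<otimes>\<^bsub>FG\<^esub> tri M b0 b1 b2 \<otimes>\<^bsub>FG\<^esub> inv\<^bsub>FG\<^esub> d"
      unfolding tri_conj[OF l dF] by (rule c(2)) (use f MN in auto)
    moreover have "tri M b0 b1 b2 \<in> K" using N'(4)[OF M(1) M'] .
    ultimately show "tri M f0 f1 f2 \<in> K"
      using d by (simp add: subgroup.m_closed[OF K] subgroup.m_inv_closed[OF K])
  qed
  have "N \<inter> N' \<in> CL" using CL_Int N(1) N'(1) by blast
  then show ?thesis unfolding cycles_near_def using l N(2) N'(2) by (intro exI[of _ "N \<inter> N'"]) simp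
qed

lemma cycles_near_avoid:
  assumes a: "cycles_near K y a0 a1 a2" and b: "deg_at c b y" "b y \<noteq> a0 y" "b y \<noteq> a1 y" "b y \<noteq> a2 y"
    and M: "M \<in> CL" "y \<in> M"
  shows "\<exists>N. N \<in> CL \<and> y \<in> N \<and> N \<subseteq> M \<and> b ` N \<inter> a0 ` N = {} \<and> b ` N \<inter> a1 ` N = {} \<and> b ` N \<inter> a2 ` N =
    {}"
proof -
  obtain c0 c1 c2 where c: "deg_at c0 a0 y" "deg_at c1 a1 y" "deg_at c2 a2 y" using
    cycles_near_deg_at[OF a] by auto
  obtain N1 where N1: "N1 \<in> CL" "y \<in> N1" "N1 \<subseteq> M" "b ` N1 \<inter> a0 ` N1 = {}"
    using deg_at_separate[OF b(1) c(1) b(2) M] by auto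
  obtain N2 where N2: "N2 \<in> CL" "y \<in> N2" "N2 \<subseteq> N1" "b ` N2 \<inter> a1 ` N2 = {}"
    using deg_at_separate[OF b(1) c(2) b(3) N1(1,2)] by auto
  obtain N3 where N3: "N3 \<in> CL" "y \<in> N3" "N3 \<subseteq> N2" "b ` N3 \<inter> a2 ` N3 = {}"
    using deg_at_separate[OF b(1) c(3) b(4) N2(1,2)] by auto
  have s: "N3 \<subseteq> N1" using N3(3) N2(3) by auto
  show ?thesis
    using N3 N1(3) s image_disjoint_mono[OF N1(4) s] image_disjoint_mono[OF N2(4) N3(3)]
    by (intro exI[of _ N3]) auto
qed

text \<open>Conjugating (a0 b1 b2) by (a0 a1 a2), which fixes b1 and b2, gives (a1 b1 b2).\<close>

lemma cycles_near_shared: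
  assumes K: "subgroup K FG" and a: "cycles_near K y a0 a1 a2"
    and b: "cycles_near K y a0 b1 b2"
    and b1: "b1 y \<noteq> a1 y" "b1 y \<noteq> a2 y"
    and b2: "b2 y \<noteq> a1 y" "b2 y \<noteq> a2 y"
  shows "cycles_near K y a1 b1 b2"
proof -
  obtain N where N: "N \<in> CL" "y \<in> N" "levels3 N a0 a1 a2"
    "\<And>M. \<lbrakk>M \<in> CL; M \<subseteq> N\<rbrakk> \<Longrightarrow> tri M a0 a1 a2 \<in> K" using a unfolding cycles_near_def by auto
  obtain c1 c2 where c: "deg_at c1 b1 y" "deg_at c2 b2 y" using cycles_near_deg_at[OF b] by auto
  obtain N1 where N1: "N1 \<in> CL" "y \<in> N1" "N1 \<subseteq> N" "b1 ` N1 \<inter> a0 ` N1 = {}"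
    "b1 ` N1 \<inter> a1 ` N1 = {}" "b1 ` N1 \<inter> a2 ` N1 = {}"
    using cycles_near_avoid[OF a c(1) _ b1 N(1,2)] cycles_near_deg_at(4)[OF b] by auto
  obtain N2 where N2: "N2 \<in> CL" "y \<in> N2" "N2 \<subseteq> N1" "b2 ` N2 \<inter> a0 ` N2 = {}"
    "b2 ` N2 \<inter> a1 ` N2 = {}" "b2 ` N2 \<inter> a2 ` N2 = {}"
    using cycles_near_avoid[OF a c(2) _ b2 N1(1,2)] cycles_near_deg_at(5)[OF b] by auto
  obtain N3 where N3: "N3 \<in> CL" "y \<in> N3" "N3 \<subseteq> N2" "P c1 N3 b1"
    using deg_at_nbhd[OF c(1) N2(1,2)] by auto
  obtain N4 where N4: "N4 \<in> CL" "y \<in> N4" "N4 \<subseteq> N3" "P c2 N4 b2"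
    using deg_at_nbhd[OF c(2) N3(1,2)] by auto
  have s: "N4 \<subseteq> N" "N4 \<subseteq> N1" "N4 \<subseteq> N2" using N4(3) N3(3) N2(3) N1(3) by auto
  have l: "levels3 N4 a0 a1 a2" using levels3_restrict[OF N(3) N4(1) s(1)] .
  note t = tri_eval[OF l]
  have Q: "Q N4 b1" "Q N4 b2" using P_imp_Q N4(4) P_restrict[OF N3(4) N4(1,3)] by auto
  show ?thesis
  proof (rule cycles_near_conj[OF K N(4)[OF N4(1) s(1)] b N4(1,2)])
    fix x assume x: "x \<in> N4"
    show "tri N4 a0 a1 a2 (a0 x) = a1 x" using t(1)[OF x] .
    have "b1 x \<notin> a0 ` N4" "b1 x \<notin> a1 ` N4" "b1 x \<notin> a2 ` N4"
      using N1(4-6) s(2) x by blast+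
    then show "tri N4 a0 a1 a2 (b1 x) = b1 x" using t(4)[OF Q_in_X[OF Q(1) x]] by simp
    have "b2 x \<notin> a0 ` N4" "b2 x \<notin> a1 ` N4" "b2 x \<notin> a2 ` N4"
      using N2(4-6) s(3) x by blast+
    then show "tri N4 a0 a1 a2 (b2 x) = b2 x" using t(4)[OF Q_in_X[OF Q(2) x]] by simp
  qed
qed

text \<open>Conjugating (a0 a1 b2) by (a0 a1 a2), which fixes b2, gives (a1 a2 b2).\<close>

lemma cycles_near_shared2:
  assumes K: "subgroup K FG" and a: "cycles_near K y a0 a1 a2"
    and b: "cycles_near K y a0 a1 b2" and b2: "b2 y \<noteq> a2 y"
  shows "cycles_near K y a1 a2 b2"
proof -
  obtain N where N: "N \<in> CL" "y \<in> N" "levels3 N a0 a1 a2"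
    "\<And>M. \<lbrakk>M \<in> CL; M \<subseteq> N\<rbrakk> \<Longrightarrow> tri M a0 a1 a2 \<in> K" using a unfolding cycles_near_def by auto
  obtain c2 where c: "deg_at c2 b2 y" using cycles_near_deg_at[OF b] by auto
  obtain N2 where N2: "N2 \<in> CL" "y \<in> N2" "N2 \<subseteq> N" "b2 ` N2 \<inter> a0 ` N2 = {}"
    "b2 ` N2 \<inter> a1 ` N2 = {}" "b2 ` N2 \<inter> a2 ` N2 = {}"
    using cycles_near_avoid[OF a c _ _ b2 N(1,2)] cycles_near_deg_at(5,6)[OF b] by auto
  obtain N4 where N4: "N4 \<in> CL" "y \<in> N4" "N4 \<subseteq> N2" "P c2 N4 b2"
    using deg_at_nbhd[OF c N2(1,2)] by auto
  have s: "N4 \<subseteq> N" using N4(3) N2(3) by auto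
  have l: "levels3 N4 a0 a1 a2" using levels3_restrict[OF N(3) N4(1) s] .
  note t = tri_eval[OF l]
  show ?thesis
  proof (rule cycles_near_conj[OF K N(4)[OF N4(1) s] b N4(1,2)])
    fix x assume x: "x \<in> N4"
    show "tri N4 a0 a1 a2 (a0 x) = a1 x" using t(1)[OF x] .
    show "tri N4 a0 a1 a2 (a1 x) = a2 x" using t(2)[OF x] .
    have "b2 x \<notin> a0 ` N4" "b2 x \<notin> a1 ` N4" "b2 x \<notin> a2 ` N4"
      using N2(4-6) N4(3) x by blast+
    then show "tri N4 a0 a1 a2 (b2 x) = b2 x" using t(4)[OF Q_in_X[OF P_imp_Q[OF N4(4)] x]] by simp
  qed
qed

text \<open>Reparametrizing the base by \<open>v\<close> does not change a cycle. A triple of germs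
  at \<open>v y\<close> thus becomes one at \<open>y\<close>, with all three degrees shifted by
  \<open>t\<close>.\<close>

lemma cycles_near_precompose:
  assumes g: "cycles_near K (v y) e0 e1 e2" and v: "deg_at t v y"
  shows "cycles_near K y (\<lambda>x. e0 (v x)) (\<lambda>x. e1 (v x)) (\<lambda>x. e2 (v x))"
proof -
  obtain N where N: "N \<in> CL" "v y \<in> N" "levels3 N e0 e1 e2"
    "\<And>M. \<lbrakk>M \<in> CL; M \<subseteq> N\<rbrakk> \<Longrightarrow> tri M e0 e1 e2 \<in> K" using g unfolding cycles_near_def by auto
  obtain N1 where N1: "y \<in> N1" "P t N1 v" using v unfolding deg_at_def by auto
  let ?N = "{x \<in> N1. v x \<in> N}"
  have NC: "?N \<in> CL" using P_preimage[OF N1(2) N(1)] .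
  have l: "levels3 M (\<lambda>x. e0 (v x)) (\<lambda>x. e1 (v x)) (\<lambda>x. e2 (v x)) \<and>
    tri M (\<lambda>x. e0 (v x)) (\<lambda>x. e1 (v x)) (\<lambda>x. e2 (v x)) \<in> K" if M: "M \<in> CL" "M \<subseteq> ?N" for M
  proof -
    have "M \<subseteq> N1" using M(2) by auto
    then have Pv: "P t M v" using P_restrict[OF N1(2) M(1)] by simp
    have vM: "v ` M \<in> CL" "v ` M \<subseteq> N" using P_image[OF Pv] M(2) by auto
    have l: "levels3 (v ` M) e0 e1 e2" using levels3_restrict[OF N(3) vM] .
    note Q = levels3_Q[OF l]
    have i: "(\<lambda>x. e (v x)) ` M = e ` v ` M" for e :: "'x \<Rightarrow> 'x" by auto
    have l': "levels3 M (\<lambda>x. e0 (v x)) (\<lambda>x. e1 (v x)) (\<lambda>x. e2 (v x))"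
      using l Q_comp[OF P_imp_Q[OF Pv] Q(1)] Q_comp[OF P_imp_Q[OF Pv] Q(2)] Q_comp[OF P_imp_Q[OF
        Pv] Q(3)]
      unfolding levels3_def i by simp
    have "tri (v ` M) e0 e1 e2 = tri M (\<lambda>x. e0 (v x)) (\<lambda>x. e1 (v x)) (\<lambda>x. e2 (v x))"
      by (rule tri_eqI[OF l' tri_F[OF l]]) (use tri_eval[OF l] in \<open>simp_all add: i\<close>)
    then show ?thesis using l' N(4)[OF vM] by simp
  qed
  then show ?thesis unfolding cycles_near_def using NC N1(1) N(2) by (intro exI[of _ ?N]) simp
qed

definition all_cycles_near :: "('x \<Rightarrow> 'x) set \<Rightarrow> int \<Rightarrow> int \<Rightarrow> int \<Rightarrow> bool" where
  "all_cycles_near K i j k \<longleftrightarrow> (\<forall>y e0 e1 e2. deg_at i e0 y \<longrightarrow> deg_at j e1 y \<longrightarrow> deg_at k e2 y \<longrightarrow>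
     e0 y \<noteq> e1 y \<longrightarrow> e0 y \<noteq> e2 y \<longrightarrow> e1 y \<noteq> e2 y \<longrightarrow> cycles_near K y e0 e1 e2)"

lemma all_cycles_nearD:
  "\<lbrakk>all_cycles_near K i j k; deg_at i e0 y; deg_at j e1 y; deg_at k e2 y; e0 y \<noteq> e1 y; e0 y \<noteq> e2
    y; e1 y \<noteq> e2 y\<rbrakk>
    \<Longrightarrow> cycles_near K y e0 e1 e2"
  by (simp add: all_cycles_near_def)

text \<open>Legs of one common degree differ by degree 0 maps, so such cycles lie in
  \<open>D0\<close>.\<close>

lemma all_cycles_near_constant:
  assumes "D0 \<subseteq> K"
  shows "all_cycles_near K i i i"
  unfolding all_cycles_near_def
proof (intro allI impI)
  fix y e0 e1 e2
  assume deg_at: "deg_at i e0 y" "deg_at i e1 y" "deg_at i e2 y" "e0 y \<noteq> e1 y" "e0 y \<noteq> e2 y"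
    "e1 y \<noteq> e2 y"
  obtain N where N: "N \<in> CL" "y \<in> N" "levels3 N e0 e1 e2" "P i N e0" "P i N e1" "P i N e2"
    using levels3_germ[OF deg_at CL_X deg_at_in_X[OF deg_at(1)]] by auto
  have "tri M e0 e1 e2 \<in> K" if M: "M \<in> CL" "M \<subseteq> N" for M
    using tri_D0[OF levels3_restrict[OF N(3) M] P_restrict[OF N(4) M] P_restrict[OF N(5) M]
      P_restrict[OF N(6) M]]
      assms by auto
  then show "cycles_near K y e0 e1 e2" unfolding cycles_near_def using N by auto
qed

text \<open>The cycle (e0 r r') with a fresh r' of the same degree lies in \<open>D0\<close>, and
  conjugation by it carries the leg e0 to r while fixing e1 and e2.\<close>

lemma cycles_near_replace:
  assumes K: "subgroup K FG" "D0 \<subseteq> K" and g: "cycles_near K y e0 e1 e2"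
    and c: "deg_at c e0 y" "deg_at c r y" and r: "r y \<noteq> e0 y" "r y \<noteq> e1 y" "r y \<noteq> e2 y"
  shows "cycles_near K y r e1 e2"
proof -
  obtain r' where r': "deg_at c r' y" "r' y \<notin> {e0 y, e1 y, e2 y, r y}"
    using fresh_germ[OF cycles_near_in_X[OF g], of "{e0 y, e1 y, e2 y, r y}" c] by auto
  have "cycles_near K y e0 r r'" by (rule all_cycles_nearD[OF all_cycles_near_constant[OF K(2)] c
    r'(1)]) (use r r'(2) in auto)
  from cycles_near_shared[OF K(1) this g] show ?thesis using r r'(2) by auto
qed

text \<open>At a given point only the degrees of the legs matter. The legs are exchanged one at a
  time, with a detour through fresh legs because some \<open>u\<close> may share its value with one
  of the \<open>e\<close>.\<close>

lemma cycles_near_same_degrees: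
  assumes K: "subgroup K FG" "D0 \<subseteq> K" and g: "cycles_near K y e0 e1 e2"
    and e: "deg_at c0 e0 y" "deg_at c1 e1 y" "deg_at c2 e2 y" and u: "deg_at c0 u0 y"
      "deg_at c1 u1 y" "deg_at c2 u2 y"
    and d: "u0 y \<noteq> u1 y" "u0 y \<noteq> u2 y" "u1 y \<noteq> u2 y"
  shows "cycles_near K y u0 u1 u2"
proof -
  let ?S = "{e0 y, e1 y, e2 y, u0 y, u1 y, u2 y}"
  note y = cycles_near_in_X[OF g]
  obtain r0 where r0: "deg_at c0 r0 y" "r0 y \<notin> ?S" using fresh_germ[OF y, of ?S c0] by auto
  obtain r1 where r1: "deg_at c1 r1 y" "r1 y \<notin> insert (r0 y) ?S"
    using fresh_germ[OF y, of "insert (r0 y) ?S" c1] by auto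
  obtain r2 where r2: "deg_at c2 r2 y" "r2 y \<notin> {r0 y, r1 y} \<union> ?S"
    using fresh_germ[OF y, of "{r0 y, r1 y} \<union> ?S" c2] by auto
  have "cycles_near K y r0 e1 e2" using cycles_near_replace[OF K g e(1) r0(1)] r0(2) by auto
  then have "cycles_near K y r1 e2 r0" using cycles_near_replace[OF K cycles_near_rot e(2) r1(1)]
    r1(2) by auto
  then have "cycles_near K y r2 r0 r1" using cycles_near_replace[OF K cycles_near_rot e(3) r2(1)]
    r2(2) by auto
  then have "cycles_near K y u0 r1 r2" using cycles_near_replace[OF K cycles_near_rot r0(1) u(1)]
    r0(2) r1(2) r2(2) by auto
  then have "cycles_near K y u1 r2 u0" using cycles_near_replace[OF K cycles_near_rot r1(1) u(2)]
    r1(2) r2(2) d by auto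
  then have "cycles_near K y u2 u0 u1" using cycles_near_replace[OF K cycles_near_rot r2(1) u(3)]
    r2(2) d by auto
  then show ?thesis by (rule cycles_near_rot)
qed

section \<open>Elements of mixed degree\<close>

definition mixed :: "('x \<Rightarrow> 'x) \<Rightarrow> bool" where
  "mixed f \<longleftrightarrow> (\<exists>x y a b. deg_at a f x \<and> deg_at b f y \<and> \<not> int p dvd b - a)"

lemma not_mixed_imp_pure:
  assumes "f \<in> F" "\<not> mixed f"
  shows "\<exists>a. \<forall>x \<in> X. deg_at a f x"
proof -
  obtain x0 where x0: "x0 \<in> X" using X_nonempty by auto
  then obtain a where a: "deg_at a f x0" using F_deg_at[OF assms(1)] by auto
  have "deg_at a f x" if x: "x \<in> X" for x
  proof -
    obtain b where b: "deg_at b f x" using F_deg_at[OF assms(1) x] by auto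
    then have "int p dvd b - a" using assms(2) a unfolding mixed_def by auto
    then show ?thesis using deg_at_dvd[OF b] by simp
  qed
  then show ?thesis by auto
qed

text \<open>Three legs of degree 0 start at \<open>x\<close>: the identity stays where
  \<open>f\<close> has degree \<open>a\<close>, the two others land where \<open>f\<close> has
  degree \<open>b\<close>. Composing with \<open>f\<close> gives degrees (a, b, b), the seed for
  \<open>Alt_subset\<close>.\<close>

lemma mixed_levels:
  assumes f: "f \<in> F" "mixed f"
  shows "\<exists>A e0 e1 e2 a b. A \<noteq> {} \<and> levels3 A e0 e1 e2 \<and> P 0 A e0 \<and> P 0 A e1 \<and> P 0 A e2 \<and>
    P a A (\<lambda>x. f (e0 x)) \<and> P b A (\<lambda>x. f (e1 x)) \<and> P b A (\<lambda>x. f (e2 x)) \<and> \<not> int p dvd b - a"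
proof -
  obtain x y a b where ab: "deg_at a f x" "deg_at b f y" "\<not> int p dvd b - a" using f(2) unfolding
    mixed_def by auto
  have x: "x \<in> X" using deg_at_in_X[OF ab(1)] .
  obtain Na where Na: "x \<in> Na" "Na \<in> CL" "P a Na f" using deg_at_nbhd[OF ab(1) CL_X x] by auto
  obtain Nb where Nb: "y \<in> Nb" "Nb \<in> CL" "P b Nb f" using deg_at_nbhd[OF ab(2) CL_X deg_at_in_X[OF
    ab(2)]] by auto
  \<comment> \<open>The targets avoid the values already taken, so that the three legs differ at
    \<open>x\<close>.\<close>
  obtain B1 where B1: "B1 \<in> CL" "B1 \<noteq> {}" "B1 \<subseteq> Nb" "B1 \<inter> {x} = {}"
    using clopen_avoiding[OF Nb(2), of "{x}"] Nb(1) by auto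
  obtain A1 g where g: "P 0 A1 g" "x \<in> A1" "g x \<in> B1" using P_minimal[OF x B1(1,2)] by auto
  obtain B2 where B2: "B2 \<in> CL" "B2 \<noteq> {}" "B2 \<subseteq> Nb" "B2 \<inter> {x, g x} = {}"
    using clopen_avoiding[OF Nb(2), of "{x, g x}"] Nb(1) by auto
  obtain A2 h where h: "P 0 A2 h" "x \<in> A2" "h x \<in> B2" using P_minimal[OF x B2(1,2)] by auto
  have deg_at: "deg_at 0 (\<lambda>x. x) x" "deg_at 0 g x" "deg_at 0 h x" using deg_at_id[OF x]
    P_imp_deg_at[OF g(1,2)] P_imp_deg_at[OF h(1,2)] by auto
  have ne: "x \<noteq> g x" "x \<noteq> h x" "g x \<noteq> h x" using B1(4) B2(4) g(3) h(3) by auto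
  obtain N where N: "N \<in> CL" "x \<in> N" "N \<subseteq> Na" "levels3 N (\<lambda>x. x) g h" "P 0 N (\<lambda>x. x)" "P 0 N g"
    "P 0 N h"
    using levels3_germ[OF deg_at ne Na(2,1)] by auto
  let ?A = "{z \<in> N. g z \<in> Nb} \<inter> {z \<in> N. h z \<in> Nb}"
  have A: "?A \<in> CL" "?A \<subseteq> N" using CL_Int[OF P_preimage[OF N(6) Nb(2)] P_preimage[OF N(7) Nb(2)]]
    by auto
  have P: "P 0 ?A (\<lambda>x. x)" "P 0 ?A g" "P 0 ?A h" using P_restrict[OF _ A] N by auto
  have "?A \<subseteq> Na" using A(2) N(3) by auto
  then have P0: "P a ?A f" using P_restrict[OF Na(3) A(1)] by simp
  have "P b (g ` ?A) f" "P b (h ` ?A) f" using P_restrict[OF Nb(3)] P_image[OF P(2)] P_image[OF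
    P(3)] by auto
  then have "P (0 + b) ?A (\<lambda>x. f (g x))" "P (0 + b) ?A (\<lambda>x. f (h x))" using P_comp P by blast+
  moreover have "?A \<noteq> {}" using N(2) g(3) h(3) B1(3) B2(3) by auto
  ultimately show ?thesis using levels3_restrict[OF N(4) A] P P0 ab(3)
    by (intro exI[of _ ?A] exI[of _ "\<lambda>x. x"] exI[of _ g] exI[of _ h] exI[of _ a] exI[of _ b]) simp
qed

text \<open>The conjugated cycle moves a level of degree \<open>a\<close> to one of degree
  \<open>b\<close>. It therefore has degree \<open>b - a\<close> there, whereas every element of
  \<open>D0\<close> has degree 0.\<close>

lemma normalizing_not_mixed:
  assumes f: "f \<in> F" and n: "\<And>g. g \<in> D0 \<Longrightarrow> f \<otimes>\<^bsub>FG\<^esub> g \<otimes>\<^bsub>FG\<^esub> inv\<^bsub>FG\<^esub> f \<in> D0"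
  shows "\<not> mixed f"
proof
  assume "mixed f"
  then obtain A e0 e1 e2 a b where e: "A \<noteq> {}" "levels3 A e0 e1 e2" "P 0 A e0" "P 0 A e1" "P 0 A e2"
    "P a A (\<lambda>x. f (e0 x))" "P b A (\<lambda>x. f (e1 x))" "\<not> int p dvd b - a"
    using mixed_levels[OF f] by blast
  obtain x where x: "x \<in> A" using e(1) by auto
  let ?t = "tri A (\<lambda>x. f (e0 x)) (\<lambda>x. f (e1 x)) (\<lambda>x. f (e2 x))"
  have l: "levels3 A (\<lambda>x. f (e0 x)) (\<lambda>x. f (e1 x)) (\<lambda>x. f (e2 x))" using levels3_image[OF e(2) f] .
  have "?t \<in> F0" using n[OF tri_D0[OF e(2-5)]] tri_conj[OF e(2) f] D0_subset by auto
  then have "deg_at 0 ?t (f (e0 x))" using Q_in_X[OF levels3_Q(1)[OF l] x] by (simp add: F0_def)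
  moreover have "deg_at (b - a) ?t (f (e0 x))"
    using deg_at_transfer[OF levels3_Q(1)[OF l] x P_imp_deg_at[OF e(6) x] P_imp_deg_at[OF e(7) x],
      of ?t]
      tri_eval(1)[OF l] by simp
  ultimately have "int p dvd 0 - (b - a)" by (rule deg_at_unique)
  then have "int p dvd b - a" by (metis diff_0 dvd_minus_iff)
  then show False using e(8) by simp
qed

text \<open>A cycle with legs of degrees 0, 0, 1 has degree 0 on its first level and degree 1 on its
  second. Its existence makes the normalizer of \<open>D0\<close> proper.\<close>

lemma mixed_in_D: "\<exists>f \<in> D. mixed f"
proof -
  obtain y where y: "y \<in> X" using X_nonempty by auto
  obtain e1 where e1: "deg_at 0 e1 y" "e1 y \<notin> {y}" using fresh_germ[OF y, of "{y}" 0] by auto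
  obtain e2 where e2: "deg_at 1 e2 y" "e2 y \<notin> {y, e1 y}" using fresh_germ[OF y, of "{y, e1 y}" 1]
    by auto
  obtain N where N: "y \<in> N" "levels3 N (\<lambda>x. x) e1 e2"
    using levels3_germ[OF deg_at_id[OF y] e1(1) e2(1) _ _ _ CL_X y] e1(2) e2(2) by auto
  let ?t = "tri N (\<lambda>x. x) e1 e2"
  note Q = levels3_Q[OF N(2)]
  have "deg_at (0 - 0) ?t y"
    using deg_at_transfer[OF Q(1) N(1) deg_at_id[OF y] e1(1), of ?t] tri_eval(1)[OF N(2)] by simp
  moreover have "deg_at (1 - 0) ?t (e1 y)"
    using deg_at_transfer[OF Q(2) N(1) e1(1) e2(1), of ?t] tri_eval(2)[OF N(2)] by simp
  moreover have "\<not> int p dvd (1 - 0) - (0 - 0)" using prime_gt_1_nat[OF prime_p] by simp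
  ultimately have "mixed ?t" unfolding mixed_def by blast
  then show ?thesis using tri_D[OF N(2)] by blast
qed

lemma tri_empty: "tri {} e0 e1 e2 = \<one>\<^bsub>FG\<^esub>"
proof -
  have "levels3 {} e0 e1 e2" by (simp add: levels3_def Q_def)
  from tri_eqI[OF this F_one] show ?thesis by simp
qed

text \<open>By \<open>cycles_near_same_degrees\<close> it is enough to enlarge the set of degree
  triples whose cycles lie in \<open>K\<close>, starting from the conjugate by \<open>f\<close> of a
  cycle in \<open>D0\<close>. Once all triples are available, compactness assembles every cycle from
  small ones.\<close>

lemma Alt_subset:
  assumes K: "subgroup K FG" "D0 \<subseteq> K" and f: "f \<in> K" "mixed f"
  shows "Alt \<subseteq> K"
proof -
  have fF: "f \<in> F" using subgroup.subset[OF K(1)] f by auto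
  obtain A e0 e1 e2 a b where e: "A \<noteq> {}" "levels3 A e0 e1 e2" "P 0 A e0" "P 0 A e1" "P 0 A e2"
    "P a A (\<lambda>x. f (e0 x))" "P b A (\<lambda>x. f (e1 x))" "P b A (\<lambda>x. f (e2 x))" "\<not> int p dvd b - a"
    using mixed_levels[OF fF f(2)] by blast
  have A: "A \<in> CL" using P_clopen[OF e(3)] .
  have base: "cycles_near K x (\<lambda>x. f (e0 x)) (\<lambda>x. f (e1 x)) (\<lambda>x. f (e2 x))" if x: "x \<in> A" for x
  proof (rule cycles_near_conj[OF K(1) f(1) _ A x])
    have "tri M e0 e1 e2 \<in> K" if M: "M \<in> CL" "M \<subseteq> A" for M
      using tri_D0[OF levels3_restrict[OF e(2) M] P_restrict[OF e(3) M] P_restrict[OF e(4) M]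
        P_restrict[OF e(5) M]]
        K(2) by auto
    then show "cycles_near K x e0 e1 e2" unfolding cycles_near_def using A x e(2) by auto
  qed auto
  define c where "c = b - a"
  \<comment> \<open>By minimality, every arrow of degree \<open>c\<close> is the product of an arrow of degree 0, one occurring in the
    conjugated three-cycle, and another arrow of degree 0.\<close>
  have W1: "all_cycles_near K d (d + c) (d + c)" for d
    unfolding all_cycles_near_def
  proof (intro allI impI)
    fix y u0 u1 u2
    assume u: "deg_at d u0 y" "deg_at (d + c) u1 y" "deg_at (d + c) u2 y"
      and ne: "u0 y \<noteq> u1 y" "u0 y \<noteq> u2 y" "u1 y \<noteq> u2 y"
    let ?e = "\<lambda>x. f (e0 x)"
    have "?e ` A \<noteq> {}" using e(1) by simp
    from P_minimal[OF deg_at_image_in_X[OF u(1)] P_image[OF e(6)] this]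
    obtain B v0 where v0: "u0 y \<in> B" "P 0 B v0" "v0 (u0 y) \<in> ?e ` A" by auto
    let ?i = "the_inv_into A ?e"
    obtain x where x: "x \<in> A" "v0 (u0 y) = ?e x" using v0(3) by auto
    have i: "?i (?e z) = z" if "z \<in> A" for z using the_inv_into_f_f[OF P_inj[OF e(6)] that] .
    have "deg_at (- a) ?i (?e x)" using deg_at_inv[OF P_imp_deg_at[OF e(6) x(1)] A x(1)] i by blast
    then have "deg_at (- a) ?i (v0 (u0 y))" using x(2) by simp
    from deg_at_comp[OF deg_at_comp[OF u(1) P_imp_deg_at[OF v0(2,1)]] this]
    have v: "deg_at (d - a) (\<lambda>z. ?i (v0 (u0 z))) y" by simp
    let ?v = "\<lambda>z. ?i (v0 (u0 z))"
    have vy: "?v y = x" using x i by simp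
    have g: "cycles_near K y (\<lambda>z. f (e0 (?v z))) (\<lambda>z. f (e1 (?v z))) (\<lambda>z. f (e2 (?v z)))"
      by (rule cycles_near_precompose[OF _ v]) (use base[OF x(1)] vy in simp)
    have l: "deg_at (d - a + a) (\<lambda>z. f (e0 (?v z))) y" "deg_at (d - a + b) (\<lambda>z. f (e1 (?v z))) y"
      "deg_at (d - a + b) (\<lambda>z. f (e2 (?v z))) y"
      using deg_at_comp[OF v, of a "\<lambda>x. f (e0 x)"] deg_at_comp[OF v, of b "\<lambda>x. f (e1 x)"]
        deg_at_comp[OF v, of b "\<lambda>x. f (e2 x)"]
        P_imp_deg_at[OF e(6) x(1)] P_imp_deg_at[OF e(7) x(1)] P_imp_deg_at[OF e(8) x(1)] vy by
          simp_all
    have eq: "d - a + a = d" "d - a + b = d + c" by (simp_all add: c_def)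
    show "cycles_near K y u0 u1 u2" by (rule cycles_near_same_degrees[OF K g l[unfolded eq] u ne])
  qed
  \<comment> \<open>With \<open>m\<close> of degree \<open>d + c\<close>, both (u0 m u2) and (u1 m
    u2) are of the kind \<open>W1\<close>; they share two legs, and
    \<open>cycles_near_shared2\<close> eliminates \<open>m\<close>.\<close>
  have W2: "all_cycles_near K d d (d + c)" for d
    unfolding all_cycles_near_def
  proof (intro allI impI)
    fix y u0 u1 u2
    assume u: "deg_at d u0 y" "deg_at d u1 y" "deg_at (d + c) u2 y"
      and ne: "u0 y \<noteq> u1 y" "u0 y \<noteq> u2 y" "u1 y \<noteq> u2 y"
    obtain m where m: "deg_at (d + c) m y" "m y \<notin> {u0 y, u1 y, u2 y}"
      using fresh_germ[OF deg_at_in_X[OF u(1)], of "{u0 y, u1 y, u2 y}" "d + c"] by auto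
    have "cycles_near K y u0 m u2" by (rule all_cycles_nearD[OF W1 u(1) m(1) u(3)]) (use m(2) ne
      in auto)
    then have 1: "cycles_near K y m u2 u0" by (rule cycles_near_rot)
    have "cycles_near K y u1 m u2" by (rule all_cycles_nearD[OF W1 u(2) m(1) u(3)]) (use m(2) ne
      in auto)
    then have 2: "cycles_near K y m u2 u1" by (rule cycles_near_rot)
    have "cycles_near K y u2 u0 u1" using cycles_near_shared2[OF K(1) 1 2] ne by auto
    then show "cycles_near K y u0 u1 u2" by (rule cycles_near_rot)
  qed
  \<comment> \<open>One step adds \<open>c\<close> to the last degree. The cycle (m' m u2) is of the
    kind \<open>W2\<close> at the degree reached so far, (u0 u1 m) comes from the induction
    hypothesis, and they share only \<open>m\<close>, which is replaced by
    \<open>u2\<close>.\<close>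
  have W3: "all_cycles_near K d d (d + int k * c)" for d k
  proof (induction k)
    case 0 then show ?case using all_cycles_near_constant[OF K(2)] by simp
  next
    case (Suc k)
    show ?case unfolding all_cycles_near_def
    proof (intro allI impI)
      fix y u0 u1 u2
      assume u: "deg_at d u0 y" "deg_at d u1 y" "deg_at (d + int (Suc k) * c) u2 y"
        and ne: "u0 y \<noteq> u1 y" "u0 y \<noteq> u2 y" "u1 y \<noteq> u2 y"
      let ?d = "d + int k * c"
      have u2: "deg_at (?d + c) u2 y" using u(3) by (simp add: algebra_simps)
      obtain m where m: "deg_at ?d m y" "m y \<notin> {u0 y, u1 y, u2 y}"
        using fresh_germ[OF deg_at_in_X[OF u(1)], of "{u0 y, u1 y, u2 y}" ?d] by auto
      obtain m' where m': "deg_at ?d m' y" "m' y \<notin> {u0 y, u1 y, u2 y, m y}"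
        using fresh_germ[OF deg_at_in_X[OF u(1)], of "{u0 y, u1 y, u2 y, m y}" ?d] by auto
      have "cycles_near K y m' m u2" by (rule all_cycles_nearD[OF W2 m'(1) m(1) u2]) (use m(2)
        m'(2) in auto)
      then have 1: "cycles_near K y m u2 m'" by (rule cycles_near_rot)
      have "cycles_near K y u0 u1 m" by (rule all_cycles_nearD[OF Suc.IH u(1,2) m(1)]) (use m(2)
        ne in auto)
      then have 2: "cycles_near K y m u0 u1" by (rule cycles_near_rot[OF cycles_near_rot])
      have "cycles_near K y u2 u0 u1" using cycles_near_shared[OF K(1) 1 2] ne m'(2) by auto
      then show "cycles_near K y u0 u1 u2" by (rule cycles_near_rot)
    qed
  qed
  \<comment> \<open>Here primality enters: Bezout gives an inverse \<open>s\<close> of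
    \<open>c\<close> modulo \<open>p\<close>, so \<open>k\<close> can be taken congruent to
    \<open>s * (d' - d)\<close>. It is reduced modulo \<open>p\<close> because \<open>W3\<close>
    needs a natural number.\<close>
  have W4: "all_cycles_near K d d d'" for d d'
  proof -
    have "prime (int p)" using prime_p by simp
    then have "coprime (int p) c" using e(9) unfolding c_def by (rule prime_imp_coprime)
    then have "gcd c (int p) = 1" by (simp add: coprime_iff_gcd_eq_1 gcd.commute)
    then obtain s t where st: "s * c + t * int p = 1" using bezout_int[of c "int p"] by auto
    let ?k = "nat ((s * (d' - d)) mod int p)"
    have k: "int ?k = (s * (d' - d)) mod int p" using prime_gt_0_nat[OF prime_p] by simp
    have "int p dvd s * (d' - d) - int ?k" unfolding k by (rule dvd_minus_mod)
    then have "int p dvd c * (s * (d' - d) - int ?k)" by (rule dvd_mult)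
    moreover have "(d + int ?k * c) - d' = - (c * (s * (d' - d) - int ?k)) - t * int p * (d' - d)"
      using st by (simp add: algebra_simps) algebra
    ultimately have dv: "int p dvd (d + int ?k * c) - d'"
      by (simp del: minus_diff_eq)
    then have dv': "int p dvd d' - (d + int ?k * c)" by (metis dvd_minus_iff minus_diff_eq)
    show ?thesis using W3[of d ?k] deg_at_dvd[OF _ dv'] unfolding all_cycles_near_def by blast
  qed
  \<comment> \<open>The auxiliary leg \<open>w\<close> repeats the degree of \<open>u0\<close>, so
    (w u0 u1) and (w u0 u2) are both covered by \<open>W4\<close>; they share two legs.\<close>
  have W: "cycles_near K y u0 u1 u2" if u: "deg_at i u0 y" "deg_at j u1 y" "deg_at k u2 y"
      and ne: "u0 y \<noteq> u1 y" "u0 y \<noteq> u2 y" "u1 y \<noteq> u2 y" for y u0 u1 u2 i j k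
  proof -
    obtain w where w: "deg_at i w y" "w y \<notin> {u0 y, u1 y, u2 y}"
      using fresh_germ[OF deg_at_in_X[OF u(1)], of "{u0 y, u1 y, u2 y}" i] by auto
    have 1: "cycles_near K y w u0 u1" by (rule all_cycles_nearD[OF W4 w(1) u(1,2)]) (use w(2) ne
      in auto)
    have 2: "cycles_near K y w u0 u2" by (rule all_cycles_nearD[OF W4 w(1) u(1,3)]) (use w(2) ne
      in auto)
    show ?thesis using cycles_near_shared2[OF K(1) 1 2] ne by auto
  qed
  have "tri A e0 e1 e2 \<in> K" if l: "levels3 A e0 e1 e2" for A e0 e1 e2
  proof -
    note Q = levels3_Q[OF l]
    have A: "A \<in> CL" using Q_clopen[OF Q(1)] .
    \<comment> \<open>Again stated for all clopen subsets, so that the induction hypothesis is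
      hereditary.\<close>
    then have "\<forall>M \<in> CL. M \<subseteq> A \<longrightarrow> tri M e0 e1 e2 \<in> K"
    proof (induction rule: clopen_induct)
      case empty
      then show ?case using subgroup.one_closed[OF K(1)] by (simp add: tri_empty)
    next
      case (local x)
      obtain c0 c1 c2 where "deg_at c0 e0 x" "deg_at c1 e1 x" "deg_at c2 e2 x" using Q_deg_at[OF _
        local] Q by metis
      moreover have "e0 x \<noteq> e1 x" "e0 x \<noteq> e2 x" "e1 x \<noteq> e2 x" using l local unfolding levels3_def
        by auto
      ultimately have "cycles_near K x e0 e1 e2" by (rule W)
      then obtain N where N: "N \<in> CL" "x \<in> N" "\<And>M. \<lbrakk>M \<in> CL; M \<subseteq> N\<rbrakk> \<Longrightarrow> tri M e0 e1 e2 \<in> K"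
        unfolding cycles_near_def by auto
      then show ?case using CL_Int[OF N(1) A] local by (intro bexI[of _ "N \<inter> A"]) auto
    next
      case (mono B C)
      then show ?case by auto
    next
      case (union B C)
      show ?case
      proof (intro ballI impI)
        fix M assume M: "M \<in> CL" "M \<subseteq> B \<union> C"
        have MB: "M \<inter> B \<in> CL" "M \<inter> C \<in> CL" using CL_Int M(1) union by auto
        have eq: "(M \<inter> B) \<union> (M \<inter> C) = M" using M(2) by auto
        have "M \<subseteq> A" using M(2) union by auto
        then have l': "levels3 ((M \<inter> B) \<union> (M \<inter> C)) e0 e1 e2" unfolding eq using
          levels3_restrict[OF l M(1)] by simp
        have "(M \<inter> B) \<inter> (M \<inter> C) = {}" using union by auto
        from tri_Un[OF l' MB this] show "tri M e0 e1 e2 \<in> K"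
          using union MB subgroup.m_closed[OF K(1)] unfolding eq by (metis inf_le2)
      qed
    qed
    then show ?thesis using A by auto
  qed
  then show ?thesis unfolding Alt_def by (intro FG.generate_subgroup_incl[OF _ K(1)]) auto
qed

end

section \<open>The commutator subgroup is generated by three-cycles\<close>

context normal
begin

lemma commutator_mem_iff:
  assumes "a \<in> carrier G" "b \<in> carrier G"
  shows "a \<otimes> b \<otimes> inv a \<otimes> inv b \<in> H \<longleftrightarrow> H #> (a \<otimes> b) = H #> (b \<otimes> a)"
proof -
  have "a \<otimes> b \<otimes> inv a \<otimes> inv b = (a \<otimes> b) \<otimes> inv (b \<otimes> a)"
    using assms by (simp add: inv_mult_group m_assoc)
  moreover have "(a \<otimes> b) \<otimes> inv (b \<otimes> a) \<in> H \<longleftrightarrow> a \<otimes> b \<in> H #> (b \<otimes> a)"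
    using rcos_module[of "b \<otimes> a" "a \<otimes> b"] assms by (simp add: is_group)
  moreover have "a \<otimes> b \<in> H #> (b \<otimes> a) \<longleftrightarrow> H #> (a \<otimes> b) = H #> (b \<otimes> a)"
    using repr_independence[of "a \<otimes> b" H "b \<otimes> a"] rcos_self[of "a \<otimes> b" H] assms subgroup_axioms
    by auto
  ultimately show ?thesis by simp
qed

text \<open>The centralizer of the image of \<open>b\<close> in the quotient by \<open>H\<close> is
  a subgroup, so only generators have to be tested.\<close>

lemma commute_mod_generate:
  assumes S: "S \<subseteq> carrier G" and b: "b \<in> carrier G"
    and "\<And>s. s \<in> S \<Longrightarrow> H #> (s \<otimes> b) = H #> (b \<otimes> s)" and a: "a \<in> generate G S"
  shows "H #> (a \<otimes> b) = H #> (b \<otimes> a)"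
proof -
  interpret Q: group "G Mod H" by (rule factorgroup_is_group)
  let ?q = "\<lambda>x. H #> x"
  interpret q: group_hom G "G Mod H" ?q
    by unfold_locales (rule r_coset_hom_Mod)
  have *: "?q (x \<otimes> y) = ?q (y \<otimes> x) \<longleftrightarrow> ?q x \<otimes>\<^bsub>G Mod H\<^esub> ?q y = ?q y \<otimes>\<^bsub>G Mod H\<^esub> ?q x"
    if "x \<in> carrier G" "y \<in> carrier G" for x y using that q.hom_mult by simp
  have c: "x \<in> carrier G" if "x \<in> generate G S" for x using generate_in_carrier[OF S that] .
  have "?q a \<otimes>\<^bsub>G Mod H\<^esub> ?q b = ?q b \<otimes>\<^bsub>G Mod H\<^esub> ?q a" using a
  proof (induction a rule: generate.induct)
    case one
    show ?case using q.hom_closed[OF b] by (metis Q.l_one Q.r_one q.hom_one)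
  next
    case (incl s)
    then show ?case using assms * by (metis subsetD)
  next
    case (inv s)
    then have s: "s \<in> carrier G" using S by auto
    have e: "?q s \<otimes>\<^bsub>G Mod H\<^esub> ?q b = ?q b \<otimes>\<^bsub>G Mod H\<^esub> ?q s" using assms(3)[OF inv] *[OF s b] by simp
    have "?q (inv s) = inv\<^bsub>G Mod H\<^esub> ?q s" using q.hom_inv[OF s] .
    then show ?case using e q.hom_closed[OF s] q.hom_closed[OF b]
      by (metis Q.inv_closed Q.inv_solve_left Q.inv_solve_right Q.m_assoc Q.m_closed)
  next
    case (eng x y)
    have x: "?q x \<in> carrier (G Mod H)" "?q y \<in> carrier (G Mod H)" "?q b \<in> carrier (G Mod H)"
      using q.hom_closed c eng.hyps b by auto
    have m: "?q (x \<otimes> y) = ?q x \<otimes>\<^bsub>G Mod H\<^esub> ?q y" using q.hom_mult c eng.hyps by auto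
    show ?case unfolding m using eng.IH x by (metis Q.m_assoc)
  qed
  then show ?thesis using * c[OF a] b by blast
qed

end

context graded_pseudogroup
begin

definition commute_mod :: "('x \<Rightarrow> 'x) \<Rightarrow> ('x \<Rightarrow> 'x) \<Rightarrow> bool" where
  "commute_mod a b \<longleftrightarrow> Alt #>\<^bsub>FG\<^esub> (a \<otimes>\<^bsub>FG\<^esub> b) = Alt #>\<^bsub>FG\<^esub> (b \<otimes>\<^bsub>FG\<^esub> a)"

lemma commute_mod_sym: "commute_mod a b \<Longrightarrow> commute_mod b a"
  by (simp add: commute_mod_def)

lemma commute_mod_generate:
  assumes S: "S \<subseteq> F" "\<And>s t. \<lbrakk>s \<in> S; t \<in> S\<rbrakk> \<Longrightarrow> commute_mod s t"
    and ab: "a \<in> generate FG S" "b \<in> generate FG S"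
  shows "commute_mod a b"
proof -
  have SC: "S \<subseteq> carrier FG" using S(1) by simp
  note gen = normal.commute_mod_generate[OF normal_Alt SC, folded commute_mod_def]
  have F: "a \<in> carrier FG" "b \<in> carrier FG" using FG.generate_in_carrier[OF SC] ab by auto
  have "commute_mod a t" if t: "t \<in> S" for t
    by (rule gen[OF _ _ ab(1)]) (use S t in auto)
  then have "commute_mod t a" if t: "t \<in> S" for t using commute_mod_sym t by simp
  then have "commute_mod b a" by (rule gen[OF F(1) _ ab(2)])
  then show ?thesis by (rule commute_mod_sym)
qed

lemma D_subset_Alt:
  assumes "\<And>a b. \<lbrakk>a \<in> F; b \<in> F\<rbrakk> \<Longrightarrow> commute_mod a b"
  shows "D \<subseteq> Alt"
  unfolding D_def derived_def
proof (rule FG.generate_subgroup_incl)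
  show "subgroup Alt FG" using normal_Alt by (rule normal_imp_subgroup)
  show "derived_set FG F \<subseteq> Alt"
    using assms normal.commutator_mem_iff[OF normal_Alt] unfolding commute_mod_def by auto
qed

text \<open>An element of \<open>Alt\<close> is trivial in the quotient, so conjugation by it
  changes nothing there. In detail, \<open>a\<close> is a word in \<open>t\<close> and its conjugate
  by \<open>t\<close>, and both commute with \<open>b\<close> modulo \<open>Alt\<close>, the first
  because \<open>Alt\<close> is normal.\<close>

lemma commute_mod_conj:
  assumes t: "t \<in> Alt" and a: "a \<in> F" and b: "b \<in> F" and c:
    "commute_mod (t \<otimes>\<^bsub>FG\<^esub> a \<otimes>\<^bsub>FG\<^esub> inv\<^bsub>FG\<^esub> t) b"
  shows "commute_mod a b"
proof -
  interpret Alt: normal Alt FG by (rule normal_Alt)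
  have tF: "t \<in> F" using Alt.subset t by auto
  let ?c = "t \<otimes>\<^bsub>FG\<^esub> a \<otimes>\<^bsub>FG\<^esub> inv\<^bsub>FG\<^esub> t"
  have cF: "?c \<in> F" using tF a by simp
  have tb: "Alt #>\<^bsub>FG\<^esub> (t \<otimes>\<^bsub>FG\<^esub> b) = Alt #>\<^bsub>FG\<^esub> (b \<otimes>\<^bsub>FG\<^esub> t)"
  proof -
    have "b \<otimes>\<^bsub>FG\<^esub> inv\<^bsub>FG\<^esub> t \<otimes>\<^bsub>FG\<^esub> inv\<^bsub>FG\<^esub> b \<in> Alt"
      using Alt.inv_op_closed2[of b "inv\<^bsub>FG\<^esub> t"] Alt.m_inv_closed[OF t] b by simp
    then have "t \<otimes>\<^bsub>FG\<^esub> (b \<otimes>\<^bsub>FG\<^esub> inv\<^bsub>FG\<^esub> t \<otimes>\<^bsub>FG\<^esub> inv\<^bsub>FG\<^esub> b) \<in> Alt" using Alt.m_closed[OF t] by simp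
    then have "t \<otimes>\<^bsub>FG\<^esub> b \<otimes>\<^bsub>FG\<^esub> inv\<^bsub>FG\<^esub> t \<otimes>\<^bsub>FG\<^esub> inv\<^bsub>FG\<^esub> b \<in> Alt" using tF b by (simp add: FG.m_assoc)
    then show ?thesis using Alt.commutator_mem_iff[of t b] tF b by simp
  qed
  have gen: "a \<in> generate FG {t, ?c}"
  proof -
    have "inv\<^bsub>FG\<^esub> t \<otimes>\<^bsub>FG\<^esub> ?c \<otimes>\<^bsub>FG\<^esub> t \<in> generate FG {t, ?c}"
      by (rule generate.eng[OF generate.eng[OF generate.inv generate.incl] generate.incl]) simp_all
    moreover have "inv\<^bsub>FG\<^esub> t \<otimes>\<^bsub>FG\<^esub> ?c \<otimes>\<^bsub>FG\<^esub> t = a"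
      using tF a FG.inv_closed[of t] by (simp add: FG.m_assoc[symmetric]) (simp add: FG.m_assoc)
    ultimately show ?thesis by simp
  qed
  show ?thesis unfolding commute_mod_def
    by (rule Alt.commute_mod_generate[OF _ _ _ gen]) (use tF cF b tb c in \<open>auto simp:
      commute_mod_def\<close>)
qed

lemma disjoint_supports_commute:
  assumes f: "f \<in> F" "\<And>x. \<lbrakk>x \<in> X; x \<notin> Z\<rbrakk> \<Longrightarrow> f x = x"
    and g: "g \<in> F" "\<And>x. \<lbrakk>x \<in> X; x \<notin> W\<rbrakk> \<Longrightarrow> g x = x"
    and ZW: "Z \<inter> W = {}"
  shows "f \<otimes>\<^bsub>FG\<^esub> g = g \<otimes>\<^bsub>FG\<^esub> f"
proof (rule F_eqI)
  fix x assume x: "x \<in> X"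
  have inZ: "f x \<in> Z" if "x \<in> Z" using f(2)[OF F_in_X[OF f(1) x]] F_inj[OF f(1) F_in_X[OF f(1) x]
    x] that by metis
  have inW: "g x \<in> W" if "x \<in> W" using g(2)[OF F_in_X[OF g(1) x]] F_inj[OF g(1) F_in_X[OF g(1) x]
    x] that by metis
  have "f (g x) = g (f x)"
  proof (cases "x \<in> Z")
    case True
    then have "g x = x" "g (f x) = f x" using inZ ZW g(2) x F_in_X[OF f(1) x] by auto
    then show ?thesis by simp
  next
    case False
    then have fx: "f x = x" using f(2) x by simp
    show ?thesis
    proof (cases "x \<in> W")
      case True
      then have "f (g x) = g x" using inW ZW f(2) F_in_X[OF g(1) x] by auto
      then show ?thesis using fx by simp
    qed (use fx g(2) x in auto)
  qed
  then show "(f \<otimes>\<^bsub>FG\<^esub> g) x = (g \<otimes>\<^bsub>FG\<^esub> f) x" using f g x by simp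
qed (use f g in auto)

text \<open>The cycle carries \<open>Z\<close> to its copy under \<open>u\<close>; the second copy,
  under \<open>v\<close>, is there to make the move a three-cycle, hence an element of
  \<open>Alt\<close>.\<close>

lemma move_support:
  assumes f: "f \<in> F" "\<And>x. \<lbrakk>x \<in> X; x \<notin> Z\<rbrakk> \<Longrightarrow> f x = x" and l: "levels3 Z (\<lambda>x. x) u v"
  shows "\<exists>f' \<in> F. (\<forall>x \<in> X. x \<notin> u ` Z \<longrightarrow> f' x = x) \<and> (\<forall>g \<in> F. commute_mod f' g \<longrightarrow> commute_mod f g)"
proof -
  let ?t = "tri Z (\<lambda>x. x) u v"
  let ?f = "?t \<otimes>\<^bsub>FG\<^esub> f \<otimes>\<^bsub>FG\<^esub> inv\<^bsub>FG\<^esub> ?t"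
  have t: "?t \<in> F" using tri_F[OF l] .
  have fF: "?f \<in> F" using t f by simp
  have "?f y = y" if y: "y \<in> X" "y \<notin> u ` Z" for y
  proof -
    obtain x where x: "x \<in> X" "?t x = y" using F_surj[OF t y(1)] by auto
    have "x \<notin> Z" using tri_eval(1)[OF l, of x] x y by auto
    then have "f x = x" using f x by simp
    moreover have "?f (?t x) = ?t (f x)" using f t x(1) F_in_X[OF t x(1)] by simp
    ultimately show ?thesis using x(2) by simp
  qed
  moreover have "commute_mod f g" if "g \<in> F" "commute_mod ?f g" for g
    using commute_mod_conj[OF tri_Alt[OF l] f(1) that] .
  ultimately show ?thesis using fF by blast
qed

lemma commute_mod_if_movable:
  assumes f: "f \<in> F" "\<And>x. \<lbrakk>x \<in> X; x \<notin> Z\<rbrakk> \<Longrightarrow> f x = x"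
    and g: "g \<in> F" "\<And>x. \<lbrakk>x \<in> X; x \<notin> W\<rbrakk> \<Longrightarrow> g x = x"
    and l: "levels3 Z (\<lambda>x. x) u v" and uW: "u ` Z \<inter> W = {}"
  shows "commute_mod f g"
proof -
  obtain f' where f': "f' \<in> F" "\<And>x. \<lbrakk>x \<in> X; x \<notin> u ` Z\<rbrakk> \<Longrightarrow> f' x = x"
    "commute_mod f' g \<Longrightarrow> commute_mod f g"
    using move_support[OF f l] g(1) by auto
  have "commute_mod f' g" using disjoint_supports_commute[OF f'(1,2) g uW] by (simp add:
    commute_mod_def)
  then show ?thesis by (rule f'(3))
qed

subsection \<open>The purely infinite case\<close>

text \<open>The form in which pure infiniteness of the semidirect product reaches the pseudogroup:
  each clopen set contains two disjoint copies of itself.\<close>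

definition paradoxical :: bool where
  "paradoxical \<longleftrightarrow> (\<forall>A \<in> CL. \<exists>f g. Q A f \<and> Q A g \<and> f ` A \<subseteq> A \<and> g ` A \<subseteq> A \<and> f ` A \<inter> g ` A = {})"

text \<open>Locally, minimality moves a neighbourhood into \<open>B\<close>. The embeddings of two
  disjoint pieces may overlap in \<open>B\<close>; following them by the disjoint self-embeddings
  \<open>u\<close> and \<open>v\<close> of \<open>B\<close> separates the images.\<close>

lemma paradoxical_embed:
  assumes pi: paradoxical and A: "A \<in> CL" and B: "B \<in> CL" "B \<noteq> {}"
  shows "\<exists>f. Q A f \<and> f ` A \<subseteq> B"
  using A
proof (induction rule: clopen_induct)
  case empty
  show ?case by (simp add: Q_def)
next
  case (local x)
  then have "x \<in> X" using CL_subset[OF A] by auto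
  then obtain N f where f: "x \<in> N" "P 0 N f" "f x \<in> B" using P_minimal[OF _ B] by blast
  let ?N = "{y \<in> N. f y \<in> B} \<inter> A"
  have N: "?N \<in> CL" using CL_Int[OF P_preimage[OF f(2) B(1)] A] .
  have "P 0 ?N f" by (rule P_restrict[OF f(2) N]) auto
  then have "Q ?N f" by (rule P_imp_Q)
  then show ?case using N f local by (intro bexI[of _ ?N] conjI exI[of _ f]) auto
next
  case (mono C C')
  then obtain f where f: "Q C f" "f ` C \<subseteq> B" by auto
  then have "Q C' f" "f ` C' \<subseteq> B" using Q_restrict[OF f(1)] mono by auto
  then show ?case by auto
next
  case (union C C')
  obtain f where f: "Q C f" "f ` C \<subseteq> B" using union by auto
  obtain f' where f': "Q C' f'" "f' ` C' \<subseteq> B" using union by auto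
  obtain u v where uv: "Q B u" "Q B v" "u ` B \<subseteq> B" "v ` B \<subseteq> B" "u ` B \<inter> v ` B = {}"
    using pi B(1) unfolding paradoxical_def by metis
  let ?h = "\<lambda>x. if x \<in> C then u (f x) else v (f' x)"
  have 1: "Q C ?h" by (rule Q_cong[OF Q_comp[OF f(1) uv(1) f(2)]]) simp
  have 2: "Q C' ?h" by (rule Q_cong[OF Q_comp[OF f'(1) uv(2) f'(2)]]) (use union in auto)
  have i: "?h ` C \<subseteq> u ` B" "?h ` C' \<subseteq> v ` B" using f(2) f'(2) union by auto
  then have "inj_on ?h (C \<union> C')"
    using Q_inj[OF 1] Q_inj[OF 2] uv(5) by (subst inj_on_Un) blast
  from Q_Un[OF 1 2 this] show ?case using i uv(3,4) by (intro exI[of _ ?h]) (simp only: image_Un,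
    blast)
qed

lemma paradoxical_embed2:
  assumes pi: paradoxical and A: "A \<in> CL" and B: "B \<in> CL" "B \<noteq> {}"
  shows "\<exists>f g. Q A f \<and> Q A g \<and> f ` A \<subseteq> B \<and> g ` A \<subseteq> B \<and> f ` A \<inter> g ` A = {}"
proof -
  obtain h where h: "Q A h" "h ` A \<subseteq> B" using paradoxical_embed[OF assms] by auto
  obtain u v where uv: "Q B u" "Q B v" "u ` B \<subseteq> B" "v ` B \<subseteq> B" "u ` B \<inter> v ` B = {}"
    using pi B(1) unfolding paradoxical_def by metis
  have i: "(\<lambda>x. u (h x)) ` A \<subseteq> u ` B" "(\<lambda>x. v (h x)) ` A \<subseteq> v ` B" using h(2) by auto
  show ?thesis
  proof (intro exI conjI)
    show "Q A (\<lambda>x. u (h x))" "Q A (\<lambda>x. v (h x))"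
      using Q_comp[OF h(1) uv(1) h(2)] Q_comp[OF h(1) uv(2) h(2)] .
    show "(\<lambda>x. u (h x)) ` A \<subseteq> B" "(\<lambda>x. v (h x)) ` A \<subseteq> B" using i uv(3,4) by auto
    show "(\<lambda>x. u (h x)) ` A \<inter> (\<lambda>x. v (h x)) ` A = {}" using i uv(5) by blast
  qed
qed

text \<open>The support of \<open>f\<close> is moved in two stages, first into \<open>V1\<close> and
  from there into \<open>W1\<close>, where \<open>g\<close> is the identity. A single stage is
  impossible with a cycle whose first level is the complement of \<open>V1\<close>, since that level
  contains \<open>W1\<close> and levels must be disjoint.\<close>

lemma paradoxical_commute_mod:
  assumes pi: paradoxical
    and f: "f \<in> F" "V \<in> CL" "V \<noteq> {}" "\<And>x. x \<in> V \<Longrightarrow> f x = x"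
    and g: "g \<in> F" "W \<in> CL" "W \<noteq> {}" "\<And>x. x \<in> W \<Longrightarrow> g x = x"
  shows "commute_mod f g"
proof -
  obtain v where v: "v \<in> V" using f(3) by auto
  \<comment> \<open>Omitting \<open>v\<close> from \<open>W1\<close> keeps \<open>V - W1\<close>
    nonempty.\<close>
  obtain W1 where W1: "W1 \<in> CL" "W1 \<noteq> {}" "W1 \<subseteq> W" "W1 \<inter> {v} = {}"
    using clopen_avoiding[OF g(2,3), of "{v}"] by auto
  define V1 where "V1 = V - W1"
  have V1: "V1 \<in> CL" "V1 \<noteq> {}" "V1 \<subseteq> V" "V1 \<inter> W1 = {}"
    using CL_Diff[OF f(2) W1(1)] v W1(4) unfolding V1_def by auto
  let ?Z = "X - V1"
  have Z: "?Z \<in> CL" using CL_Diff[OF CL_X V1(1)] .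
  obtain a b where ab: "Q ?Z a" "Q ?Z b" "a ` ?Z \<subseteq> V1" "b ` ?Z \<subseteq> V1" "a ` ?Z \<inter> b ` ?Z = {}"
    using paradoxical_embed2[OF pi Z V1(1,2)] by auto
  have l1: "levels3 ?Z (\<lambda>x. x) a b" unfolding levels3_def using ab Q_id[OF Z] by auto
  obtain f' where f': "f' \<in> F" "\<And>x. \<lbrakk>x \<in> X; x \<notin> a ` ?Z\<rbrakk> \<Longrightarrow> f' x = x"
    "commute_mod f' g \<Longrightarrow> commute_mod f g"
  proof -
    have "f x = x" if "x \<in> X" "x \<notin> ?Z" for x using f(4) V1(3) that by auto
    from move_support[OF f(1) this l1] show ?thesis using g(1) that by blast
  qed
  obtain c d where cd: "Q V1 c" "Q V1 d" "c ` V1 \<subseteq> W1" "d ` V1 \<subseteq> W1" "c ` V1 \<inter> d ` V1 = {}"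
    using paradoxical_embed2[OF pi V1(1) W1(1,2)] by auto
  have l2: "levels3 V1 (\<lambda>x. x) c d" unfolding levels3_def using cd Q_id[OF V1(1)] V1(4) by auto
  have "commute_mod f' g"
  proof (rule commute_mod_if_movable[OF f'(1) _ g(1) _ l2, of "X - W1"])
    show "f' x = x" if "x \<in> X" "x \<notin> V1" for x using f'(2) ab(3) that by auto
    show "g x = x" if "x \<in> X" "x \<notin> X - W1" for x using g(4) W1(3) that by auto
    show "c ` V1 \<inter> (X - W1) = {}" using cd(3) by auto
  qed
  then show ?thesis by (rule f'(3))
qed

text \<open>On a small set \<open>N\<close> the element \<open>f\<close> is undone by the swap of
  \<open>N\<close> with its image. The swap composed with \<open>f\<close> then fixes
  \<open>N\<close>, and the swap itself fixes everything off \<open>N\<close> and its image.\<close>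

lemma product_of_proper_supports:
  assumes f: "f \<in> F"
  shows "f \<in> generate FG {g \<in> F. \<exists>V \<in> CL. V \<noteq> {} \<and> (\<forall>x \<in> V. g x = x)}" (is "_ \<in> generate FG ?S")
proof (cases "\<forall>x \<in> X. f x = x")
  case True
  then show ?thesis using f X_nonempty CL_X by (intro generate.incl) auto
next
  case False
  then obtain x where x: "x \<in> X" "f x \<noteq> x" by auto
  \<comment> \<open>The point \<open>z\<close> will lie off \<open>N\<close> and its image, which
    keeps the fixed set of the swap nonempty; to this end \<open>N\<close> has to miss
    \<open>z\<close> and its preimage \<open>z'\<close>.\<close>
  have "\<not> X \<subseteq> {x, f x}" using CL_infinite[OF CL_X X_nonempty] finite_subset by blast
  then obtain z where z: "z \<in> X" "z \<noteq> x" "z \<noteq> f x" by auto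
  obtain z' where z': "z' \<in> X" "f z' = z" using F_surj[OF f z(1)] by auto
  have "x \<notin> {z, z'}" using z z' by auto
  then obtain M where M: "M \<in> CL" "x \<in> M" "M \<inter> {z, z'} = {}"
    using separate_finite[of "{z, z'}" x] x(1) by auto
  obtain c where c: "deg_at c f x" using F_deg_at[OF f x(1)] by auto
  obtain N where N: "N \<in> CL" "x \<in> N" "N \<subseteq> M" "P c N f" "(\<lambda>x. x) ` N \<inter> f ` N = {}"
    using deg_at_separate[OF deg_at_id[OF x(1)] c _ M(1,2)] x(2) by auto
  let ?s = "swap N (\<lambda>x. x) f"
  have l: "levels2 N (\<lambda>x. x) f" unfolding levels2_def using Q_id[OF N(1)] P_imp_Q[OF N(4)] N(5) by
    simp
  have s: "?s \<in> F" using swap_F[OF l] .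
  have NX: "N \<subseteq> X" using CL_subset[OF N(1)] .
  have "?s \<otimes>\<^bsub>FG\<^esub> f \<in> F" using s f by simp
  moreover have "(?s \<otimes>\<^bsub>FG\<^esub> f) y = y" if "y \<in> N" for y
    using swap_eval(2)[OF l that] s f NX that by auto
  ultimately have 1: "?s \<otimes>\<^bsub>FG\<^esub> f \<in> ?S" using N(1,2) by blast
  let ?V = "X - (N \<union> f ` N)"
  have "?V \<in> CL" using CL_Diff[OF CL_X CL_Un[OF N(1) P_image[OF N(4)]]] .
  moreover have "z \<in> ?V"
  proof -
    have "z \<notin> N" "z' \<notin> N" using M(3) N(3) by auto
    moreover have "f y \<noteq> z" if "y \<in> N" for y
      using F_inj[OF f _ z'(1), of y] NX z'(2) that \<open>z' \<notin> N\<close> by auto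
    ultimately show ?thesis using z(1) by auto
  qed
  moreover have "?s y = y" if "y \<in> ?V" for y using swap_eval(3)[OF l] that by auto
  ultimately have "\<exists>V \<in> CL. V \<noteq> {} \<and> (\<forall>x \<in> V. ?s x = x)"
    by (intro bexI[of _ ?V] conjI ballI) (simp_all, auto)
  then have 2: "?s \<in> ?S" using s by simp
  have "f = ?s \<otimes>\<^bsub>FG\<^esub> (?s \<otimes>\<^bsub>FG\<^esub> f)"
    by (rule F_eqI) (use s f swap_involution[OF l] F_in_X in simp_all)
  moreover have "?s \<otimes>\<^bsub>FG\<^esub> (?s \<otimes>\<^bsub>FG\<^esub> f) \<in> generate FG ?S"
    using 1 2 by (intro generate.eng generate.incl)
  ultimately show ?thesis by simp
qed

lemma paradoxical_D_subset_Alt: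
  assumes paradoxical
  shows "D \<subseteq> Alt"
proof (rule D_subset_Alt)
  fix a b assume ab: "a \<in> F" "b \<in> F"
  show "commute_mod a b"
  proof (rule commute_mod_generate[OF _ _ product_of_proper_supports[OF ab(1)]
    product_of_proper_supports[OF ab(2)]])
    fix s t
    assume "s \<in> {g \<in> F. \<exists>V \<in> CL. V \<noteq> {} \<and> (\<forall>x \<in> V. g x = x)}"
      "t \<in> {g \<in> F. \<exists>V \<in> CL. V \<noteq> {} \<and> (\<forall>x \<in> V. g x = x)}"
    then obtain V W where "s \<in> F" "V \<in> CL" "V \<noteq> {}" "\<forall>x \<in> V. s x = x"
      "t \<in> F" "W \<in> CL" "W \<noteq> {}" "\<forall>x \<in> W. t x = x" by blast
    then show "commute_mod s t" using paradoxical_commute_mod[OF assms, of s V t W] by simp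
  qed auto
qed

end

subsection \<open>The almost finite case\<close>

text \<open>\<open>E\<close> is the orbit relation of an elementary subgroupoid, whose nonunits are covered by the finitely
  many compact open bisections that induce the partial maps in \<open>J\<close>.\<close>

locale finite_relation = graded_pseudogroup X CL p P L
  for X :: "'x set" and CL p P L +
  fixes E :: "('x \<times> 'x) set" and J :: "('x set \<times> ('x \<Rightarrow> 'x)) set"
  assumes equiv_E: "equiv X E"
    and finite_class: "x \<in> X \<Longrightarrow> finite (E `` {x})"
    and large_class: "x \<in> X \<Longrightarrow> 20 \<le> card (E `` {x})"
    and finite_J: "finite J"
    and J_Q: "(C, g) \<in> J \<Longrightarrow> Q C g"
    and J_E: "\<lbrakk>(C, g) \<in> J; x \<in> C\<rbrakk> \<Longrightarrow> (x, g x) \<in> E \<and> g x \<noteq> x"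
    and E_J: "\<lbrakk>(x, y) \<in> E; x \<noteq> y\<rbrakk> \<Longrightarrow> \<exists>(C, g) \<in> J. x \<in> C \<and> g x = y"
begin

lemma E_refl: "x \<in> X \<Longrightarrow> (x, x) \<in> E"
  and E_sym: "(x, y) \<in> E \<Longrightarrow> (y, x) \<in> E"
  and E_trans: "\<lbrakk>(x, y) \<in> E; (y, z) \<in> E\<rbrakk> \<Longrightarrow> (x, z) \<in> E"
  using equiv_E unfolding equiv_def by (blast dest: refl_onD symD transD)+

lemma E_in_X: "(x, y) \<in> E \<Longrightarrow> x \<in> X" "(x, y) \<in> E \<Longrightarrow> y \<in> X"
  using equiv_type[OF equiv_E] by auto

text \<open>The partial maps are processed one by one, and each adds all pairs it still can. The
  last clause is maximality with respect to the maps processed so far. It survives later steps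
  because the unmatched part of \<open>A\<close> shrinks and the used part of \<open>B\<close>
  grows.\<close>

lemma greedy_matching:
  assumes A: "A \<in> CL" and B: "B \<in> CL" and \<J>: "finite \<J>"
    and "\<forall>C g. (C, g) \<in> \<J> \<longrightarrow> Q C g \<and> (\<forall>x \<in> C. (x, g x) \<in> E)"
  shows "\<exists>A' f. Q A' f \<and> A' \<subseteq> A \<and> f ` A' \<subseteq> B \<and> (\<forall>x \<in> A'. (x, f x) \<in> E) \<and>
    (\<forall>C g x. (C, g) \<in> \<J> \<longrightarrow> x \<in> C \<longrightarrow> x \<in> A - A' \<longrightarrow> g x \<in> B \<longrightarrow> g x \<in> f ` A')"
  using \<J> assms(4)
proof (induction rule: finite_induct)
  case empty
  have "Q {} f" for f by (simp add: Q_def)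
  then show ?case by (intro exI[of _ "{}"]) auto
next
  case (insert Cg \<J>)
  obtain C g where Cg: "Cg = (C, g)" by (cases Cg)
  have "\<forall>C g. (C, g) \<in> \<J> \<longrightarrow> Q C g \<and> (\<forall>x \<in> C. (x, g x) \<in> E)" using insert.prems by blast
  from insert.IH[OF this]
  obtain A' f where f: "Q A' f" "A' \<subseteq> A" "f ` A' \<subseteq> B" "\<forall>x \<in> A'. (x, f x) \<in> E"
    and mx: "\<forall>C g x. (C, g) \<in> \<J> \<longrightarrow> x \<in> C \<longrightarrow> x \<in> A - A' \<longrightarrow> g x \<in> B \<longrightarrow> g x \<in> f ` A'"
    by (elim exE conjE)
  have g: "Q C g" "\<And>x. x \<in> C \<Longrightarrow> (x, g x) \<in> E" using insert.prems Cg by auto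
  have A': "A' \<in> CL" using Q_clopen[OF f(1)] .
  define M where "M = {x \<in> C. g x \<in> B - f ` A'} \<inter> (A - A')"
  have M: "M \<in> CL" unfolding M_def
    by (rule CL_Int[OF Q_preimage[OF g(1) CL_Diff[OF B Q_image[OF f(1)]]] CL_Diff[OF A A']])
  have MC: "M \<subseteq> C" unfolding M_def by auto
  let ?f = "\<lambda>x. if x \<in> A' then f x else g x"
  have nA: "x \<notin> A'" if "x \<in> M" for x using that unfolding M_def by auto
  have 1: "Q A' ?f" by (rule Q_cong[OF f(1)]) simp
  have 2: "Q M ?f" by (rule Q_cong[OF Q_restrict[OF g(1) M MC]]) (simp add: nA)
  have i: "?f ` A' = f ` A'" "?f ` M \<subseteq> B - f ` A'" using nA unfolding M_def by auto
  then have "?f ` A' \<inter> ?f ` M = {}" by blast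
  then have "inj_on ?f (A' \<union> M)" using Q_inj[OF 1] Q_inj[OF 2] by (subst inj_on_Un) blast
  from Q_Un[OF 1 2 this] have Q: "Q (A' \<union> M) ?f" .
  show ?case
  proof (intro exI conjI)
    show "Q (A' \<union> M) ?f" by (rule Q)
    show "A' \<union> M \<subseteq> A" using f(2) unfolding M_def by auto
    show "?f ` (A' \<union> M) \<subseteq> B" using i f(3) by (simp only: image_Un) blast
    show "\<forall>x \<in> A' \<union> M. (x, ?f x) \<in> E" using f(4) g(2) MC by auto
    have "h x \<in> ?f ` (A' \<union> M)"
      if h: "(C', h) \<in> insert Cg \<J>" "x \<in> C'" "x \<in> A - (A' \<union> M)" "h x \<in> B" for C' h x
    proof (cases "(C', h) = (C, g)")
      case True
      then have "g x \<in> f ` A'" using h unfolding M_def by auto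
      then show ?thesis using True i(1) by (auto simp: image_Un)
    next
      case False
      then have "h x \<in> f ` A'" using mx[rule_format, of C' h x] h Cg False by blast
      then show ?thesis using i(1) by (auto simp: image_Un)
    qed
    then show "\<forall>C' h x. (C', h) \<in> insert Cg \<J> \<longrightarrow> x \<in> C' \<longrightarrow> x \<in> A - (A' \<union> M) \<longrightarrow> h x \<in> B \<longrightarrow>
      h x \<in> ?f ` (A' \<union> M)" by (intro allI impI)
  qed
qed

text \<open>Since \<open>f\<close> stays within classes, it maps the part of \<open>A\<close> in a
  class onto the part of its image in the same class.\<close>

lemma class_image_card:
  assumes "inj_on f A" "\<And>x. x \<in> A \<Longrightarrow> (x, f x) \<in> E" "x \<in> X"
  shows "card (E `` {x} \<inter> f ` A) = card (E `` {x} \<inter> A)"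
proof -
  have "E `` {x} \<inter> f ` A = f ` (E `` {x} \<inter> A)"
    using assms(2) E_sym E_trans by blast
  then show ?thesis using inj_on_subset[OF assms(1)] by (simp add: card_image)
qed

text \<open>A match that is still possible at the end was possible when its partial map was processed, so the
  greedy matching leaves no point of \<open>A\<close> over.\<close>

lemma matching:
  assumes A: "A \<in> CL" and B: "B \<in> CL"
    and c: "\<And>x. x \<in> X \<Longrightarrow> card (E `` {x} \<inter> A) \<le> card (E `` {x} \<inter> B)"
  shows "\<exists>f. Q A f \<and> f ` A \<subseteq> B \<and> (\<forall>x \<in> A. (x, f x) \<in> E)"
proof -
  \<comment> \<open>The maps in \<open>J\<close> have no fixed points, so the identity is added to
    allow a point to be matched with itself.\<close>
  let ?J = "insert (X, \<lambda>x. x) J"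
  have "\<forall>C g. (C, g) \<in> ?J \<longrightarrow> Q C g \<and> (\<forall>x \<in> C. (x, g x) \<in> E)"
    using J_Q J_E E_refl Q_id[OF CL_X] by auto
  moreover have "finite ?J" using finite_J by simp
  ultimately obtain A' f where f: "Q A' f" "A' \<subseteq> A" "f ` A' \<subseteq> B" "\<And>x. x \<in> A' \<Longrightarrow> (x, f x) \<in> E"
    and mx: "\<forall>C g x. (C, g) \<in> ?J \<longrightarrow> x \<in> C \<longrightarrow> x \<in> A - A' \<longrightarrow> g x \<in> B \<longrightarrow> g x \<in> f ` A'"
    using greedy_matching[OF A B, of ?J] by metis
  have "A \<subseteq> A'"
  proof
    fix a assume a: "a \<in> A"
    show "a \<in> A'"
    proof (rule ccontr)
      assume na: "a \<notin> A'"
      have aX: "a \<in> X" using a CL_subset[OF A] by auto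
      note fin = finite_class[OF aX]
      \<comment> \<open>An unmatched \<open>a\<close> makes the count in its class strict, so some
        \<open>b\<close> in \<open>B\<close> of that class is still free; the map of
        \<open>?J\<close> from \<open>a\<close> to \<open>b\<close> then contradicts
        maximality.\<close>
      have "E `` {a} \<inter> A' \<subset> E `` {a} \<inter> A" using f(2) a na E_refl[OF aX] by blast
      then have "card (E `` {a} \<inter> A') < card (E `` {a} \<inter> A)" using fin by (intro
        psubset_card_mono) auto
      then have "card (E `` {a} \<inter> f ` A') < card (E `` {a} \<inter> B)"
        using c[OF aX] class_image_card[OF Q_inj[OF f(1)] f(4) aX] by simp
      moreover have "card (E `` {a} \<inter> B) \<le> card (E `` {a} \<inter> f ` A')" if "E `` {a} \<inter> B \<subseteq> f ` A'"
        using that fin by (intro card_mono) auto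
      ultimately obtain b where b: "(a, b) \<in> E" "b \<in> B" "b \<notin> f ` A'" by fastforce
      have "\<exists>(C, g) \<in> ?J. a \<in> C \<and> g a = b"
        using E_J[OF b(1)] aX by (cases "a = b") auto
      then obtain C g where "(C, g) \<in> ?J" "a \<in> C" "g a = b" by blast
      then have "g a \<in> f ` A'"
        using mx[rule_format, of C g a] a na b(2) by blast
      then show False using \<open>g a = b\<close> b(3) by simp
    qed
  qed
  then have "A' = A" using f(2) by simp
  then show ?thesis using f by auto
qed

text \<open>With one tenth, two small sets and a copy of one of them leave room in every class for a
  further copy. On the other hand, in classes of at least 20 points a small set may contain two
  points of each class.\<close>

definition small_set :: "'x set \<Rightarrow> bool" where
  "small_set Z \<longleftrightarrow> Z \<in> CL \<and> (\<forall>x \<in> X. 10 * card (E `` {x} \<inter> Z) \<le> card (E `` {x}))"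

definition small_elements :: "('x \<Rightarrow> 'x) set" where
  "small_elements = {f \<in> F. \<exists>Z. small_set Z \<and> (\<forall>x \<in> X. x \<notin> Z \<longrightarrow> f x = x)}"

lemma card_class_Diff:
  assumes "x \<in> X" "Z \<subseteq> X"
  shows "card (E `` {x} \<inter> (X - Z)) = card (E `` {x}) - card (E `` {x} \<inter> Z)"
    "card (E `` {x} \<inter> Z) \<le> card (E `` {x})"
proof -
  have "E `` {x} \<inter> (X - Z) = E `` {x} - (E `` {x} \<inter> Z)" using E_in_X by blast
  then show "card (E `` {x} \<inter> (X - Z)) = card (E `` {x}) - card (E `` {x} \<inter> Z)"
    using finite_class[OF assms(1)] by (simp add: card_Diff_subset)
  show "card (E `` {x} \<inter> Z) \<le> card (E `` {x})"
    using finite_class[OF assms(1)] by (intro card_mono) auto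
qed

text \<open>Counting in each class and \<open>matching\<close> yield two disjoint copies of
  \<open>Z\<close> outside \<open>Z \<union> W\<close>. They complete \<open>Z\<close> to the levels
  of a three-cycle that moves the support of \<open>f\<close> off that of \<open>g\<close>.\<close>

lemma small_commute_mod:
  assumes "f \<in> small_elements" "g \<in> small_elements"
  shows "commute_mod f g"
proof -
  obtain Z where Z: "small_set Z" "\<And>x. \<lbrakk>x \<in> X; x \<notin> Z\<rbrakk> \<Longrightarrow> f x = x"
    using assms(1) unfolding small_elements_def by auto
  obtain W where W: "small_set W" "\<And>x. \<lbrakk>x \<in> X; x \<notin> W\<rbrakk> \<Longrightarrow> g x = x"
    using assms(2) unfolding small_elements_def by auto
  have fg: "f \<in> F" "g \<in> F" using assms unfolding small_elements_def by auto
  have ZC: "Z \<in> CL" "W \<in> CL" using Z(1) W(1) unfolding small_set_def by auto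
  have sub: "Z \<subseteq> X" "W \<subseteq> X" using CL_subset ZC by auto
  have c1: "10 * card (E `` {x} \<inter> Z) \<le> card (E `` {x})" "10 * card (E `` {x} \<inter> W) \<le> card (E `` {x})"
    if "x \<in> X" for x using Z(1) W(1) that unfolding small_set_def by auto
  have U: "card (E `` {x} \<inter> (A \<union> B)) \<le> card (E `` {x} \<inter> A) + card (E `` {x} \<inter> B)" for x A B
    unfolding Int_Un_distrib by (rule card_Un_le)
  let ?Y = "Z \<union> W"
  have Y: "X - ?Y \<in> CL" "?Y \<subseteq> X" using CL_Diff[OF CL_X CL_Un[OF ZC]] sub by auto
  have "card (E `` {x} \<inter> Z) \<le> card (E `` {x} \<inter> (X - ?Y))" if x: "x \<in> X" for x
    using card_class_Diff[OF x Y(2)] c1[OF x] U[of x Z W] by linarith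
  from matching[OF ZC(1) Y(1) this]
  obtain u where u: "Q Z u" "u ` Z \<subseteq> X - ?Y" "\<And>x. x \<in> Z \<Longrightarrow> (x, u x) \<in> E" by auto
  let ?Y' = "?Y \<union> u ` Z"
  have Y': "X - ?Y' \<in> CL" "?Y' \<subseteq> X"
    using CL_Diff[OF CL_X CL_Un[OF CL_Un[OF ZC] Q_image[OF u(1)]]] Y(2) u(2) by auto
  have "card (E `` {x} \<inter> Z) \<le> card (E `` {x} \<inter> (X - ?Y'))" if x: "x \<in> X" for x
    using card_class_Diff[OF x Y'(2)] c1[OF x] U[of x Z W] U[of x ?Y "u ` Z"]
      class_image_card[OF Q_inj[OF u(1)] u(3) x] by linarith
  from matching[OF ZC(1) Y'(1) this]
  obtain v where v: "Q Z v" "v ` Z \<subseteq> X - ?Y'" by auto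
  have l: "levels3 Z (\<lambda>x. x) u v"
    unfolding levels3_def using u v Q_id[OF ZC(1)] by auto
  show ?thesis
    by (rule commute_mod_if_movable[OF fg(1) Z(2) fg(2) W(2) l]) (use u(2) in auto)
qed

text \<open>Related distinct points are joined by one of the finitely many maps in \<open>J\<close>.
  None of these fixes \<open>x\<close>, so one shrinking per map yields a neighbourhood that no map
  sends partly into itself.\<close>

lemma class_injective_neighbourhood:
  assumes "x \<in> X"
  shows "\<exists>N \<in> CL. x \<in> N \<and> (\<forall>y \<in> N. \<forall>z \<in> N. (y, z) \<in> E \<longrightarrow> y = z)"
proof -
  have "\<exists>N \<in> CL. x \<in> N \<and> (\<forall>C g y. (C, g) \<in> \<J> \<longrightarrow> y \<in> N \<longrightarrow> y \<in> C \<longrightarrow> g y \<notin> N)" if "finite \<J>" "\<J> \<subseteq> J" for \<J>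
    using that
  proof (induction rule: finite_induct)
    case empty
    then show ?case using assms CL_X by auto
  next
    case (insert Cg \<J>)
    obtain C g where Cg: "Cg = (C, g)" by (cases Cg)
    have "\<exists>N \<in> CL. x \<in> N \<and> (\<forall>C g y. (C, g) \<in> \<J> \<longrightarrow> y \<in> N \<longrightarrow> y \<in> C \<longrightarrow> g y \<notin> N)"
      using insert.IH insert.prems by simp
    then obtain N where N: "N \<in> CL" "x \<in> N" "\<forall>C g y. (C, g) \<in> \<J> \<longrightarrow> y \<in> N \<longrightarrow> y \<in> C \<longrightarrow> g y \<notin> N"
      by (elim bexE conjE)
    have J: "(C, g) \<in> J" using insert.prems Cg by simp
    have "\<exists>N' \<in> CL. x \<in> N' \<and> N' \<subseteq> N \<and> (\<forall>y \<in> N'. y \<in> C \<longrightarrow> g y \<notin> N')"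
    proof (cases "x \<in> C")
      case True
      then obtain c where c: "deg_at c g x" using Q_deg_at[OF J_Q[OF J]] by auto
      have "x \<noteq> g x" using J_E[OF J True] by auto
      then obtain N' where "N' \<in> CL" "x \<in> N'" "N' \<subseteq> N" "(\<lambda>x. x) ` N' \<inter> g ` N' = {}"
        using deg_at_separate[OF deg_at_id[OF assms] c _ N(1,2)] by auto
      then show ?thesis by (intro bexI[of _ N']) auto
    next
      case False
      then show ?thesis
        using CL_Diff[OF N(1) Q_clopen[OF J_Q[OF J]]] N(2) by (intro bexI[of _ "N - C"]) auto
    qed
    then obtain N' where N': "N' \<in> CL" "x \<in> N'" "N' \<subseteq> N" "\<forall>y \<in> N'. y \<in> C \<longrightarrow> g y \<notin> N'" by auto
    have "h y \<notin> N'" if "(C', h) \<in> insert Cg \<J>" "y \<in> N'" "y \<in> C'" for C' h y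
    proof (cases "(C', h) = Cg")
      case False
      then have "h y \<notin> N" using that N(3) N'(3) by blast
      then show ?thesis using N'(3) by blast
    qed (use that N'(4) Cg in auto)
    then show ?case using N'(1,2) by (intro bexI[of _ N']) auto
  qed
  from this[OF finite_J subset_refl]
  obtain N where N: "N \<in> CL" "x \<in> N" "\<And>C g y. \<lbrakk>(C, g) \<in> J; y \<in> N; y \<in> C\<rbrakk> \<Longrightarrow> g y \<notin> N" by auto
  have "y = z" if yz: "y \<in> N" "z \<in> N" "(y, z) \<in> E" for y z
  proof (rule ccontr)
    assume "y \<noteq> z"
    then obtain C g where "(C, g) \<in> J" "y \<in> C" "g y = z" using E_J[OF yz(3)] by auto
    then show False using N(3)[of C g y] yz by auto
  qed
  then show ?thesis using N by blast
qed

text \<open>The element \<open>w\<close> is undone piece by piece. Over a piece that meets each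
  class at most once, a swap sends \<open>w x\<close> back to \<open>x\<close> and moves at most two
  points of every class, hence is small.\<close>

lemma orbit_preserving_product:
  assumes w: "w \<in> F" "\<And>x. x \<in> X \<Longrightarrow> (x, w x) \<in> E"
  shows "w \<in> generate FG small_elements"
proof -
  let ?G = "generate FG small_elements"
  have gF: "s \<in> F" if "s \<in> ?G" for s
    using FG.generate_in_carrier[OF _ that] by (auto simp: small_elements_def)
  \<comment> \<open>The correction on one piece must not spoil points where \<open>w\<close> is
    already the identity; with this clause, corrections on different pieces can be performed in
    succession.\<close>
  define R where "R N \<longleftrightarrow> (\<forall>w \<in> F. (\<forall>x \<in> X. (x, w x) \<in> E) \<longrightarrow> (\<exists>s \<in> ?G. \<forall>x \<in> X. (x, s (w x)) \<in> E \<and>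
    (x \<in> N \<longrightarrow> s (w x) = x) \<and> (w x = x \<longrightarrow> s (w x) = x)))" for N
  have "R X" using CL_X
  proof (induction rule: clopen_induct)
    case empty
    show ?case unfolding R_def
    proof (intro ballI impI)
      fix w assume w: "w \<in> F" "\<forall>x \<in> X. (x, w x) \<in> E"
      then show "\<exists>s \<in> ?G. \<forall>x \<in> X. (x, s (w x)) \<in> E \<and> (x \<in> {} \<longrightarrow> s (w x) = x) \<and> (w x = x \<longrightarrow> s (w x) =
        x)"
        using F_in_X[OF w(1)] by (intro bexI[of _ "\<one>\<^bsub>FG\<^esub>"] generate.one) auto
    qed
  next
    case (local x)
    obtain N where N: "N \<in> CL" "x \<in> N" "\<And>y z. \<lbrakk>y \<in> N; z \<in> N; (y, z) \<in> E\<rbrakk> \<Longrightarrow> y = z"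
      using class_injective_neighbourhood[OF local] by auto
    have NX: "N \<subseteq> X" using CL_subset[OF N(1)] .
    have "\<exists>s \<in> ?G. \<forall>x \<in> X. (x, s (w x)) \<in> E \<and> (x \<in> N \<longrightarrow> s (w x) = x) \<and> (w x = x \<longrightarrow> s (w x) = x)"
      if w: "w \<in> F" "\<And>x. x \<in> X \<Longrightarrow> (x, w x) \<in> E" for w
    proof -
      \<comment> \<open>As \<open>N\<close> meets every class at most once, these are the points of \<open>N\<close> moved by \<open>w\<close>; written
        in this way the set is visibly clopen.\<close>
      define M where "M = N - {x \<in> N. w x \<in> N}"
      have M: "M \<in> CL" unfolding M_def
        using CL_Diff[OF N(1) Q_preimage[OF F_Q[OF w(1) N(1)] N(1)]] .
      have MN: "M \<subseteq> N" unfolding M_def by auto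
      have M1: "w y \<notin> M" if "y \<in> M" for y using that unfolding M_def by auto
      have M2: "w y = y" if "y \<in> N" "y \<notin> M" for y
        using N(3)[of y "w y"] w(2)[of y] that NX unfolding M_def by auto
      have l: "levels2 M (\<lambda>x. x) w"
        unfolding levels2_def using Q_id[OF M] F_Q[OF w(1) M] M1 by auto
      let ?s = "swap M (\<lambda>x. x) w"
      let ?Z = "M \<union> w ` M"
      have MX: "M \<subseteq> X" using MN NX by auto
      have ZX: "?Z \<in> CL" using CL_Un[OF M Q_image[OF F_Q[OF w(1) M]]] .
      have fixs: "?s y = y" if "y \<in> X" "y \<notin> ?Z" for y using swap_eval(3)[OF l] that by auto
      have "small_set ?Z"
        unfolding small_set_def
      proof (intro conjI ballI)
        fix z assume z: "z \<in> X"
        have "is_singleton (E `` {z} \<inter> M) \<or> E `` {z} \<inter> M = {}"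
          using N(3) MN E_sym E_trans unfolding is_singleton_def by blast
        then have "card (E `` {z} \<inter> M) \<le> 1" by (auto simp: is_singleton_altdef)
        moreover have "card (E `` {z} \<inter> w ` M) = card (E `` {z} \<inter> M)"
          by (rule class_image_card[OF Q_inj[OF F_Q[OF w(1) M]] _ z]) (use w(2) MX in auto)
        moreover have "card (E `` {z} \<inter> ?Z) \<le> card (E `` {z} \<inter> M) + card (E `` {z} \<inter> w ` M)"
          unfolding Int_Un_distrib by (rule card_Un_le)
        \<comment> \<open>Each class meets \<open>M\<close> and its image in at most one point each:
          two points among at least 20.\<close>
        ultimately show "10 * card (E `` {z} \<inter> ?Z) \<le> card (E `` {z})" using large_class[OF z] by
          linarith
      qed (rule ZX)
      then have "?s \<in> small_elements" unfolding small_elements_def using swap_F[OF l] fixs by auto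
      then have sG: "?s \<in> ?G" by (rule generate.incl)
      have sE: "(y, ?s y) \<in> E" if y: "y \<in> X" for y
      proof -
        consider "y \<in> M" | m where "m \<in> M" "y = w m" | "y \<notin> ?Z" by auto
        then show ?thesis
        proof cases
          case 1 then show ?thesis using swap_eval(1)[OF l, of y] w(2) y by simp
        next
          case 2 then show ?thesis using swap_eval(2)[OF l, of m] w(2)[of m] E_sym MX by auto
        next
          case 3 then show ?thesis using fixs y E_refl by simp
        qed
      qed
      have wfix: "?s (w y) = y" if y: "y \<in> X" "w y = y" for y
      proof -
        have "y \<notin> M" using M1 y(2) by metis
        moreover have "y \<notin> w ` M"
        proof
          assume "y \<in> w ` M"
          then obtain m where "m \<in> M" "w y = w m" using y(2) by auto
          then show False using F_inj[OF w(1) y(1), of m] MX \<open>y \<notin> M\<close> by auto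
        qed
        ultimately show ?thesis using fixs y by simp
      qed
      have "?s (w y) = y" if "y \<in> N" for y
        using swap_eval(2)[OF l, of y] M2[OF that] wfix[of y] NX that by (cases "y \<in> M") auto
      moreover have "(y, ?s (w y)) \<in> E" if "y \<in> X" for y
        using E_trans[OF w(2)[OF that] sE[OF F_in_X[OF w(1) that]]] .
      ultimately show ?thesis using sG wfix by (intro bexI[of _ ?s]) auto
    qed
    then have "R N" unfolding R_def by blast
    then show ?case using N(1,2) NX by (intro bexI[of _ N]) auto
  next
    case (mono B C)
    then show ?case unfolding R_def by (meson subsetD)
  next
    case (union B C)
    show ?case unfolding R_def
    proof (intro ballI impI)
      fix w assume w: "w \<in> F" "\<forall>x \<in> X. (x, w x) \<in> E"
      obtain s where s: "s \<in> ?G" "\<And>x. x \<in> X \<Longrightarrow> (x, s (w x)) \<in> E"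
        "\<And>x. \<lbrakk>x \<in> X; x \<in> B\<rbrakk> \<Longrightarrow> s (w x) = x" "\<And>x. \<lbrakk>x \<in> X; w x = x\<rbrakk> \<Longrightarrow> s (w x) = x"
        using union(6) w unfolding R_def by (metis (no_types, lifting))
      have sw: "s \<otimes>\<^bsub>FG\<^esub> w \<in> F" using gF[OF s(1)] w by simp
      have e: "(s \<otimes>\<^bsub>FG\<^esub> w) x = s (w x)" if "x \<in> X" for x using gF[OF s(1)] w(1) that by simp
      have "\<forall>x \<in> X. (x, (s \<otimes>\<^bsub>FG\<^esub> w) x) \<in> E" using s(2) e by simp
      then have "\<exists>t \<in> ?G. \<forall>x \<in> X. (x, t ((s \<otimes>\<^bsub>FG\<^esub> w) x)) \<in> E \<and> (x \<in> C \<longrightarrow> t ((s \<otimes>\<^bsub>FG\<^esub> w) x) = x) \<and>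
          ((s \<otimes>\<^bsub>FG\<^esub> w) x = x \<longrightarrow> t ((s \<otimes>\<^bsub>FG\<^esub> w) x) = x)"
        using union(7) sw unfolding R_def by blast
      then obtain t where t: "t \<in> ?G" "\<And>x. x \<in> X \<Longrightarrow> (x, t (s (w x))) \<in> E"
        "\<And>x. \<lbrakk>x \<in> X; x \<in> C\<rbrakk> \<Longrightarrow> t (s (w x)) = x" "\<And>x. \<lbrakk>x \<in> X; s (w x) = x\<rbrakk> \<Longrightarrow> t (s (w x)) = x"
        by (auto simp: e cong: ball_cong)
      have ts: "t \<otimes>\<^bsub>FG\<^esub> s \<in> ?G" using generate.eng[OF t(1) s(1)] .
      have e': "(t \<otimes>\<^bsub>FG\<^esub> s) (w x) = t (s (w x))" if "x \<in> X" for x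
        using gF[OF s(1)] gF[OF t(1)] F_in_X[OF w(1) that] by simp
      show "\<exists>s \<in> ?G. \<forall>x \<in> X. (x, s (w x)) \<in> E \<and> (x \<in> B \<union> C \<longrightarrow> s (w x) = x) \<and> (w x = x \<longrightarrow> s (w x) = x)"
      proof (intro bexI[OF _ ts] ballI conjI impI)
        fix x assume x: "x \<in> X"
        show "(x, (t \<otimes>\<^bsub>FG\<^esub> s) (w x)) \<in> E" unfolding e'[OF x] by (rule t(2)[OF x])
        show "(t \<otimes>\<^bsub>FG\<^esub> s) (w x) = x" if "x \<in> B \<union> C"
          unfolding e'[OF x] using t(3,4)[OF x] s(3)[OF x] that by blast
        show "(t \<otimes>\<^bsub>FG\<^esub> s) (w x) = x" if "w x = x"
          unfolding e'[OF x] by (rule t(4)[OF x s(4)[OF x that]])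
      qed
    qed
  qed
  then obtain s where s: "s \<in> ?G" "\<And>x. x \<in> X \<Longrightarrow> s (w x) = x"
    using w unfolding R_def by (metis (no_types, lifting))
  have "s \<otimes>\<^bsub>FG\<^esub> w = \<one>\<^bsub>FG\<^esub>"
    by (rule F_eqI) (use s gF[OF s(1)] w(1) in auto)
  then have "inv\<^bsub>FG\<^esub> w = s" by (rule FG.inv_equality) (use w(1) gF[OF s(1)] in auto)
  then have "w = inv\<^bsub>FG\<^esub> s" using FG.inv_inv[of w] w(1) by simp
  moreover have "inv\<^bsub>FG\<^esub> s \<in> ?G"
    by (rule FG.generate_m_inv_closed[OF _ s(1)]) (auto simp: small_elements_def)
  ultimately show ?thesis by simp
qed

text \<open>As \<open>f\<close> stays within classes on \<open>B\<close>, the complements of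
  \<open>B\<close> and of its image have equally many points in each class. A matching between them
  extends \<open>f\<close> from \<open>B\<close> to a class-preserving \<open>w\<close>, and
  \<open>f\<close> differs from \<open>w\<close> by an element supported on the small complement of
  the image of \<open>B\<close>.\<close>

lemma almost_orbit_preserving_product:
  assumes f: "f \<in> F" and B: "B \<in> CL" "\<And>x. x \<in> B \<Longrightarrow> (x, f x) \<in> E"
    and c: "\<And>x. x \<in> X \<Longrightarrow> 10 * card (E `` {x} - B) \<le> card (E `` {x})"
  shows "f \<in> generate FG small_elements"
proof -
  have BX: "B \<subseteq> X" using CL_subset[OF B(1)] .
  have QB: "Q B f" using F_Q[OF f B(1)] .
  have fB: "f ` B \<in> CL" "f ` B \<subseteq> X" using Q_image[OF QB] CL_subset by auto
  let ?A = "X - B" and ?A' = "X - f ` B"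
  have A: "?A \<in> CL" "?A' \<in> CL" using CL_Diff[OF CL_X] B(1) fB(1) by auto
  have eq: "card (E `` {x} \<inter> ?A') = card (E `` {x} \<inter> ?A)" if x: "x \<in> X" for x
    using card_class_Diff(1)[OF x fB(2)] card_class_Diff(1)[OF x BX]
      class_image_card[OF Q_inj[OF QB] B(2) x] by simp
  obtain g where g: "Q ?A g" "g ` ?A \<subseteq> ?A'" "\<And>x. x \<in> ?A \<Longrightarrow> (x, g x) \<in> E"
    using matching[OF A] eq by auto
  \<comment> \<open>Equal finite counts in each class turn the injective matching into a
    bijection.\<close>
  have gA: "g ` ?A = ?A'"
  proof
    show "?A' \<subseteq> g ` ?A"
    proof
      fix y assume y: "y \<in> ?A'"
      then have yX: "y \<in> X" by simp
      have "card (E `` {y} \<inter> g ` ?A) = card (E `` {y} \<inter> ?A')"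
        using class_image_card[OF Q_inj[OF g(1)] g(3) yX] eq[OF yX] by simp
      moreover have "E `` {y} \<inter> g ` ?A \<subseteq> E `` {y} \<inter> ?A'" using g(2) by auto
      ultimately have "E `` {y} \<inter> g ` ?A = E `` {y} \<inter> ?A'"
        using finite_class[OF yX] by (intro card_subset_eq) auto
      then show "y \<in> g ` ?A" using E_refl[OF yX] y by auto
    qed
  qed (rule g(2))
  define w where "w = (\<lambda>x\<in>X. if x \<in> B then f x else g x)"
  have wB: "w x = f x" if "x \<in> B" for x using that BX by (auto simp: w_def)
  have wA: "w x = g x" if "x \<in> ?A" for x using that by (simp add: w_def)
  have "Q (B \<union> ?A) w"
  proof (rule Q_Un)
    show 1: "Q B w" using Q_cong[OF QB] wB by simp
    show 2: "Q ?A w" using Q_cong[OF g(1)] wA by simp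
    have "w ` B = f ` B" "w ` ?A = g ` ?A" using wB wA by auto
    then show "inj_on w (B \<union> ?A)" using Q_inj[OF 1] Q_inj[OF 2] g(2) by (subst inj_on_Un) auto
  qed
  then have Qw: "Q X w" using BX by (simp add: Un_absorb1)
  have "w ` X = w ` B \<union> w ` ?A" using BX by auto
  also have "\<dots> = f ` B \<union> ?A'" using wB wA gA by auto
  also have "\<dots> = X" using fB(2) by auto
  finally have "bij_betw w X X" using Q_inj[OF Qw] by (simp add: bij_betw_def)
  then have wF: "w \<in> F" unfolding F_def using Q_deg_at[OF Qw] by (auto simp: w_def)
  have wE: "(x, w x) \<in> E" if "x \<in> X" for x using B(2) g(3) wB wA that by (cases "x \<in> B") auto
  let ?h = "f \<otimes>\<^bsub>FG\<^esub> inv\<^bsub>FG\<^esub> w"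
  have hF: "?h \<in> F" using f wF by simp
  have "?h y = y" if y: "y \<in> X" "y \<notin> ?A'" for y
  proof -
    obtain x where x: "x \<in> B" "y = f x" using y by auto
    then have "(inv\<^bsub>FG\<^esub> w) y = x" using FG_inv_apply(1)[OF wF, of x] wB BX by auto
    then show ?thesis using f wF y(1) x by simp
  qed
  moreover have "small_set ?A'"
    unfolding small_set_def
  proof (intro conjI ballI)
    fix x assume x: "x \<in> X"
    have "E `` {x} \<inter> ?A = E `` {x} - B" using E_in_X by auto
    then show "10 * card (E `` {x} \<inter> ?A') \<le> card (E `` {x})" using eq[OF x] c[OF x] by simp
  qed (rule A(2))
  ultimately have "?h \<in> small_elements" unfolding small_elements_def using hF by auto
  then have "?h \<otimes>\<^bsub>FG\<^esub> w \<in> generate FG small_elements"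
    by (intro generate.eng generate.incl orbit_preserving_product[OF wF wE])
  moreover have "?h \<otimes>\<^bsub>FG\<^esub> w = f" using f wF by (simp add: FG.m_assoc)
  ultimately show ?thesis by simp
qed

lemma almost_orbit_preserving_commute_mod:
  assumes f: "f \<in> F" "B \<in> CL" "\<And>x. x \<in> B \<Longrightarrow> (x, f x) \<in> E"
      "\<And>x. x \<in> X \<Longrightarrow> 10 * card (E `` {x} - B) \<le> card (E `` {x})"
    and g: "g \<in> F" "C \<in> CL" "\<And>x. x \<in> C \<Longrightarrow> (x, g x) \<in> E"
      "\<And>x. x \<in> X \<Longrightarrow> 10 * card (E `` {x} - C) \<le> card (E `` {x})"
  shows "commute_mod f g"
  by (rule commute_mod_generate[OF _ small_commute_mod almost_orbit_preserving_product[OF f]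
      almost_orbit_preserving_product[OF g]]) (auto simp: small_elements_def)

end

context graded_pseudogroup
begin

section \<open>The cyclic group and the normalizer\<close>

lemma L_in_X: "x \<in> X \<Longrightarrow> L a x \<in> X"
  by (rule F_in_X[OF L_F])

lemma L_mult: "L a \<otimes>\<^bsub>FG\<^esub> L b = L (a + b)"
  by (rule F_eqI) (simp_all add: L_F L_add)

lemma L_zero: "L 0 = \<one>\<^bsub>FG\<^esub>"
  by (rule F_eqI) (simp_all add: L_F L_0)

lemma L_inv: "inv\<^bsub>FG\<^esub> (L a) = L (- a)"
  by (rule FG.inv_equality) (simp_all add: L_F L_mult L_zero)

lemma L_eq:
  assumes "int p dvd a - b"
  shows "L a = L b"
proof (rule F_eqI[OF L_F L_F])
  fix x assume x: "x \<in> X"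
  have "L a x = L (a - b) (L b x)" using L_add[OF x, of "a - b" b] by simp
  then show "L a x = L b x" using L_dvd[OF assms L_in_X[OF x]] by simp
qed

text \<open>For a free action of a finite group, a neighbourhood disjoint from its nontrivial
  translates is a local fundamental domain. Two partial domains combine after the orbits met by the
  first are removed from the second.\<close>

lemma fundamental_domain:
  "\<exists>Y \<in> CL. (\<forall>x \<in> X. \<exists>i. L i x \<in> Y) \<and> (\<forall>x \<in> Y. \<forall>i. L i x \<in> Y \<longrightarrow> int p dvd i)"
proof -
  define R where "R N \<longleftrightarrow> (\<exists>Y \<in> CL. (\<forall>x \<in> N. \<exists>i. L i x \<in> Y) \<and>
    (\<forall>x \<in> Y. \<forall>i. L i x \<in> Y \<longrightarrow> int p dvd i))" for N
  have mod: "L i x = L (i mod int p) x" for i x using L_eq[of i "i mod int p"] by simp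
  have p0: "0 < int p" using prime_gt_0_nat[OF prime_p] by simp
  have "R X" using CL_X
  proof (induction rule: clopen_induct)
    case empty
    show ?case unfolding R_def using CL_empty by blast
  next
    case (local x)
    \<comment> \<open>The neighbourhood is shrunk once for each nonzero residue.\<close>
    have "\<exists>N \<in> CL. x \<in> N \<and> (\<forall>i \<in> I. \<forall>y \<in> N. L i y \<notin> N)"
      if "finite I" "\<And>i. i \<in> I \<Longrightarrow> \<not> int p dvd i" for I
      using that
    proof (induction rule: finite_induct)
      case empty
      then show ?case using local CL_X by auto
    next
      case (insert i I)
      then obtain N where N: "N \<in> CL" "x \<in> N" "\<forall>i \<in> I. \<forall>y \<in> N. L i y \<notin> N" by auto
      have "x \<noteq> L i x" using L_free[OF local, of i] insert.prems[of i] by auto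
      then obtain N' where N': "N' \<in> CL" "x \<in> N'" "N' \<subseteq> N" "(\<lambda>x. x) ` N' \<inter> L i ` N' = {}"
        using deg_at_separate[OF deg_at_id[OF local] deg_at_L[OF local, of i] _ N(1,2)] by blast
      then have "\<forall>y \<in> N'. L i y \<notin> N'" by auto
      then show ?case using N N' by (intro bexI[of _ N']) auto
    qed
    from this[of "{0<..<int p}"] obtain N where N: "N \<in> CL" "x \<in> N"
      "\<forall>i \<in> {0<..<int p}. \<forall>y \<in> N. L i y \<notin> N" by (auto simp: zdvd_not_zless)
    have "int p dvd i" if "y \<in> N" "L i y \<in> N" for y i
    proof (rule ccontr)
      assume "\<not> int p dvd i"
      then have "i mod int p \<noteq> 0" by (simp add: dvd_eq_mod_eq_0)
      then have "i mod int p \<in> {0<..<int p}"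
        using pos_mod_bound[OF p0, of i] pos_mod_sign[OF p0, of i]
        by (simp only: greaterThanLessThan_iff less_le) simp
      then show False using N(3) that mod[of i y] by auto
    qed
    moreover have "L 0 y \<in> N" if "y \<in> N" for y using L_0 CL_subset[OF N(1)] that by auto
    ultimately have "R N" unfolding R_def using N(1) by blast
    then show ?case using N(1,2) CL_subset[OF N(1)] by (intro bexI[of _ N]) auto
  next
    case (mono B C)
    then show ?case unfolding R_def by (meson subsetD)
  next
    case (union B C)
    obtain Y1 where Y1: "Y1 \<in> CL" "\<And>x. x \<in> B \<Longrightarrow> \<exists>i. L i x \<in> Y1"
      "\<And>x i. \<lbrakk>x \<in> Y1; L i x \<in> Y1\<rbrakk> \<Longrightarrow> int p dvd i" using union(6) unfolding R_def by auto
    obtain Y2 where Y2: "Y2 \<in> CL" "\<And>x. x \<in> C \<Longrightarrow> \<exists>i. L i x \<in> Y2"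
      "\<And>x i. \<lbrakk>x \<in> Y2; L i x \<in> Y2\<rbrakk> \<Longrightarrow> int p dvd i" using union(7) unfolding R_def by auto
    \<comment> \<open>The union of the orbits that meet \<open>Y1\<close>; it is clopen because
      finitely many residues suffice.\<close>
    let ?S = "{z \<in> X. \<exists>i. L i z \<in> Y1}"
    have "?S = \<Union>((\<lambda>i. {z \<in> X. L i z \<in> Y1}) ` {0..<int p})"
    proof (intro equalityI subsetI)
      fix z assume "z \<in> ?S"
      then obtain i where i: "z \<in> X" "L i z \<in> Y1" by auto
      then have "L (i mod int p) z \<in> Y1" using mod[of i z] by simp
      moreover have "i mod int p \<in> {0..<int p}" using p0 by simp
      ultimately show "z \<in> \<Union>((\<lambda>i. {z \<in> X. L i z \<in> Y1}) ` {0..<int p})" using i(1) by blast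
    qed auto
    also have "\<dots> \<in> CL" using P_preimage[OF L_P Y1(1)] by (intro CL_Union) auto
    finally have S: "?S \<in> CL" .
    let ?Y = "Y1 \<union> (Y2 - ?S)"
    have YX: "Y1 \<subseteq> X" "Y2 \<subseteq> X" using CL_subset Y1(1) Y2(1) by auto
    have CX: "C \<subseteq> X" using union by auto
    have "\<exists>i. L i x \<in> ?Y" if "x \<in> B \<union> C" for x
    proof (cases "x \<in> B")
      case True then show ?thesis using Y1(2) by auto
    next
      case False
      then have xC: "x \<in> C" using that by simp
      then have xX: "x \<in> X" using CX by auto
      obtain i where i: "L i x \<in> Y2" using Y2(2) xC by auto
      show ?thesis
      proof (cases "L i x \<in> ?S")
        case True
        then obtain j where "L j (L i x) \<in> Y1" by auto
        then have "L (j + i) x \<in> Y1" using L_add[OF xX] by simp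
        then show ?thesis by auto
      qed (use i in auto)
    qed
    moreover have "int p dvd i" if xy: "x \<in> ?Y" "L i x \<in> ?Y" for x i
    proof -
      have xX: "x \<in> X" using xy(1) YX by auto
      have "L i x \<in> Y1 \<Longrightarrow> x \<in> ?S" using xX by auto
      moreover have "x \<in> Y1 \<Longrightarrow> L i x \<in> ?S"
      proof -
        assume "x \<in> Y1"
        then have "L (- i) (L i x) \<in> Y1" using L_add[OF xX, of "- i" i] L_0[OF xX] by simp
        then show "L i x \<in> ?S" using L_in_X[OF xX] by blast
      qed
      ultimately consider "x \<in> Y1" "L i x \<in> Y1" | "x \<in> Y2" "L i x \<in> Y2" using xy by blast
      then show ?thesis using Y1(3) Y2(3) by cases auto
    qed
    moreover have "?Y \<in> CL" using CL_Un[OF Y1(1) CL_Diff[OF Y2(1) S]] .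
    ultimately show ?case unfolding R_def by (intro bexI[of _ ?Y] conjI ballI allI impI)
  qed
  then show ?thesis unfolding R_def .
qed

text \<open>The involution \<open>r\<close> is \<open>L i y \<mapsto> L (- i) y\<close> for \<open>y\<close> in the fundamental domain; as \<open>p\<close> is odd, every
  \<open>L b\<close> is a square.\<close>

lemma L_in_D:
  assumes "3 \<le> p"
  shows "L b \<in> D"
proof -
  obtain Y where Y: "Y \<in> CL" "\<And>x. x \<in> X \<Longrightarrow> \<exists>i. L i x \<in> Y"
    "\<And>x i. \<lbrakk>x \<in> Y; L i x \<in> Y\<rbrakk> \<Longrightarrow> int p dvd i" using fundamental_domain by auto
  \<comment> \<open>If \<open>y = L i x\<close> lies in \<open>Y\<close>, then \<open>x\<close> is
    \<open>L (- i) y\<close> and has to go to \<open>L i y\<close>, which is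
    \<open>L (2 * i) x\<close>. The chosen \<open>i\<close> is unique modulo \<open>p\<close>, so
    the choice does not affect the value.\<close>
  define r where "r = (\<lambda>x\<in>X. L (2 * (SOME i. L i x \<in> Y)) x)"
  have r: "r x = L (2 * i) x" if x: "x \<in> X" and i: "L i x \<in> Y" for x i
  proof -
    let ?j = "SOME i. L i x \<in> Y"
    have j: "L ?j x \<in> Y" using someI[of "\<lambda>i. L i x \<in> Y", OF i] .
    have "L (i - ?j) (L ?j x) \<in> Y" using L_add[OF x, of "i - ?j" ?j] i by simp
    then have "int p dvd i - ?j" using Y(3)[OF j] by simp
    then have "int p dvd 2 * (i - ?j)" by (rule dvd_mult)
    then have "int p dvd 2 * i - 2 * ?j" by (simp add: algebra_simps)
    then show ?thesis using L_eq x by (simp add: r_def)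
  qed
  have rX: "r x \<in> X" and rr: "r (r x) = x" and r_deg: "\<exists>c. deg_at c r x" if x: "x \<in> X" for x
  proof -
    obtain i where i: "L i x \<in> Y" using Y(2)[OF x] by auto
    show "r x \<in> X" using r[OF x i] L_in_X[OF x] by simp
    have "L (- i) (L (2 * i) x) \<in> Y" using L_add[OF x, of "- i" "2 * i"] i by simp
    from r[OF L_in_X[OF x] this] show "r (r x) = x"
      using r[OF x i] L_add[OF x, of "2 * - i" "2 * i"] L_0[OF x] by simp
    let ?N = "{z \<in> X. L i z \<in> Y}"
    have "deg_at (2 * i) r x"
      by (rule deg_at_cong[OF deg_at_L[OF x] P_preimage[OF L_P Y(1)]]) (use x i r in auto)
    then show "\<exists>c. deg_at c r x" by blast
  qed
  have rF: "r \<in> F" by (rule F_I[where g = r]) (use rX rr r_deg in \<open>auto simp: r_def\<close>)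
  have ri: "inv\<^bsub>FG\<^esub> r = r"
    by (rule FG.inv_equality, rule F_eqI) (use rF rr in simp_all)
  have comm: "r \<otimes>\<^bsub>FG\<^esub> L a \<otimes>\<^bsub>FG\<^esub> inv\<^bsub>FG\<^esub> r \<otimes>\<^bsub>FG\<^esub> inv\<^bsub>FG\<^esub> (L a) = L (- 2 * a)" for a
  proof (rule F_eqI)
    fix x assume x: "x \<in> X"
    obtain i where i: "L i x \<in> Y" using Y(2)[OF x] by auto
    have "L (i + a) (L (- a) x) \<in> Y" using L_add[OF x, of "i + a" "- a"] i by simp
    from r[OF L_in_X[OF x] this] have "r (L (- a) x) = L (2 * i + a) x"
      using L_add[OF x, of "2 * (i + a)" "- a"] by (simp add: algebra_simps)
    then have 1: "L a (r (L (- a) x)) = L (2 * i + 2 * a) x"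
      using L_add[OF x, of a "2 * i + a"] by (simp add: algebra_simps)
    have "L (- i - 2 * a) (L (2 * i + 2 * a) x) \<in> Y"
      using L_add[OF x, of "- i - 2 * a" "2 * i + 2 * a"] i by simp
    from r[OF L_in_X[OF x] this] have "r (L (2 * i + 2 * a) x) = L (- 2 * a) x"
      using L_add[OF x, of "2 * (- i - 2 * a)" "2 * i + 2 * a"] by (simp add: algebra_simps)
    then show "(r \<otimes>\<^bsub>FG\<^esub> L a \<otimes>\<^bsub>FG\<^esub> inv\<^bsub>FG\<^esub> r \<otimes>\<^bsub>FG\<^esub> inv\<^bsub>FG\<^esub> (L a)) x = L (- 2 * a) x"
      using x rF 1 by (simp add: ri L_inv L_F L_in_X rX)
  qed (use rF in \<open>simp_all add: L_F\<close>)
  have *: "L (- 2 * a) \<in> D" for a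
    unfolding comm[symmetric] D_def by (rule commutator_in_derived[OF rF L_F])
  have "odd p" using prime_odd_nat[OF prime_p] assms by simp
  then obtain m where m: "p = 2 * m + 1" by (elim oddE)
  \<comment> \<open>Modulo \<open>p = 2 * m + 1\<close>, the number \<open>- 2 * m\<close> is 1, so
    \<open>L b\<close> is one of the commutators just found.\<close>
  have "b - (- 2 * (b * int m)) = int p * b" by (simp add: m algebra_simps)
  then have "L b = L (- 2 * (b * int m))" by (intro L_eq) simp
  then show ?thesis using * by simp
qed

section \<open>Conjugation of \<open>D0\<close> and its normalizer\<close>

abbreviation "FD \<equiv> FG\<lparr>carrier := D\<rparr>"

text \<open>Conjugation by \<open>c\<close> is an endomorphism of \<open>FG\<close> that maps
  \<open>F0\<close> into itself, and homomorphisms carry derived subgroups to derived subgroups of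
  images.\<close>

lemma conj_derived:
  assumes c: "c \<in> F" and F0: "\<And>f. f \<in> F0 \<Longrightarrow> c \<otimes>\<^bsub>FG\<^esub> f \<otimes>\<^bsub>FG\<^esub> inv\<^bsub>FG\<^esub> c \<in> F0" and g: "g \<in> D0"
  shows "c \<otimes>\<^bsub>FG\<^esub> g \<otimes>\<^bsub>FG\<^esub> inv\<^bsub>FG\<^esub> c \<in> D0"
proof -
  let ?h = "\<lambda>g. c \<otimes>\<^bsub>FG\<^esub> g \<otimes>\<^bsub>FG\<^esub> inv\<^bsub>FG\<^esub> c"
  interpret h: group_hom FG FG ?h
  proof (unfold_locales, rule homI)
    show "?h x \<in> carrier FG" if "x \<in> carrier FG" for x using that c by simp
    show "?h (x \<otimes>\<^bsub>FG\<^esub> y) = ?h x \<otimes>\<^bsub>FG\<^esub> ?h y" if "x \<in> carrier FG" "y \<in> carrier FG" for x y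
      by (rule F_eqI) (use that c in \<open>simp_all add: F_in_X\<close>)
  qed
  have "?h ` D0 = derived FG (?h ` F0)" unfolding D0_def
    by (rule h.derived_img[symmetric]) (simp add: F0_subset)
  also have "\<dots> \<subseteq> D0" unfolding D0_def by (rule FG.mono_derived) (use F0 in auto)
  finally show ?thesis using g by auto
qed

lemma F0_conj_D0: "\<lbrakk>f \<in> F0; g \<in> D0\<rbrakk> \<Longrightarrow> f \<otimes>\<^bsub>FG\<^esub> g \<otimes>\<^bsub>FG\<^esub> inv\<^bsub>FG\<^esub> f \<in> D0"
  using conj_derived[of f g] F0_subset subgroup.m_closed[OF subgroup_F0] subgroup.m_inv_closed[OF
    subgroup_F0]
  by auto

lemma pure_F0:
  assumes "f \<in> F" "\<And>x. x \<in> X \<Longrightarrow> deg_at a f x"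
  shows "f \<otimes>\<^bsub>FG\<^esub> L (- a) \<in> F0"
proof -
  have "deg_at 0 (f \<otimes>\<^bsub>FG\<^esub> L (- a)) x" if x: "x \<in> X" for x
  proof -
    have "deg_at (- a + a) (\<lambda>x. f (L (- a) x)) x" by (rule deg_at_comp[OF deg_at_L[OF x]
      assms(2)[OF L_in_X[OF x]]])
    then have "deg_at (- a + a) (f \<otimes>\<^bsub>FG\<^esub> L (- a)) x"
      by (rule deg_at_cong[OF _ CL_X x]) (use assms(1) L_F in simp)
    then show ?thesis by simp
  qed
  then show ?thesis using assms(1) L_F by (simp add: F0_def)
qed

lemma L_conj_F0:
  assumes "f \<in> F0"
  shows "L a \<otimes>\<^bsub>FG\<^esub> f \<otimes>\<^bsub>FG\<^esub> L (- a) \<in> F0"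
proof (rule pure_F0)
  have f: "f \<in> F" "\<And>x. x \<in> X \<Longrightarrow> deg_at 0 f x" using assms by (auto simp: F0_def)
  show "L a \<otimes>\<^bsub>FG\<^esub> f \<in> F" using f L_F by simp
  fix x assume x: "x \<in> X"
  have "deg_at (0 + a) (\<lambda>x. L a (f x)) x" by (rule deg_at_comp[OF f(2)[OF x] deg_at_L[OF F_in_X[OF
    f(1) x]]])
  then have "deg_at (0 + a) (L a \<otimes>\<^bsub>FG\<^esub> f) x"
    by (rule deg_at_cong[OF _ CL_X x]) (use f L_F in simp)
  then show "deg_at a (L a \<otimes>\<^bsub>FG\<^esub> f) x" by simp
qed

lemma L_conj_D0: "g \<in> D0 \<Longrightarrow> L a \<otimes>\<^bsub>FG\<^esub> g \<otimes>\<^bsub>FG\<^esub> L (- a) \<in> D0"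
  using conj_derived[OF L_F, of a g] L_conj_F0 by (simp add: L_inv)

text \<open>Because the \<open>L a\<close> normalize \<open>S\<close>, the products of an element of
  \<open>S\<close> with some \<open>L a\<close> already form a subgroup.\<close>

lemma generate_L:
  assumes S: "subgroup S FG" and c: "\<And>a s. s \<in> S \<Longrightarrow> L a \<otimes>\<^bsub>FG\<^esub> s \<otimes>\<^bsub>FG\<^esub> L (- a) \<in> S"
    and f: "f \<in> generate FG (S \<union> range L)"
  shows "\<exists>s \<in> S. \<exists>a. f = s \<otimes>\<^bsub>FG\<^esub> L a"
proof -
  let ?T = "{s \<otimes>\<^bsub>FG\<^esub> L a | s a. s \<in> S}"
  have SF: "s \<in> F" if "s \<in> S" for s using subgroup.subset[OF S] that by auto
  have m: "(s \<otimes>\<^bsub>FG\<^esub> L a) \<otimes>\<^bsub>FG\<^esub> (t \<otimes>\<^bsub>FG\<^esub> L b) =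
    (s \<otimes>\<^bsub>FG\<^esub> (L a \<otimes>\<^bsub>FG\<^esub> t \<otimes>\<^bsub>FG\<^esub> L (- a))) \<otimes>\<^bsub>FG\<^esub> L (a + b)" if "s \<in> S" "t \<in> S" for s t a b
    by (rule F_eqI) (use SF that L_F in \<open>simp_all add: L_add[symmetric] F_in_X L_in_X\<close>)
  have "subgroup ?T FG"
  proof (rule FG.subgroupI)
    show "?T \<subseteq> carrier FG" using SF L_F by auto
    show "?T \<noteq> {}" using subgroup.one_closed[OF S] by auto
  next
    fix x assume "x \<in> ?T"
    then obtain s a where x: "x = s \<otimes>\<^bsub>FG\<^esub> L a" "s \<in> S" by auto
    let ?t = "L (- a) \<otimes>\<^bsub>FG\<^esub> inv\<^bsub>FG\<^esub> s \<otimes>\<^bsub>FG\<^esub> L (- (- a))"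
    have t: "?t \<in> S" using c[OF subgroup.m_inv_closed[OF S x(2)], of "- a"] .
    have "inv\<^bsub>FG\<^esub> x = ?t \<otimes>\<^bsub>FG\<^esub> L (- a)"
      unfolding x(1) using SF[OF x(2)] L_F
      by (simp add: FG.inv_mult_group L_inv FG.m_assoc L_mult L_zero)
    then show "inv\<^bsub>FG\<^esub> x \<in> ?T" using t by blast
  next
    fix x y assume "x \<in> ?T" "y \<in> ?T"
    then obtain s a t b where "x = s \<otimes>\<^bsub>FG\<^esub> L a" "s \<in> S" "y = t \<otimes>\<^bsub>FG\<^esub> L b" "t \<in> S" by auto
    then show "x \<otimes>\<^bsub>FG\<^esub> y \<in> ?T" using m[of s t a b] subgroup.m_closed[OF S] c by blast
  qed
  moreover have "S \<union> range L \<subseteq> ?T"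
  proof (intro Un_least subsetI)
    show "s \<in> ?T" if "s \<in> S" for s using SF[OF that] that L_zero FG.r_one[of s] by (auto intro!:
      exI[of _ s] exI[of _ 0])
    show "x \<in> ?T" if "x \<in> range L" for x
      using that subgroup.one_closed[OF S] L_F by (auto intro!: exI[of _ "\<one>\<^bsub>FG\<^esub>"])
  qed
  ultimately have "generate FG (S \<union> range L) \<subseteq> ?T" by (rule FG.generate_subgroup_incl[rotated])
  then show ?thesis using f by blast
qed

lemma group_FD: "group FD"
  using FG.subgroup_imp_group[OF subgroup_D] .

text \<open>Here \<open>normalizer\<close> is a stabilizer for conjugation of subsets inside
  \<open>FD\<close>; inverses agree with those of \<open>FG\<close>, where the calculations take
  place.\<close>

lemma normalizer_iff:
  "f \<in> normalizer FD D0 \<longleftrightarrow> f \<in> D \<and> (\<lambda>g. f \<otimes>\<^bsub>FG\<^esub> g \<otimes>\<^bsub>FG\<^esub> inv\<^bsub>FG\<^esub> f) ` D0 = D0"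
proof (cases "f \<in> D")
  case True
  have "f <#\<^bsub>FD\<^esub> D0 #>\<^bsub>FD\<^esub> inv\<^bsub>FD\<^esub> f = (\<lambda>g. f \<otimes>\<^bsub>FG\<^esub> g \<otimes>\<^bsub>FG\<^esub> inv\<^bsub>FG\<^esub> f) ` D0"
    unfolding l_coset_def r_coset_def using FG.m_inv_consistent[OF subgroup_D True] by auto
  then show ?thesis using True D0_subset_D by (simp add: normalizer_def stabilizer_def)
qed (simp add: normalizer_def stabilizer_def)

lemma subgroup_normalizer: "subgroup (normalizer FD D0) FD"
  using group.normalizer_imp_subgroup[OF group_FD] D0_subset_D by simp

text \<open>Normalizing demands equality of the conjugate with \<open>D0\<close>, not just
  inclusion; conjugation by the inverse gives the other half.\<close>

lemma normalizerI:
  assumes f: "f \<in> D" and "\<And>g. g \<in> D0 \<Longrightarrow> f \<otimes>\<^bsub>FG\<^esub> g \<otimes>\<^bsub>FG\<^esub> inv\<^bsub>FG\<^esub> f \<in> D0"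
    "\<And>g. g \<in> D0 \<Longrightarrow> inv\<^bsub>FG\<^esub> f \<otimes>\<^bsub>FG\<^esub> g \<otimes>\<^bsub>FG\<^esub> f \<in> D0"
  shows "f \<in> normalizer FD D0"
proof -
  have fF: "f \<in> F" using f D_subset by auto
  have "g \<in> (\<lambda>g. f \<otimes>\<^bsub>FG\<^esub> g \<otimes>\<^bsub>FG\<^esub> inv\<^bsub>FG\<^esub> f) ` D0" if g: "g \<in> D0" for g
  proof (rule image_eqI[OF _ assms(3)[OF g]])
    have gF: "g \<in> F" using g D0_subset F0_subset by auto
    show "g = f \<otimes>\<^bsub>FG\<^esub> (inv\<^bsub>FG\<^esub> f \<otimes>\<^bsub>FG\<^esub> g \<otimes>\<^bsub>FG\<^esub> f) \<otimes>\<^bsub>FG\<^esub> inv\<^bsub>FG\<^esub> f"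
      by (rule F_eqI) (use fF gF in \<open>simp_all add: F_in_X\<close>)
  qed
  then show ?thesis unfolding normalizer_iff using assms by auto
qed

lemma normalizer_pure:
  assumes "f \<in> normalizer FD D0"
  shows "f \<in> D" "\<not> mixed f"
proof -
  have f: "f \<in> D" "(\<lambda>g. f \<otimes>\<^bsub>FG\<^esub> g \<otimes>\<^bsub>FG\<^esub> inv\<^bsub>FG\<^esub> f) ` D0 = D0" using assms unfolding normalizer_iff
    by auto
  show "f \<in> D" using f(1) .
  show "\<not> mixed f" by (rule normalizing_not_mixed) (use f D_subset in auto)
qed

context
  assumes L_D: "\<And>a. L a \<in> D"
begin

lemma pure_decompose:
  assumes "f \<in> D" "\<not> mixed f"
  shows "\<exists>s \<in> F0 \<inter> D. \<exists>a. f = s \<otimes>\<^bsub>FG\<^esub> L a"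
proof -
  have fF: "f \<in> F" using assms(1) D_subset by auto
  obtain a where a: "\<And>x. x \<in> X \<Longrightarrow> deg_at a f x" using not_mixed_imp_pure[OF fF assms(2)] by auto
  have "f \<otimes>\<^bsub>FG\<^esub> L (- a) \<in> F0" using pure_F0[OF fF a] .
  moreover have "f \<otimes>\<^bsub>FG\<^esub> L (- a) \<in> D" using subgroup.m_closed[OF subgroup_D assms(1) L_D] .
  moreover have "f = (f \<otimes>\<^bsub>FG\<^esub> L (- a)) \<otimes>\<^bsub>FG\<^esub> L a"
    using fF L_F by (simp add: FG.m_assoc L_mult L_zero)
  ultimately show ?thesis by blast
qed

text \<open>An element that normalizes \<open>D0\<close> is not mixed, so it has a constant degree
  \<open>a\<close>. Dividing by \<open>L a\<close>, which lies in \<open>D\<close>, leaves an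
  element of \<open>F0 \<inter> D\<close>.\<close>

lemma normalizer_eq: "normalizer FD D0 = generate FG (F0 \<inter> D \<union> range L)"
proof
  have N: "subgroup (normalizer FD D0) FG"
    using FG.incl_subgroup[OF subgroup_D subgroup_normalizer] .
  have "f \<in> normalizer FD D0" if f: "f \<in> F0 \<inter> D" for f
  proof (rule normalizerI)
    have i: "inv\<^bsub>FG\<^esub> f \<in> F0" using subgroup.m_inv_closed[OF subgroup_F0] f by simp
    fix g assume "g \<in> D0"
    then show "f \<otimes>\<^bsub>FG\<^esub> g \<otimes>\<^bsub>FG\<^esub> inv\<^bsub>FG\<^esub> f \<in> D0" "inv\<^bsub>FG\<^esub> f \<otimes>\<^bsub>FG\<^esub> g \<otimes>\<^bsub>FG\<^esub> f \<in> D0"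
      using F0_conj_D0[of f g] F0_conj_D0[OF i, of g] f F0_subset by auto
  qed (use f in simp)
  moreover have "L a \<in> normalizer FD D0" for a
    by (rule normalizerI) (use L_D L_conj_D0[of _ a] L_conj_D0[of _ "- a"] in \<open>auto simp: L_inv\<close>)
  ultimately show "generate FG (F0 \<inter> D \<union> range L) \<subseteq> normalizer FD D0"
    by (intro FG.generate_subgroup_incl[OF _ N]) auto
  show "normalizer FD D0 \<subseteq> generate FG (F0 \<inter> D \<union> range L)"
  proof
    fix f assume "f \<in> normalizer FD D0"
    then obtain s a where "s \<in> F0 \<inter> D" "f = s \<otimes>\<^bsub>FG\<^esub> L a"
      using normalizer_pure pure_decompose by meson
    then show "f \<in> generate FG (F0 \<inter> D \<union> range L)"
      by (auto intro!: generate.eng intro: generate.incl)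
  qed
qed

text \<open>The product of an element of \<open>D0\<close> with \<open>L a\<close> has degree
  \<open>a\<close> everywhere. If it lies in \<open>F0\<close>, then \<open>p\<close> divides
  \<open>a\<close> and \<open>L a\<close> is the identity.\<close>

lemma F0_Int_generate:
  assumes "f \<in> F0" "f \<in> generate FG (D0 \<union> range L)"
  shows "f \<in> D0"
proof -
  obtain s a where s: "s \<in> D0" "f = s \<otimes>\<^bsub>FG\<^esub> L a"
    using generate_L[OF subgroup_D0 L_conj_D0 assms(2)] by auto
  have sF: "s \<in> F0" "s \<in> F" using s D0_subset F0_subset by auto
  obtain x where x: "x \<in> X" using X_nonempty by auto
  have "deg_at (a + 0) (\<lambda>x. s (L a x)) x"
    using deg_at_comp[OF deg_at_L[OF x], of 0 s] sF L_in_X[OF x] by (simp add: F0_def)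
  then have "deg_at (a + 0) f x"
    by (rule deg_at_cong[OF _ CL_X x]) (use s sF L_F in simp)
  moreover have "deg_at 0 f x" using assms(1) x by (simp add: F0_def)
  ultimately have "int p dvd (a + 0) - 0" by (rule deg_at_unique)
  then have "L a = \<one>\<^bsub>FG\<^esub>" using L_eq[of a 0] L_zero by simp
  then show ?thesis using s sF by simp
qed

text \<open>Both sides are semidirect products with the same cyclic group, and intersecting with
  \<open>F0\<close> recovers the first factor.\<close>

lemma normalizer_eq_iff:
  "normalizer FD D0 = generate FG (D0 \<union> range L) \<longleftrightarrow> F0 \<inter> D \<subseteq> D0"
proof
  assume eq: "normalizer FD D0 = generate FG (D0 \<union> range L)"
  show "F0 \<inter> D \<subseteq> D0"
  proof
    fix f assume f: "f \<in> F0 \<inter> D"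
    then have "f \<in> normalizer FD D0" unfolding normalizer_eq by (auto intro: generate.incl)
    then show "f \<in> D0" using F0_Int_generate f eq by simp
  qed
next
  assume "F0 \<inter> D \<subseteq> D0"
  then have "F0 \<inter> D = D0" using D0_subset D0_subset_D by auto
  then show "normalizer FD D0 = generate FG (D0 \<union> range L)" unfolding normalizer_eq by simp
qed

lemma generate_subset_normalizer: "generate FG (D0 \<union> range L) \<subseteq> normalizer FD D0"
  unfolding normalizer_eq using D0_subset D0_subset_D by (intro FG.mono_generate) auto

text \<open>An intermediate subgroup either contains a mixed element, and is everything by
  \<open>Alt_subset\<close>, or consists of elements of constant degree, which decompose into
  \<open>F0 \<inter> D\<close> and some \<open>L a\<close>. Conversely, the normalizer itself is an
  intermediate subgroup.\<close>

lemma maximal_iff: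
  assumes Alt: "D \<subseteq> Alt"
  shows "normalizer FD D0 = generate FG (D0 \<union> range L) \<longleftrightarrow>
    maximal_subgroup (generate FG (D0 \<union> range L)) FD" (is "?N = ?M \<longleftrightarrow> _")
proof
  \<comment> \<open>A mixed element of \<open>D\<close> does not normalize
    \<open>D0\<close>.\<close>
  have N: "?N \<noteq> D" using mixed_in_D normalizer_pure by blast
  have MD: "?M \<subseteq> D" using generate_subset_normalizer normalizer_pure(1) by blast
  have M: "subgroup ?M FG"
    using D0_subset_D D_subset L_F by (intro FG.generate_is_subgroup) auto
  {
    assume eq: "?N = ?M"
    show "maximal_subgroup ?M FD"
      unfolding maximal_subgroup_def
    proof (intro conjI allI impI)
      show "subgroup ?M FD" using FG.subgroup_incl[OF M subgroup_D MD] .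
      show "?M \<noteq> carrier FD" using N eq by simp
      fix K assume K: "subgroup K FD \<and> ?M \<subseteq> K"
      have KG: "subgroup K FG" using FG.incl_subgroup[OF subgroup_D] K by simp
      have KD: "K \<subseteq> D" using subgroup.subset K by fastforce
      have "D0 \<subseteq> ?M" by (auto intro: generate.incl)
      then have D0K: "D0 \<subseteq> K" using K by auto
      show "K = ?M \<or> K = carrier FD"
      proof (cases "\<exists>f \<in> K. mixed f")
        case True
        then have "Alt \<subseteq> K" using Alt_subset[OF KG D0K] by auto
        then show ?thesis using Alt KD by auto
      next
        case False
        have "f \<in> ?M" if f: "f \<in> K" for f
        proof -
          have "f \<in> D" "\<not> mixed f" using False f KD by auto
          then obtain s a where s: "s \<in> F0 \<inter> D" "f = s \<otimes>\<^bsub>FG\<^esub> L a"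
            using pure_decompose by meson
          then have "s \<in> D0" using eq normalizer_eq_iff by auto
          then show ?thesis using s by (auto intro!: generate.eng intro: generate.incl)
        qed
        then show ?thesis using K by auto
      qed
    qed
  next
    assume "maximal_subgroup ?M FD"
    then show "?N = ?M"
      unfolding maximal_subgroup_def using subgroup_normalizer generate_subset_normalizer N by auto
  }
qed

end

end

section \<open>Groupoids and compact open bisections\<close>

locale abstract_groupoid =
  fixes G :: "('g, 'z) top_groupoid_scheme"
  assumes groupoid_G: "groupoid G"
begin

abbreviation "rr \<equiv> grng G"
abbreviation "ss \<equiv> gsrc G"
abbreviation "mu \<equiv> gmult G"
abbreviation "iv \<equiv> ginv G"
abbreviation "A \<equiv> garrows G"

lemma iv_closed: "g \<in> A \<Longrightarrow> iv g \<in> A" and iv_iv: "g \<in> A \<Longrightarrow> iv (iv g) = g"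
  using groupoid_G by (auto simp: groupoid_def)

lemma mu_facts:
  assumes "g \<in> A" "h \<in> A" "ss g = rr h"
  shows "mu g h \<in> A" "ss (mu g h) = ss h" "rr (mu g h) = rr g"
    "mu (iv g) (mu g h) = h" "mu (mu g h) (iv h) = g"
  using groupoid_G assms by (auto simp: groupoid_def composable_def)

lemma mu_assoc:
  assumes "g \<in> A" "h \<in> A" "k \<in> A" "ss g = rr h" "ss h = rr k"
  shows "mu (mu g h) k = mu g (mu h k)"
  using groupoid_G assms unfolding groupoid_def composable_def by auto

lemma ss_iv: "g \<in> A \<Longrightarrow> ss (iv g) = rr g" and rr_iv: "g \<in> A \<Longrightarrow> rr (iv g) = ss g"
  by (simp_all add: gsrc_def grng_def iv_iv)

lemma rr_closed: "g \<in> A \<Longrightarrow> rr g \<in> A" and ss_closed: "g \<in> A \<Longrightarrow> ss g \<in> A"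
  using mu_facts(1)[of g "iv g"] mu_facts(1)[of "iv g" g] iv_closed[of g]
  by (simp_all add: ss_iv rr_iv) (simp_all add: grng_def gsrc_def)

lemma rr_rr: "g \<in> A \<Longrightarrow> rr (rr g) = rr g" and ss_rr: "g \<in> A \<Longrightarrow> ss (rr g) = rr g"
  using mu_facts(2,3)[of g "iv g"] iv_closed[of g]
  by (simp_all add: ss_iv rr_iv) (simp_all add: grng_def)

lemma rr_ss: "g \<in> A \<Longrightarrow> rr (ss g) = ss g" and ss_ss: "g \<in> A \<Longrightarrow> ss (ss g) = ss g"
  using rr_rr[of "iv g"] ss_rr[of "iv g"] by (simp_all add: iv_closed rr_iv)

lemma mu_rr: "g \<in> A \<Longrightarrow> mu (rr g) g = g"
  using mu_facts(5)[of g "iv g"] by (simp add: iv_closed rr_iv iv_iv grng_def[symmetric])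

lemma mu_ss: "g \<in> A \<Longrightarrow> mu g (ss g) = g"
  using mu_facts(4)[of "iv g" g] by (simp add: iv_closed ss_iv iv_iv gsrc_def[symmetric])

lemma units_iff: "x \<in> gunits G \<longleftrightarrow> x \<in> A \<and> rr x = x"
  unfolding gunits_def using rr_closed rr_rr by force

lemma unit_ss: "x \<in> gunits G \<Longrightarrow> ss x = x"
  using units_iff ss_rr by metis

lemma units_subset: "gunits G \<subseteq> A"
  using units_iff by auto

lemma rr_unit: "g \<in> A \<Longrightarrow> rr g \<in> gunits G" and ss_unit: "g \<in> A \<Longrightarrow> ss g \<in> gunits G"
  using units_iff rr_closed rr_rr ss_closed rr_ss by auto

lemma iv_unique:
  assumes "g \<in> A" "h \<in> A" "ss g = rr h" "mu g h = rr g"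
  shows "h = iv g"
proof -
  have "h = mu (iv g) (mu g h)" using mu_facts(4)[OF assms(1-3)] by simp
  also have "\<dots> = mu (iv g) (ss (iv g))" using assms(1,4) by (simp add: ss_iv)
  also have "\<dots> = iv g" using mu_ss iv_closed assms by simp
  finally show ?thesis .
qed

end

locale etale_groupoid = abstract_groupoid +
  assumes etale_G: "etale G" and units_open: "openin (gtop G) (gunits G)"
    and compact_units: "compact_space (unit_top G)"
    and zero_dim: "\<And>x y. \<lbrakk>x \<in> gunits G; y \<in> gunits G; x \<noteq> y\<rbrakk> \<Longrightarrow>
      \<exists>B. openin (unit_top G) B \<and> closedin (unit_top G) B \<and> x \<in> B \<and> y \<notin> B"
begin

abbreviation "T \<equiv> gtop G"
abbreviation "U0 \<equiv> gunits G"
abbreviation "cob \<equiv> compact_open_bisection G"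

text \<open>Formulated in the arrow space, so that such sets are themselves compact open bisections;
  \<open>clop_iff\<close> identifies them with the clopen subsets of the unit space.\<close>

definition clop :: "'a set \<Rightarrow> bool" where
  "clop B \<longleftrightarrow> B \<subseteq> U0 \<and> openin T B \<and> compactin T B"

lemma Hausdorff_T: "Hausdorff_space T"
  and cont_iv: "continuous_map T T iv"
  and cont_mu: "continuous_map (subtopology (prod_topology T T) (composable G)) T (\<lambda>(g, h). mu g h)"
  using etale_G by (auto simp: etale_def topological_groupoid_def)

lemma compact_closed: "compactin T K \<Longrightarrow> closedin T K"
  using compactin_imp_closedin Hausdorff_T by blast

lemma cont_rr: "continuous_map T T rr"
proof -
  have "continuous_map T (subtopology (prod_topology T T) (composable G)) (\<lambda>g. (g, iv g))"
    by (intro continuous_map_into_subtopology continuous_map_pairedI cont_iv)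
      (auto simp: composable_def iv_closed rr_iv)
  from continuous_map_compose[OF this cont_mu] show ?thesis
    by (simp add: comp_def grng_def[abs_def])
qed

lemma cont_ss: "continuous_map T T ss"
proof -
  have "continuous_map T T (rr \<circ> iv)" using continuous_map_compose[OF cont_iv cont_rr] .
  then show ?thesis by (rule continuous_map_eq) (simp add: rr_iv)
qed

text \<open>Continuity of division is what makes products of open bisections open in
  \<open>cob_set_product\<close>.\<close>

lemma cont_div:
  "continuous_map (subtopology (prod_topology T T) {(h, g). rr h = rr g}) T (\<lambda>(h, g). mu (iv h) g)"
proof -
  let ?S = "subtopology (prod_topology T T) {(h, g). rr h = rr g}"
  have f: "continuous_map ?S T (\<lambda>z. fst z)" "continuous_map ?S T (\<lambda>z. snd z)"
    by (auto intro: continuous_map_from_subtopology continuous_map_fst continuous_map_snd)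
  then have "continuous_map ?S T (iv \<circ> fst)" using continuous_map_compose[OF _ cont_iv] by auto
  then have "continuous_map ?S (subtopology (prod_topology T T) (composable G)) (\<lambda>z. (iv (fst z),
    snd z))"
    using f by (intro continuous_map_into_subtopology continuous_map_pairedI)
      (auto simp: composable_def iv_closed ss_iv comp_def)
  from continuous_map_compose[OF this cont_mu] show ?thesis
    by (rule continuous_map_eq) auto
qed

lemma compact_U0: "compactin T U0"
  using compact_units units_subset by (simp add: compactin_subspace)

lemma clop_iff: "clop B \<longleftrightarrow> openin (unit_top G) B \<and> closedin (unit_top G) B"
proof
  assume B: "clop B"
  then have "compactin (unit_top G) B" by (simp add: clop_def compactin_subtopology)
  then have "closedin (unit_top G) B"
    using compactin_imp_closedin Hausdorff_space_subtopology[OF Hausdorff_T] by blast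
  then show "openin (unit_top G) B \<and> closedin (unit_top G) B"
    using B units_open by (simp add: clop_def openin_open_subtopology)
next
  assume B: "openin (unit_top G) B \<and> closedin (unit_top G) B"
  then have "compactin (unit_top G) B" using closedin_compact_space[OF compact_units] by blast
  then show "clop B" using B units_open by (simp add: clop_def openin_open_subtopology
    compactin_subtopology)
qed

lemma clop_U0: "clop U0"
  using units_open compact_U0 by (simp add: clop_def)

lemma clop_Un: "\<lbrakk>clop B; clop C\<rbrakk> \<Longrightarrow> clop (B \<union> C)"
  by (simp add: clop_def openin_Un compactin_Un)

lemma clop_Diff: "\<lbrakk>clop B; clop C\<rbrakk> \<Longrightarrow> clop (B - C)"
  unfolding clop_iff by (auto intro: openin_diff closedin_diff)

lemma clop_Int: "\<lbrakk>clop B; clop C\<rbrakk> \<Longrightarrow> clop (B \<inter> C)"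
  unfolding clop_iff by auto

text \<open>The complement of \<open>O'\<close> is compact and is covered by the complements of
  clopen neighbourhoods of \<open>x\<close>; finitely many of these suffice.\<close>

lemma clop_base:
  assumes x: "x \<in> O'" and O': "openin T O'" "O' \<subseteq> U0"
  shows "\<exists>B. clop B \<and> x \<in> B \<and> B \<subseteq> O'"
proof -
  have xU: "x \<in> U0" using x O' by auto
  let ?\<C> = "{U0 - B | B. clop B \<and> x \<in> B}"
  have "closedin T (U0 - O')" using closedin_diff[OF compact_closed[OF compact_U0] O'(1)] .
  then have "compactin T (U0 - O')" using closed_compactin[OF compact_U0] by blast
  moreover have "\<And>C. C \<in> ?\<C> \<Longrightarrow> openin T C" using clop_Diff[OF clop_U0] by (auto simp: clop_def)
  moreover have "U0 - O' \<subseteq> \<Union>?\<C>"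
  proof
    fix y assume y: "y \<in> U0 - O'"
    then have "x \<noteq> y" using x by auto
    then obtain B where "clop B" "x \<in> B" "y \<notin> B" using zero_dim[OF xU] y clop_iff by auto
    then show "y \<in> \<Union>?\<C>" using y by auto
  qed
  ultimately obtain \<F> where \<F>: "finite \<F>" "\<F> \<subseteq> ?\<C>" "U0 - O' \<subseteq> \<Union>\<F>"
    unfolding compactin_def by (meson subsetD)
  have "clop (U0 - \<Union>\<F>) \<and> x \<in> U0 - \<Union>\<F>" using \<F>(1,2)
  proof (induction rule: finite_induct)
    case empty then show ?case using clop_U0 xU by simp
  next
    case (insert C \<F>)
    then obtain B where B: "C = U0 - B" "clop B" "x \<in> B" by auto
    have "U0 - \<Union>(insert C \<F>) = (U0 - \<Union>\<F>) \<inter> B" using B by (auto simp: clop_def)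
    then show ?case using clop_Int[OF _ B(2)] insert B(3) by simp
  qed
  moreover have "U0 - \<Union>\<F> \<subseteq> O'" using \<F>(3) by auto
  ultimately show ?thesis by blast
qed

lemma local_section:
  assumes g: "g \<in> A"
  shows "\<exists>U. openin T U \<and> g \<in> U \<and> openin T (rr ` U) \<and>
    homeomorphic_map (subtopology T U) (subtopology T (rr ` U)) rr"
proof -
  obtain U where U: "openin T U" "g \<in> U" "openin (unit_top G) (rr ` U)"
    "homeomorphic_map (subtopology T U) (subtopology (unit_top G) (rr ` U)) rr"
    using etale_G g unfolding etale_def local_homeomorphism_map_def by blast
  have sub: "rr ` U \<subseteq> U0" using rr_unit openin_subset[OF U(1)] by auto
  then have "subtopology (unit_top G) (rr ` U) = subtopology T (rr ` U)"
    by (simp add: subtopology_subtopology Int_absorb1)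
  moreover have "openin T (rr ` U)" using U(3) units_open by (simp add: openin_open_subtopology)
  ultimately show ?thesis using U by auto
qed

lemma open_rr:
  assumes "openin T W"
  shows "openin T (rr ` W)"
proof (subst openin_subopen, intro ballI)
  fix x assume "x \<in> rr ` W"
  then obtain g where g: "g \<in> W" "x = rr g" by auto
  then have "g \<in> A" using openin_subset[OF assms] by auto
  then obtain U where U: "openin T U" "g \<in> U" "openin T (rr ` U)"
    "homeomorphic_map (subtopology T U) (subtopology T (rr ` U)) rr" using local_section by blast
  have "openin (subtopology T U) (U \<inter> W)" using assms U(1) by (simp add: openin_open_subtopology
    openin_Int)
  then have "openin (subtopology T (rr ` U)) (rr ` (U \<inter> W))"
    using homeomorphic_imp_open_map[OF U(4)] by (auto simp: open_map_def)
  then have "openin T (rr ` (U \<inter> W))" using openin_trans_full[OF _ U(3)] by blast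
  then show "\<exists>V. openin T V \<and> x \<in> V \<and> V \<subseteq> rr ` W" using g U(2) by (intro exI[of _ "rr ` (U \<inter> W)"])
    auto
qed

lemma open_iv: "openin T W \<Longrightarrow> openin T (iv ` W)"
proof -
  assume W: "openin T W"
  have "iv ` W = {g \<in> A. iv g \<in> W}"
    using openin_subset[OF W] iv_closed iv_iv by (force simp: image_iff)
  then show ?thesis using openin_continuous_map_preimage[OF cont_iv W] by simp
qed

lemma ss_image: "W \<subseteq> A \<Longrightarrow> ss ` W = rr ` iv ` W"
  by (force simp: rr_iv image_iff)

lemma open_ss: "openin T W \<Longrightarrow> openin T (ss ` W)"
  using open_rr[OF open_iv] ss_image openin_subset by metis

section \<open>Compact open bisections\<close>

lemma cob_iff: "cob V \<longleftrightarrow> openin T V \<and> compactin T V \<and> inj_on rr V \<and> inj_on ss V"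
  by (auto simp: compact_open_bisection_def bisection_def dest: openin_subset)

lemma cob_subset: "cob V \<Longrightarrow> V \<subseteq> A"
  by (simp add: cob_iff openin_subset)

lemma cob_rr: "cob V \<Longrightarrow> clop (rr ` V)"
  unfolding clop_def cob_iff using open_rr image_compactin[OF _ cont_rr] rr_unit openin_subset[of
    T V] by auto

lemma cob_ss: "cob V \<Longrightarrow> clop (ss ` V)"
  unfolding clop_def cob_iff using open_ss image_compactin[OF _ cont_ss] ss_unit openin_subset[of
    T V] by auto

lemma cob_iv: "cob V \<Longrightarrow> cob (iv ` V)"
proof -
  assume V: "cob V"
  have VA: "V \<subseteq> A" using cob_subset[OF V] .
  have "inj_on rr (iv ` V)" "inj_on ss (iv ` V)"
    using V VA unfolding cob_iff inj_on_def by (auto simp: rr_iv ss_iv subset_iff)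
  then show ?thesis using V open_iv image_compactin[OF _ cont_iv] by (auto simp: cob_iff)
qed

lemma cob_clop: "clop B \<Longrightarrow> cob B"
  unfolding clop_def cob_iff using units_iff unit_ss by (auto simp: inj_on_def subset_iff)

lemma cob_restrict:
  assumes V: "cob V" and B: "clop B"
  shows "cob {v \<in> V. ss v \<in> B}"
proof -
  have "openin T B" "closedin T B" using B compact_closed by (auto simp: clop_def)
  then have c: "openin T {v \<in> A. ss v \<in> B}" "closedin T {v \<in> A. ss v \<in> B}"
    using openin_continuous_map_preimage[OF cont_ss] closedin_continuous_map_preimage[OF cont_ss]
      by auto
  have "{v \<in> V. ss v \<in> B} = V \<inter> {v \<in> A. ss v \<in> B}" using cob_subset[OF V] by auto
  then show ?thesis using V c unfolding cob_iff
    by (auto intro: openin_Int compact_Int_closedin inj_on_subset)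
qed

lemma cob_Un:
  assumes "cob V" "cob W" "ss ` V \<inter> ss ` W = {}" "rr ` V \<inter> rr ` W = {}"
  shows "cob (V \<union> W)"
  using assms unfolding cob_iff by (auto intro: compactin_Un simp: inj_on_Un)

text \<open>Local injectivity of the range map at \<open>g\<close> and at its inverse makes both
  range and source injective near \<open>g\<close>. Cutting the range down to a clopen
  \<open>B\<close> gives compactness, since the piece is the image of \<open>B\<close> under the
  local section \<open>k\<close>.\<close>

lemma cob_base:
  assumes g: "g \<in> W" and W: "openin T W"
  shows "\<exists>V. cob V \<and> g \<in> V \<and> V \<subseteq> W"
proof -
  have gA: "g \<in> A" using g openin_subset[OF W] by auto
  obtain U where U: "openin T U" "g \<in> U" "openin T (rr ` U)"
    "homeomorphic_map (subtopology T U) (subtopology T (rr ` U)) rr" using local_section[OF gA] by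
      blast
  obtain U' where U': "openin T U'" "iv g \<in> U'"
    "homeomorphic_map (subtopology T U') (subtopology T (rr ` U')) rr" using local_section[OF
      iv_closed[OF gA]] by blast
  have inj: "inj_on rr U" "inj_on rr U'"
    using U(4) U'(3) openin_subset[OF U(1)] openin_subset[OF U'(1)]
    by (auto simp: homeomorphic_eq_everything_map Int_absorb1)
  let ?O = "W \<inter> U \<inter> {h \<in> A. iv h \<in> U'}"
  have O: "openin T ?O" using W U(1) openin_continuous_map_preimage[OF cont_iv U'(1)] by auto
  have gO: "g \<in> ?O" using g U U' gA by auto
  have "rr ` ?O \<subseteq> U0" using rr_unit by auto
  then obtain B where B: "clop B" "rr g \<in> B" "B \<subseteq> rr ` ?O"
    using clop_base[OF _ open_rr[OF O]] gO by blast
  define V where "V = {h \<in> ?O. rr h \<in> B}"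
  have "V = ?O \<inter> {h \<in> A. rr h \<in> B}" unfolding V_def by auto
  then have openV: "openin T V"
    using O openin_continuous_map_preimage[OF cont_rr] B(1) by (simp add: clop_def openin_Int)
  obtain k where k: "homeomorphic_maps (subtopology T U) (subtopology T (rr ` U)) rr k"
    using U(4) homeomorphic_map_maps by blast
  have VU: "V \<subseteq> U" "V \<subseteq> A" unfolding V_def by auto
  have UA: "U \<subseteq> A" using openin_subset[OF U(1)] .
  have kr: "k (rr h) = h" if "h \<in> U" for h using k that UA by (auto simp: homeomorphic_maps_def)
  have "V = k ` B"
  proof (intro equalityI subsetI)
    fix h assume "h \<in> V"
    then show "h \<in> k ` B" using kr[of h] VU unfolding V_def by (intro image_eqI[of _ _ "rr h"]) auto
  next
    fix h assume "h \<in> k ` B"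
    then obtain b where b: "b \<in> B" "h = k b" by auto
    then obtain h' where "h' \<in> ?O" "b = rr h'" using B(3) by auto
    then show "h \<in> V" using kr[of h'] b unfolding V_def by auto
  qed
  moreover have "compactin (subtopology T (rr ` U)) B"
    using B by (auto simp: clop_def compactin_subtopology)
  ultimately have "compactin (subtopology T U) V"
    using image_compactin k unfolding homeomorphic_maps_def by blast
  then have "compactin T V" by (simp add: compactin_subtopology)
  moreover have "inj_on rr V" using inj_on_subset[OF inj(1) VU(1)] .
  moreover have "inj_on ss V"
  proof (rule inj_onI)
    fix h h' assume h: "h \<in> V" "h' \<in> V" "ss h = ss h'"
    then have "h \<in> A" "h' \<in> A" "iv h \<in> U'" "iv h' \<in> U'" unfolding V_def by auto
    then have "iv h = iv h'" using inj(2) h(3) by (metis inj_onD rr_iv)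
    then show "h = h'" using iv_iv \<open>h \<in> A\<close> \<open>h' \<in> A\<close> by metis
  qed
  ultimately have "cob V" using openV by (simp add: cob_iff)
  moreover have "g \<in> V" "V \<subseteq> W" using gO B(2) unfolding V_def by auto
  ultimately show ?thesis by blast
qed

definition set_product :: "'a set \<Rightarrow> 'a set \<Rightarrow> 'a set" where
  "set_product V W = {mu v w | v w. v \<in> V \<and> w \<in> W \<and> ss v = rr w}"

text \<open>Compactness: the product is the continuous image of the closed set of composable pairs
  in \<open>V \<times> W\<close>. Openness: for \<open>h\<close> near \<open>v w\<close>, the arrow
  \<open>v'\<close> of \<open>V\<close> with the same range as \<open>h\<close> is near
  \<open>v\<close>, so by continuity of division the inverse of \<open>v'\<close> times
  \<open>h\<close> still lies in \<open>W\<close>.\<close>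

lemma cob_set_product:
  assumes V: "cob V" and W: "cob W"
  shows "cob (set_product V W)"
proof -
  note VA = cob_subset[OF V] and WA = cob_subset[OF W]
  have PA: "set_product V W \<subseteq> A" unfolding set_product_def using mu_facts(1) VA WA by auto
  have "inj_on rr (set_product V W)"
  proof (rule inj_onI)
    fix x y assume "x \<in> set_product V W" "y \<in> set_product V W" and e: "rr x = rr y"
    then obtain v w v' w' where x: "x = mu v w" "v \<in> V" "w \<in> W" "ss v = rr w"
      and y: "y = mu v' w'" "v' \<in> V" "w' \<in> W" "ss v' = rr w'" unfolding set_product_def by blast
    have "v \<in> A" "w \<in> A" "v' \<in> A" "w' \<in> A" using VA WA x y by auto
    then have "rr v = rr v'" using mu_facts(3) x y e by simp
    then have "v = v'" using V x y unfolding cob_iff inj_on_def by auto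
    then have "w = w'" using W x y unfolding cob_iff inj_on_def by metis
    then show "x = y" using x y \<open>v = v'\<close> by simp
  qed
  moreover have "inj_on ss (set_product V W)"
  proof (rule inj_onI)
    fix x y assume "x \<in> set_product V W" "y \<in> set_product V W" and e: "ss x = ss y"
    then obtain v w v' w' where x: "x = mu v w" "v \<in> V" "w \<in> W" "ss v = rr w"
      and y: "y = mu v' w'" "v' \<in> V" "w' \<in> W" "ss v' = rr w'" unfolding set_product_def by blast
    have "v \<in> A" "w \<in> A" "v' \<in> A" "w' \<in> A" using VA WA x y by auto
    then have "ss w = ss w'" using mu_facts(2) x y e by simp
    then have "w = w'" using W x y unfolding cob_iff inj_on_def by auto
    then have "v = v'" using V x y unfolding cob_iff inj_on_def by metis
    then show "x = y" using x y \<open>w = w'\<close> by simp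
  qed
  moreover have "compactin T (set_product V W)"
  proof -
    let ?E = "{z \<in> topspace (prod_topology T T). (ss \<circ> fst) z = (rr \<circ> snd) z}"
    have "closedin (prod_topology T T) ?E"
      by (rule closedin_continuous_maps_eq[OF Hausdorff_T continuous_map_compose[OF
        continuous_map_fst cont_ss]
            continuous_map_compose[OF continuous_map_snd cont_rr]])
    moreover have "compactin (prod_topology T T) (V \<times> W)"
      using V W by (auto simp: compactin_Times cob_iff)
    ultimately have "compactin (prod_topology T T) ((V \<times> W) \<inter> ?E)" by (simp add:
      compact_Int_closedin)
    moreover have "(V \<times> W) \<inter> ?E \<subseteq> composable G" using VA WA by (auto simp: composable_def)
    ultimately have "compactin (subtopology (prod_topology T T) (composable G)) ((V \<times> W) \<inter> ?E)"
      by (simp add: compactin_subtopology)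
    from image_compactin[OF this cont_mu] have "compactin T ((\<lambda>(g, h). mu g h) ` ((V \<times> W) \<inter> ?E))" .
    moreover have "(\<lambda>(g, h). mu g h) ` ((V \<times> W) \<inter> ?E) = set_product V W"
      unfolding set_product_def using VA WA by (force simp: image_iff)
    ultimately show ?thesis by simp
  qed
  moreover have "openin T (set_product V W)"
  proof (subst openin_subopen, intro ballI)
    fix g assume "g \<in> set_product V W"
    then obtain v w where vw: "g = mu v w" "v \<in> V" "w \<in> W" "ss v = rr w" unfolding set_product_def
      by blast
    have A: "v \<in> A" "w \<in> A" using vw VA WA by auto
    have gA: "g \<in> A" "rr g = rr v" "mu (iv v) g = w" using mu_facts[OF A vw(4)] vw(1) by auto
    let ?D = "subtopology (prod_topology T T) {(h, g). rr h = rr g}"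
    have "openin T W" using W by (simp add: cob_iff)
    from openin_continuous_map_preimage[OF cont_div this]
    obtain S where S: "openin (prod_topology T T) S"
      "{z \<in> topspace ?D. (\<lambda>(h, g). mu (iv h) g) z \<in> W} = S \<inter> {(h, g). rr h = rr g}"
      unfolding openin_subtopology by blast
    have "(v, g) \<in> {z \<in> topspace ?D. (\<lambda>(h, g). mu (iv h) g) z \<in> W}" using A gA vw by simp
    then have "(v, g) \<in> S" unfolding S(2) by simp
    then obtain N1 N2 where N: "openin T N1" "openin T N2" "v \<in> N1" "g \<in> N2" "N1 \<times> N2 \<subseteq> S"
      using S(1)[unfolded openin_prod_topology_alt, rule_format] by metis
    have "openin T (N1 \<inter> V)" using N(1) V by (auto simp: cob_iff)
    from openin_continuous_map_preimage[OF cont_rr open_rr[OF this]]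
    have N3: "openin T (N2 \<inter> {h \<in> A. rr h \<in> rr ` (N1 \<inter> V)})" using N(2) by auto
    have "h \<in> set_product V W" if h: "h \<in> N2" "h \<in> A" "rr h \<in> rr ` (N1 \<inter> V)" for h
    proof -
      obtain v' where v': "v' \<in> N1" "v' \<in> V" "rr v' = rr h" using h(3) by auto
      then have "(v', h) \<in> S \<inter> {(h, g). rr h = rr g}" using N(5) h(1) by auto
      then have w': "mu (iv v') h \<in> W" unfolding S(2)[symmetric] by simp
      have v'A: "v' \<in> A" using v' VA by auto
      have c: "ss (iv v') = rr h" using ss_iv[OF v'A] v'(3) by simp
      have "ss v' = rr (mu (iv v') h)" using mu_facts(3)[OF iv_closed[OF v'A] h(2) c] rr_iv[OF
        v'A] by simp
      moreover have "mu v' (mu (iv v') h) = h"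
        using mu_facts(4)[OF iv_closed[OF v'A] h(2) c] iv_iv[OF v'A] by simp
      ultimately show ?thesis unfolding set_product_def using v'(2) w' by force
    qed
    then show "\<exists>N. openin T N \<and> g \<in> N \<and> N \<subseteq> set_product V W"
      using N3 N(3,4) vw(2) gA(1,2) by (intro exI[of _ "N2 \<inter> {h \<in> A. rr h \<in> rr ` (N1 \<inter> V)}"]) auto
  qed
  ultimately show ?thesis by (simp add: cob_iff)
qed

lemma compact_cover_cob:
  assumes K: "compactin T K" and W: "openin T W" "K \<subseteq> W"
  shows "\<exists>\<V>. finite \<V> \<and> (\<forall>V \<in> \<V>. cob V \<and> V \<subseteq> W) \<and> K \<subseteq> \<Union>\<V>"
proof -
  let ?\<C> = "{V. cob V \<and> V \<subseteq> W}"
  have "\<And>V. V \<in> ?\<C> \<Longrightarrow> openin T V" by (simp add: cob_iff)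
  moreover have "K \<subseteq> \<Union>?\<C>"
  proof
    fix g assume "g \<in> K"
    then obtain V where "cob V" "g \<in> V" "V \<subseteq> W" using cob_base[of g W] W by blast
    then show "g \<in> \<Union>?\<C>" by auto
  qed
  ultimately obtain \<F> where "finite \<F>" "\<F> \<subseteq> ?\<C>" "K \<subseteq> \<Union>\<F>"
    using K unfolding compactin_def by (meson subsetD)
  then show ?thesis by (intro exI[of _ \<F>]) auto
qed

text \<open>An automorphism is only required to respect products. That it commutes with inversion,
  and then with range and source, follows from uniqueness of inverses.\<close>

lemma cob_automorphism:
  assumes f: "groupoid_automorphism G f" and V: "cob V"
  shows "cob (f ` V)"
    and "\<And>g. g \<in> A \<Longrightarrow> f g \<in> A" "\<And>g. g \<in> A \<Longrightarrow> rr (f g) = f (rr g)" "\<And>g. g \<in> A \<Longrightarrow> ss (f g) = f (ss g)"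
    "\<And>g. g \<in> A \<Longrightarrow> iv (f g) = f (iv g)"
proof -
  have h: "homeomorphic_map T T f" and
    m: "\<And>g h. \<lbrakk>g \<in> A; h \<in> A; ss g = rr h\<rbrakk> \<Longrightarrow> ss (f g) = rr (f h) \<and> f (mu g h) = mu (f g) (f h)"
    using f by (auto simp: groupoid_automorphism_def composable_def)
  have inj: "inj_on f A" and cont: "continuous_map T T f" and op: "open_map T T f"
    using h by (auto simp: homeomorphic_eq_everything_map)
  show fA: "f g \<in> A" if "g \<in> A" for g using cont that by (auto simp: continuous_map_def)
  show i: "iv (f g) = f (iv g)" if g: "g \<in> A" for g
  proof -
    have 1: "ss (f g) = rr (f (iv g))" "f (rr g) = mu (f g) (f (iv g))"
      using m[OF g iv_closed[OF g]] rr_iv[OF g] by (simp_all add: grng_def)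
    have 2: "ss (f (rr g)) = rr (f g)" "f g = mu (f (rr g)) (f g)"
      using m[OF rr_closed[OF g] g] ss_rr[OF g] mu_rr[OF g] by simp_all
    have "rr (f (rr g)) = rr (f g)" using mu_facts(3)[OF fA fA 2(1)] rr_closed g 2(2) by metis
    have "f (rr g) = rr (f g)"
      using mu_facts(5)[OF fA[OF rr_closed[OF g]] fA[OF g] 2(1)] 2(2) by (metis grng_def)
    then show ?thesis using iv_unique[OF fA[OF g] fA[OF iv_closed[OF g]] 1(1)] 1(2) by simp
  qed
  show r: "rr (f g) = f (rr g)" if g: "g \<in> A" for g
    using m[OF g iv_closed[OF g]] rr_iv[OF g] i[OF g] by (simp add: grng_def)
  show s: "ss (f g) = f (ss g)" if g: "g \<in> A" for g
    using m[OF iv_closed[OF g] g] ss_iv[OF g] i[OF g] by (simp add: gsrc_def)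
  have VA: "V \<subseteq> A" using cob_subset[OF V] .
  have "inj_on rr (f ` V)" "inj_on ss (f ` V)"
    using V VA inj r s rr_closed ss_closed unfolding cob_iff inj_on_def by (auto simp: subset_iff)
      metis+
  then show "cob (f ` V)"
    using V op image_compactin[OF _ cont] by (auto simp: cob_iff open_map_def)
qed

end

section \<open>Cantor spaces\<close>

abbreviation cantor_cube :: "(nat \<Rightarrow> bool) topology" where
  "cantor_cube \<equiv> product_topology (\<lambda>_. discrete_topology UNIV) UNIV"

lemma topspace_cantor_cube: "topspace cantor_cube = UNIV"
  by (auto simp: PiE_def)

lemma cantor_space_compact: "cantor_space X \<Longrightarrow> compact_space X"
  using homeomorphic_compact_space[of X cantor_cube]
  by (simp add: cantor_space_def compact_space_product_topology compact_space_discrete_topology)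

lemma cantor_space_separation:
  assumes "cantor_space X" "x \<in> topspace X" "y \<in> topspace X" "x \<noteq> y"
  shows "\<exists>B. openin X B \<and> closedin X B \<and> x \<in> B \<and> y \<notin> B"
proof -
  obtain f g where fg: "homeomorphic_maps X cantor_cube f g"
    using assms(1) unfolding cantor_space_def homeomorphic_space_def by auto
  then have "f x \<noteq> f y" using assms by (auto simp: homeomorphic_maps_def) metis
  then obtain n where n: "f x n \<noteq> f y n" by auto
  have "continuous_map X cantor_cube f" using fg by (simp add: homeomorphic_maps_def)
  then have c: "continuous_map X (discrete_topology UNIV) (\<lambda>z. f z n)"
    using continuous_map_compose[OF _ continuous_map_product_projection[of n UNIV
      "\<lambda>_. discrete_topology UNIV"]]
    by (simp add: comp_def)
  let ?B = "{z \<in> topspace X. f z n \<in> {f x n}}"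
  have "openin X ?B" "closedin X ?B"
    using openin_continuous_map_preimage[OF c, of "{f x n}"] closedin_continuous_map_preimage[OF
      c, of "{f x n}"]
    by auto
  then show ?thesis using n assms by (intro exI[of _ ?B]) auto
qed

text \<open>A basic open set restricts finitely many coordinates; flipping any one of the others
  stays inside it.\<close>

lemma cantor_cube_open_infinite:
  assumes "openin cantor_cube U" "x \<in> U"
  shows "infinite U"
proof -
  obtain W where W: "finite {i. W i \<noteq> UNIV}" "x \<in> Pi\<^sub>E UNIV W" "Pi\<^sub>E UNIV W \<subseteq> U"
    using assms unfolding openin_product_topology_alt by force
  let ?f = "\<lambda>n. x(n := \<not> x n)"
  have "inj ?f" by (rule injI) (metis fun_upd_apply)
  then have "inj_on ?f (UNIV - {i. W i \<noteq> UNIV})" by (rule inj_on_subset) simp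
  moreover have "infinite (UNIV - {i. W i \<noteq> UNIV})" using W(1) by (simp add: Diff_infinite_finite)
  ultimately have "infinite (?f ` (UNIV - {i. W i \<noteq> UNIV}))" using finite_imageD by blast
  moreover have "?f ` (UNIV - {i. W i \<noteq> UNIV}) \<subseteq> U"
  proof
    fix y assume "y \<in> ?f ` (UNIV - {i. W i \<noteq> UNIV})"
    then obtain n where n: "W n = UNIV" "y = ?f n" by auto
    then have "y \<in> Pi\<^sub>E UNIV W" using W(2) by (auto simp: PiE_def Pi_def)
    then show "y \<in> U" using W(3) by auto
  qed
  ultimately show ?thesis using finite_subset by blast
qed

lemma cantor_space_open_infinite:
  assumes "cantor_space X" "openin X U" "U \<noteq> {}"
  shows "infinite U"
proof -
  obtain f where f: "homeomorphic_map X cantor_cube f"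
    using assms(1) unfolding cantor_space_def homeomorphic_space by auto
  then have "openin cantor_cube (f ` U)"
    using assms(2) homeomorphic_imp_open_map[OF f] by (auto simp: open_map_def)
  then have "infinite (f ` U)" using cantor_cube_open_infinite assms(3) by blast
  then show ?thesis by auto
qed

section \<open>The pseudogroup of a semidirect product\<close>

locale semidirect_setting =
  fixes p :: nat and G :: "'g top_groupoid" and lam :: "int \<Rightarrow> 'g \<Rightarrow> 'g"
  assumes prime_p: "prime p" and ample_G: "ample G" and cantor_G: "cantor_space (unit_top G)"
    and action: "groupoid_action p G lam" and free: "free_on_units p G lam"
    and effective_G: "effective G" and effective_H: "effective (semidirect p G lam)"
    and minimal_G: "minimal_groupoid G"
begin

definition H :: "('g \<times> int) top_groupoid" where "H = semidirect p G lam"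

lemma topspace_unit_top: "topspace (unit_top G) = gunits G"
  if "openin (gtop G) (gunits G)" using openin_subset[OF that] by (simp add: Int_absorb1)

text \<open>Effectiveness exhibits the unit space as an interior.\<close>

lemma units_open: "openin (gtop G) (gunits G)"
  using effective_G openin_interior_of[of "gtop G" "isotropy G"] by (simp add: effective_def)

sublocale G: etale_groupoid G
proof
  show "groupoid G" "etale G" using ample_G by (auto simp: ample_def etale_def
    topological_groupoid_def)
  show "openin (gtop G) (gunits G)" by (rule units_open)
  show "compact_space (unit_top G)" by (rule cantor_space_compact[OF cantor_G])
  show "\<exists>B. openin (unit_top G) B \<and> closedin (unit_top G) B \<and> x \<in> B \<and> y \<notin> B"
    if "x \<in> gunits G" "y \<in> gunits G" "x \<noteq> y" for x y
    using cantor_space_separation[OF cantor_G] that topspace_unit_top[OF units_open] by auto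
qed

abbreviation "Zp \<equiv> integer_mod_group p"
text \<open>Degrees are arbitrary integers, while \<open>lam\<close> is specified on the
  representatives in \<open>carrier Zp\<close> only.\<close>

abbreviation "la c \<equiv> lam (c mod int p)"

lemma p_pos: "0 < int p"
  using prime_gt_0_nat[OF prime_p] by simp

lemma carrier_Zp: "carrier Zp = {0..<int p}"
  using p_pos by (simp add: carrier_integer_mod_group)

lemma mod_in_Zp [simp]: "c mod int p \<in> carrier Zp"
  unfolding carrier_Zp using p_pos by simp

lemma mod_Zp: "c \<in> carrier Zp \<Longrightarrow> c mod int p = c"
  unfolding carrier_Zp by simp

lemma action_group: "group_action Zp G.A lam"
  using action by (simp add: groupoid_action_def)

lemma la_automorphism: "groupoid_automorphism G (la c)"
  using action mod_in_Zp unfolding groupoid_action_def by blast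

lemma la_A: "g \<in> G.A \<Longrightarrow> la c g \<in> G.A"
  and la_rr: "g \<in> G.A \<Longrightarrow> G.rr (la c g) = la c (G.rr g)"
  and la_ss: "g \<in> G.A \<Longrightarrow> G.ss (la c g) = la c (G.ss g)"
  and la_iv: "g \<in> G.A \<Longrightarrow> G.iv (la c g) = la c (G.iv g)"
  and cob_la: "G.cob V \<Longrightarrow> G.cob (la c ` V)"
proof -
  have e: "G.cob {}" by (simp add: G.cob_iff)
  note 1 = G.cob_automorphism(2-5)[OF la_automorphism e]
  show "g \<in> G.A \<Longrightarrow> la c g \<in> G.A" "g \<in> G.A \<Longrightarrow> G.rr (la c g) = la c (G.rr g)"
    "g \<in> G.A \<Longrightarrow> G.ss (la c g) = la c (G.ss g)" "g \<in> G.A \<Longrightarrow> G.iv (la c g) = la c (G.iv g)"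
    by (rule 1, assumption)+
  show "G.cob V \<Longrightarrow> G.cob (la c ` V)" by (rule G.cob_automorphism(1)[OF la_automorphism])
qed

lemma la_mu:
  assumes "g \<in> G.A" "h \<in> G.A" "G.ss g = G.rr h"
  shows "la c (G.mu g h) = G.mu (la c g) (la c h)"
proof -
  have "(g, h) \<in> composable G" using assms by (simp add: composable_def)
  then show ?thesis using la_automorphism[of c] unfolding groupoid_automorphism_def by auto
qed

lemma la_add: "g \<in> G.A \<Longrightarrow> la (a + b) g = la a (la b g)"
  using group_action.composition_rule[OF action_group _ mod_in_Zp mod_in_Zp, of g a b]
  by (simp add: mod_add_eq)

lemma la_0: "g \<in> G.A \<Longrightarrow> la 0 g = g"
  using group_action.id_eq_one[OF action_group, THEN fun_cong, of g] by simp

lemma la_minus: "g \<in> G.A \<Longrightarrow> la (- c) (la c g) = g" "g \<in> G.A \<Longrightarrow> la c (la (- c) g) = g"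
  using la_add[of g "- c" c] la_add[of g c "- c"] la_0 by simp_all

lemma la_unit: "x \<in> G.U0 \<Longrightarrow> la c x \<in> G.U0"
  using G.units_iff la_A la_rr by metis

lemma la_inj: "\<lbrakk>g \<in> G.A; h \<in> G.A\<rbrakk> \<Longrightarrow> la c g = la c h \<longleftrightarrow> g = h"
  using la_minus by metis

lemma clop_la:
  assumes "G.clop B"
  shows "G.clop (la c ` B)"
proof -
  have "la c ` B \<subseteq> G.U0" using assms la_unit by (auto simp: G.clop_def)
  then show ?thesis using cob_la[OF G.cob_clop[OF assms]] by (simp add: G.clop_def G.cob_iff)
qed

section \<open>Partial maps given by bisections of the semidirect product\<close>

definition j :: "'g \<Rightarrow> 'g \<times> int" where "j x = (x, 0)"

definition X :: "('g \<times> int) set" where "X = j ` G.U0"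

definition CL :: "('g \<times> int) set set" where "CL = {j ` B | B. G.clop B}"

lemma j_eq [simp]: "j x = j y \<longleftrightarrow> x = y" and fst_j [simp]: "fst (j x) = x" and snd_j [simp]:
  "snd (j x) = 0"
  by (auto simp: j_def)

lemma j_image_iff [simp]: "j x \<in> j ` B \<longleftrightarrow> x \<in> B"
  by auto

lemma j_image_eq: "j ` B = j ` C \<longleftrightarrow> B = C"
  by (rule inj_image_eq_iff) (simp add: inj_def)

definition src :: "int \<Rightarrow> 'g \<Rightarrow> 'g" where "src c v = la (- c) (G.ss v)"

text \<open>\<open>src c v\<close> and the range of \<open>v\<close> are the source and range of the arrow \<open>(v, c mod p)\<close>, so \<open>P c B f\<close> says
  that \<open>f\<close> is given on \<open>B\<close> by a compact open bisection \<open>V \<times> {c mod p}\<close> of \<open>H\<close>.\<close>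

definition P :: "int \<Rightarrow> ('g \<times> int) set \<Rightarrow> ('g \<times> int \<Rightarrow> 'g \<times> int) \<Rightarrow> bool" where
  "P c B f \<longleftrightarrow> (\<exists>V. G.cob V \<and> B = j ` src c ` V \<and> (\<forall>v \<in> V. f (j (src c v)) = j (G.rr v)))"

definition L :: "int \<Rightarrow> 'g \<times> int \<Rightarrow> 'g \<times> int" where
  "L a = (\<lambda>y\<in>X. (la a (fst y), snd y))"

lemma P_I: "\<lbrakk>G.cob V; B = j ` src c ` V; \<And>v. v \<in> V \<Longrightarrow> f (j (src c v)) = j (G.rr v)\<rbrakk> \<Longrightarrow> P c B f"
  unfolding P_def by auto

lemma src_inj: "\<lbrakk>v \<in> G.A; w \<in> G.A\<rbrakk> \<Longrightarrow> src c v = src c w \<longleftrightarrow> G.ss v = G.ss w"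
  unfolding src_def using la_inj G.ss_closed by auto

lemma src_image: "src c ` V = la (- c) ` G.ss ` V"
  unfolding src_def by auto

lemma clop_src: "G.cob V \<Longrightarrow> G.clop (src c ` V)"
  unfolding src_image using clop_la[OF G.cob_ss] by auto

lemma boolean_X: "boolean_space X CL"
proof
  show "B \<subseteq> X" if "B \<in> CL" for B using that by (auto simp: CL_def X_def G.clop_def)
  show "X \<in> CL" unfolding X_def CL_def using G.clop_U0 by auto
  show "B \<union> C \<in> CL" if BC: "B \<in> CL" "C \<in> CL" for B C
  proof -
    obtain B' C' where B: "B = j ` B'" "G.clop B'" "C = j ` C'" "G.clop C'" using BC by (auto
      simp: CL_def)
    then have "B \<union> C = j ` (B' \<union> C')" by auto
    moreover have "G.clop (B' \<union> C')" using G.clop_Un B by simp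
    ultimately show ?thesis unfolding CL_def by blast
  qed
  show "B - C \<in> CL" if BC: "B \<in> CL" "C \<in> CL" for B C
  proof -
    obtain B' C' where B: "B = j ` B'" "G.clop B'" "C = j ` C'" "G.clop C'" using BC by (auto
      simp: CL_def)
    then have "B - C = j ` (B' - C')" by auto
    moreover have "G.clop (B' - C')" using G.clop_Diff B by simp
    ultimately show ?thesis unfolding CL_def by blast
  qed
  show "\<exists>B \<in> CL. x \<in> B \<and> y \<notin> B" if xy: "x \<in> X" "y \<in> X" "x \<noteq> y" for x y
  proof -
    obtain x' y' where x': "x = j x'" "x' \<in> G.U0" "y = j y'" "y' \<in> G.U0" using xy by (auto simp:
      X_def)
    then obtain B where "G.clop B" "x' \<in> B" "y' \<notin> B" using G.zero_dim[of x' y'] G.clop_iff xy(3)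
      by auto
    then show ?thesis using x' unfolding CL_def by (intro bexI[of _ "j ` B"]) auto
  qed
  show "\<exists>\<V>. finite \<V> \<and> \<V> \<subseteq> \<U> \<and> X \<subseteq> \<Union>\<V>" if \<U>: "\<U> \<subseteq> CL" "X \<subseteq> \<Union>\<U>" for \<U>
  proof -
    let ?\<C> = "{B. G.clop B \<and> j ` B \<in> \<U>}"
    have "\<And>B. B \<in> ?\<C> \<Longrightarrow> openin G.T B" by (simp add: G.clop_def)
    moreover have "G.U0 \<subseteq> \<Union>?\<C>"
    proof
      fix x assume "x \<in> G.U0"
      then have "j x \<in> X" by (simp add: X_def)
      then obtain B where B: "B \<in> \<U>" "j x \<in> B" using \<U>(2) by auto
      then obtain B' where "B = j ` B'" "G.clop B'" using \<U>(1) unfolding CL_def by auto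
      then show "x \<in> \<Union>?\<C>" using B by auto
    qed
    ultimately obtain \<F> where \<F>: "finite \<F>" "\<F> \<subseteq> ?\<C>" "G.U0 \<subseteq> \<Union>\<F>"
      using G.compact_U0 unfolding compactin_def by (meson subsetD)
    have "X \<subseteq> \<Union>((`) j ` \<F>)" unfolding X_def using \<F>(3) by blast
    then show ?thesis using \<F>(1,2) by (intro exI[of _ "(`) j ` \<F>"]) auto
  qed
  show "infinite B" if B: "B \<in> CL" "B \<noteq> {}" for B
  proof -
    obtain B' where B': "B = j ` B'" "G.clop B'" using B by (auto simp: CL_def)
    then have "infinite B'" using cantor_space_open_infinite[OF cantor_G] G.clop_iff B(2) by blast
    moreover have "inj_on j B'" by (auto intro: inj_onI)
    ultimately show ?thesis using B' finite_imageD by blast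
  qed
  show "X \<noteq> {}"
  proof -
    obtain f where "homeomorphic_map (unit_top G) cantor_cube f"
      using cantor_G unfolding cantor_space_def homeomorphic_space by auto
    then have "f ` topspace (unit_top G) = UNIV"
      using topspace_cantor_cube homeomorphic_imp_surjective_map by metis
    then have "topspace (unit_top G) \<noteq> {}" by auto
    then show ?thesis by (auto simp: X_def topspace_unit_top[OF units_open])
  qed
qed

text \<open>In the semidirect product (w, d)(v, c) = (w \<lambda>(v), d + c), with \<lambda> the
  automorphism \<open>la d\<close>. So the composite is given by the product of \<open>W\<close>
  with the translate of \<open>V\<close>.\<close>

lemma P_comp:
  assumes "P c B f" "P d (f ` B) g"
  shows "P (c + d) B (\<lambda>x. g (f x))"
proof -
  obtain V where V: "G.cob V" "B = j ` src c ` V" "\<And>v. v \<in> V \<Longrightarrow> f (j (src c v)) = j (G.rr v)"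
    using assms(1) unfolding P_def by auto
  obtain W where W: "G.cob W" "f ` B = j ` src d ` W" "\<And>w. w \<in> W \<Longrightarrow> g (j (src d w)) = j (G.rr w)"
    using assms(2) unfolding P_def by auto
  have VA: "V \<subseteq> G.A" and WA: "W \<subseteq> G.A" using G.cob_subset V(1) W(1) by auto
  have "f ` B = j ` G.rr ` V" unfolding V(2) using V(3) by (force simp: image_iff)
  then have rV: "G.rr ` V = src d ` W" using W(2) by (simp add: j_image_eq)
  have s: "src (c + d) (G.mu w (la d v)) = src c v" "G.rr (G.mu w (la d v)) = G.rr w"
    and m: "G.rr v = src d w"
    if "v \<in> G.A" "w \<in> G.A" "G.ss w = G.rr (la d v)" for v w
  proof -
    have "G.ss (G.mu w (la d v)) = la d (G.ss v)" using G.mu_facts(2) la_A la_ss that by simp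
    moreover have "la (- (c + d)) (la d (G.ss v)) = la (- c) (G.ss v)"
      using la_add[of "G.ss v" "- (c + d)" d] G.ss_closed that(1) by simp
    ultimately show "src (c + d) (G.mu w (la d v)) = src c v" by (simp add: src_def)
    show "G.rr (G.mu w (la d v)) = G.rr w" using G.mu_facts(3) la_A that by simp
    show "G.rr v = src d w" using that la_rr la_minus(1) G.rr_closed by (simp add: src_def)
  qed
  show ?thesis
  proof (rule P_I[OF G.cob_set_product[OF W(1) cob_la[OF V(1)]]])
    show "g (f (j (src (c + d) u))) = j (G.rr u)" if u: "u \<in> G.set_product W (la d ` V)" for u
    proof -
      obtain v w where vw: "v \<in> V" "w \<in> W" "G.ss w = G.rr (la d v)" "u = G.mu w (la d v)"
        using u unfolding G.set_product_def by auto
      then have "v \<in> G.A" "w \<in> G.A" using VA WA by auto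
      note s = s[OF this vw(3)] m[OF this vw(3)]
      show ?thesis using V(3)[OF vw(1)] W(3)[OF vw(2)] vw(4) s by simp
    qed
    show "B = j ` src (c + d) ` G.set_product W (la d ` V)"
    proof -
      have "src c ` V = src (c + d) ` G.set_product W (la d ` V)"
      proof (intro equalityI subsetI)
        fix x assume "x \<in> src c ` V"
        then obtain v where v: "v \<in> V" "x = src c v" by auto
        then obtain w where w: "w \<in> W" "G.rr v = src d w" using rV by auto
        have A: "v \<in> G.A" "w \<in> G.A" using v w VA WA by auto
        then have "G.ss w = G.rr (la d v)" using w(2) la_rr la_minus(2) G.ss_closed by (simp add:
          src_def)
        then show "x \<in> src (c + d) ` G.set_product W (la d ` V)"
          using s(1)[OF A] v w unfolding G.set_product_def by (intro image_eqI[of _ _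
            "G.mu w (la d v)"]) auto
      next
        fix x assume "x \<in> src (c + d) ` G.set_product W (la d ` V)"
        then obtain v w where vw: "v \<in> V" "w \<in> W" "G.ss w = G.rr (la d v)"
          "x = src (c + d) (G.mu w (la d v))"
          unfolding G.set_product_def by auto
        then show "x \<in> src c ` V" using s(1)[of v w] VA WA by auto
      qed
      then show ?thesis using V(2) by simp
    qed
  qed
qed

text \<open>The inverse of the arrow (v, c) is the translate by \<open>la (- c)\<close> of the
  inverse of v, in degree - c.\<close>

lemma P_inverse:
  assumes "P c B f" "\<And>x. x \<in> B \<Longrightarrow> g (f x) = x"
  shows "P (- c) (f ` B) g"
proof -
  obtain V where V: "G.cob V" "B = j ` src c ` V" "\<And>v. v \<in> V \<Longrightarrow> f (j (src c v)) = j (G.rr v)"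
    using assms(1) unfolding P_def by auto
  have VA: "V \<subseteq> G.A" using G.cob_subset V(1) by auto
  have s: "src (- c) (la (- c) (G.iv v)) = G.rr v" "G.rr (la (- c) (G.iv v)) = src c v" if
    "v \<in> G.A" for v
  proof -
    show "src (- c) (la (- c) (G.iv v)) = G.rr v"
      using that G.iv_closed G.ss_iv la_ss la_minus(2)[of "G.rr v" c] G.rr_closed by (simp add:
        src_def)
    show "G.rr (la (- c) (G.iv v)) = src c v" using that G.iv_closed G.rr_iv la_rr by (simp add:
      src_def)
  qed
  show ?thesis
  proof (rule P_I[OF cob_la[OF G.cob_iv[OF V(1)], of "- c"]])
    show "g (j (src (- c) u)) = j (G.rr u)" if u: "u \<in> la (- c) ` G.iv ` V" for u
    proof -
      obtain v where v: "v \<in> V" "u = la (- c) (G.iv v)" using u by auto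
      have "g (f (j (src c v))) = j (src c v)" using assms(2) V(2) v(1) by auto
      then show ?thesis using s[of v] v V(3)[OF v(1)] VA by auto
    qed
    have "f ` B = (\<lambda>v. j (G.rr v)) ` V" unfolding V(2) image_image using V(3) by (intro
      image_cong) auto
    also have "\<dots> = j ` src (- c) ` la (- c) ` G.iv ` V"
      unfolding image_image using s(1) VA by (intro image_cong) auto
    finally show "f ` B = j ` src (- c) ` la (- c) ` G.iv ` V" .
  qed
qed

lemma P_inj:
  assumes "P c B f"
  shows "inj_on f B"
proof (rule inj_onI)
  obtain V where V: "G.cob V" "B = j ` src c ` V" "\<And>v. v \<in> V \<Longrightarrow> f (j (src c v)) = j (G.rr v)"
    using assms unfolding P_def by auto
  fix x y assume "x \<in> B" "y \<in> B" and f: "f x = f y"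
  then obtain v w where vw: "v \<in> V" "w \<in> V" "x = j (src c v)" "y = j (src c w)" using V(2) by auto
  then have "G.rr v = G.rr w" using f V(3) by simp
  then have "v = w" using V(1) vw(1,2) by (auto simp: G.cob_iff inj_on_def)
  then show "x = y" using vw by simp
qed

lemma semidirect_facts:
  assumes "v \<in> G.A"
  shows "grng H (v, c mod int p) = j (G.rr v)" "gsrc H (v, c mod int p) = j (src c v)"
  unfolding H_def j_def src_def
  using semidirect_grng[OF action G.groupoid_G assms mod_in_Zp[of c]]
    semidirect_gsrc[OF action G.groupoid_G assms mod_in_Zp[of c]] by (simp_all add: mod_minus_eq)

lemma gunits_H: "gunits H = X"
  using semidirect_gunits[OF action G.groupoid_G] by (auto simp: H_def X_def j_def)

lemma gtop_H: "gtop H = prod_topology G.T (discrete_topology (carrier Zp))"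
  by (simp add: H_def semidirect_def)

lemma arrows_H: "garrows H = G.A \<times> carrier Zp"
  by (simp add: gtop_H)

text \<open>Composing \<open>f\<close> with its inverse, read with the two degrees, presents the
  identity by a bisection of degree \<open>d - c\<close>. This is an open set of isotropy in
  \<open>H\<close>, so effectiveness of \<open>H\<close> places it in the unit space, where the
  degree is 0.\<close>

lemma P_unique:
  assumes "P c B f" "P d B f" "B \<noteq> {}"
  shows "int p dvd c - d"
proof -
  let ?g = "the_inv_into B f"
  have g: "?g (f x) = x" if "x \<in> B" for x using the_inv_into_f_f[OF P_inj[OF assms(1)] that] .
  have gB: "?g ` f ` B = B" using g by (force simp: image_iff)
  have "P (- c) (f ` B) ?g" by (rule P_inverse[OF assms(1) g])
  moreover have "P d (?g ` f ` B) f" using assms(2) gB by simp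
  ultimately have "P (- c + d) (f ` B) (\<lambda>x. f (?g x))" by (rule P_comp)
  then obtain V where V: "G.cob V" "f ` B = j ` src (- c + d) ` V"
    "\<And>v. v \<in> V \<Longrightarrow> f (?g (j (src (- c + d) v))) = j (G.rr v)" unfolding P_def by auto
  let ?e = "(- c + d) mod int p"
  have VA: "V \<subseteq> G.A" using G.cob_subset V(1) by auto
  have "V \<times> {?e} \<subseteq> isotropy H"
  proof
    fix u assume "u \<in> V \<times> {?e}"
    then obtain v where v: "v \<in> V" "u = (v, ?e)" by auto
    then have "j (src (- c + d) v) \<in> f ` B" using V(2) by auto
    then have "f (?g (j (src (- c + d) v))) = j (src (- c + d) v)" using g by auto
    then show "u \<in> isotropy H"
      using V(3)[OF v(1)] v VA semidirect_facts[of v "- c + d"] by (auto simp: isotropy_def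
        arrows_H)
  qed
  moreover have "openin (gtop H) (V \<times> {?e})"
    unfolding gtop_H openin_prod_Times_iff using V(1) by (simp add: G.cob_iff)
  ultimately have "V \<times> {?e} \<subseteq> gunits H"
    using effective_H interior_of_maximal unfolding effective_def H_def[symmetric] by metis
  moreover obtain v where "v \<in> V" using V(2) assms(3) by auto
  ultimately have "(v, ?e) \<in> j ` G.U0" unfolding gunits_H X_def by auto
  then have "?e = 0" by (auto simp: j_def)
  then have "int p dvd d - c" by (simp add: dvd_eq_mod_eq_0)
  then show ?thesis by (rule dvd_diff_commute[THEN iffD1])
qed

lemma src_cong: "int p dvd c - d \<Longrightarrow> src c v = src d v"
proof -
  assume "int p dvd c - d"
  then have "int p dvd (- d) - (- c)" by simp
  then have "(- c) mod int p = (- d) mod int p" by (metis mod_eq_dvd_iff)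
  then show ?thesis by (simp add: src_def)
qed

text \<open>Density of the orbit of \<open>x\<close> gives an arrow of \<open>G\<close> from
  \<open>x\<close> into \<open>B\<close>; a compact open bisection through this arrow defines
  \<open>f\<close>.\<close>

lemma P_minimal:
  assumes "x \<in> X" "B \<in> CL" "B \<noteq> {}"
  shows "\<exists>C f. x \<in> C \<and> P 0 C f \<and> f x \<in> B"
proof -
  obtain y where y: "x = j y" "y \<in> G.U0" using assms(1) by (auto simp: X_def)
  obtain B' where B': "B = j ` B'" "G.clop B'" "B' \<noteq> {}" using assms(2,3) by (auto simp: CL_def)
  then obtain b where b: "b \<in> B'" by auto
  have "b \<in> unit_top G closure_of (G.rr ` {g \<in> G.A. G.ss g = y})"
    using minimal_G y(2) b B'(2) unfolding minimal_groupoid_def by (auto simp: G.clop_def)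
  then obtain g where g: "g \<in> G.A" "G.ss g = y" "G.rr g \<in> B'"
    using b B'(2) unfolding in_closure_of G.clop_iff by auto
  have "openin G.T {h \<in> G.A. G.rr h \<in> B'}"
    using openin_continuous_map_preimage[OF G.cont_rr] B'(2) by (simp add: G.clop_def)
  from G.cob_base[OF _ this, of g] obtain V where V: "G.cob V" "g \<in> V" using g by auto
  let ?f = "\<lambda>y. j (G.rr (the_inv_into V G.ss (fst y)))"
  have VA: "V \<subseteq> G.A" using G.cob_subset[OF V(1)] .
  have s: "src 0 v = G.ss v" if "v \<in> V" for v using la_0 G.ss_closed VA that by (auto simp: src_def)
  have i: "the_inv_into V G.ss (G.ss v) = v" if "v \<in> V" for v
    using V(1) that by (simp add: the_inv_into_f_f G.cob_iff)
  have "P 0 (j ` src 0 ` V) ?f" by (rule P_I[OF V(1) refl]) (simp add: s i)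
  moreover have "x = j (src 0 g)" using s[OF V(2)] y g by simp
  moreover have "?f x \<in> B" using i[OF V(2)] y g B' by simp
  ultimately show ?thesis using V(2) by (intro exI[of _ "j ` src 0 ` V"] exI[of _ ?f]) simp
qed

sublocale M: graded_pseudogroup X CL p P L
proof -
  interpret boolean_space X CL by (rule boolean_X)
  show "graded_pseudogroup X CL p P L"
  proof
    show "prime p" by (rule prime_p)
    show "B \<in> CL" if "P c B f" for c B f
      using that clop_src unfolding P_def CL_def by auto
    show "f ` B \<in> CL" if P: "P c B f" for c B f
    proof -
      obtain V where V: "G.cob V" "B = j ` src c ` V" "\<And>v. v \<in> V \<Longrightarrow> f (j (src c v)) = j (G.rr v)"
        using P unfolding P_def by auto
      have "f ` B = j ` G.rr ` V" unfolding V(2) image_image using V(3) by (intro image_cong) auto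
      then show ?thesis using G.cob_rr[OF V(1)] by (auto simp: CL_def)
    qed
    show "inj_on f B" if "P c B f" for c B f using P_inj that .
    show "P c C f" if P: "P c B f" and C: "C \<in> CL" "C \<subseteq> B" for c B C f
    proof -
      obtain V where V: "G.cob V" "B = j ` src c ` V" "\<And>v. v \<in> V \<Longrightarrow> f (j (src c v)) = j (G.rr v)"
        using P unfolding P_def by auto
      have VA: "V \<subseteq> G.A" using G.cob_subset[OF V(1)] .
      obtain C' where C': "C = j ` C'" "G.clop C'" using C(1) by (auto simp: CL_def)
      have C'A: "C' \<subseteq> G.A" using C'(2) G.units_subset by (auto simp: G.clop_def)
      \<comment> \<open>Restricting the domain to \<open>C'\<close> amounts to restricting the
        sources in \<open>G\<close> to the translate of \<open>C'\<close>, because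
        \<open>src c\<close> differs from the source by \<open>la (- c)\<close>.\<close>
      have e: "src c v \<in> C' \<longleftrightarrow> G.ss v \<in> la c ` C'" if "v \<in> V" for v
      proof -
        have v: "v \<in> G.A" using that VA by auto
        have "src c v \<in> C' \<Longrightarrow> G.ss v \<in> la c ` C'"
          using la_minus(2)[OF G.ss_closed[OF v], of c] unfolding src_def by (metis imageI)
        moreover have "G.ss v \<in> la c ` C' \<Longrightarrow> src c v \<in> C'"
          using la_minus(1) C'A unfolding src_def by auto
        ultimately show ?thesis by blast
      qed
      let ?V = "{v \<in> V. G.ss v \<in> la c ` C'}"
      have "C' \<subseteq> src c ` V" using C(2) C'(1) V(2) by auto
      then have "C' = src c ` ?V" using e by auto
      then show ?thesis using G.cob_restrict[OF V(1) clop_la[OF C'(2)], of c] C'(1) V(3)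
        by (intro P_I[of ?V]) auto
    qed
    show "P c B g" if P: "P c B f" and g: "\<And>x. x \<in> B \<Longrightarrow> g x = f x" for c B f g
    proof -
      obtain V where V: "G.cob V" "B = j ` src c ` V" "\<And>v. v \<in> V \<Longrightarrow> f (j (src c v)) = j (G.rr v)"
        using P unfolding P_def by auto
      show ?thesis by (rule P_I[OF V(1,2)]) (use g V in auto)
    qed
    show "P (c + d) B (\<lambda>x. g (f x))" if "P c B f" "P d (f ` B) g" for c d B f g
      using P_comp[OF that] .
    show "P (- c) (f ` B) g" if "P c B f" "\<And>x. x \<in> B \<Longrightarrow> g (f x) = x" for c B f g
      using P_inverse[OF that] .
    have s0: "src c x = la (- c) x" if "x \<in> G.U0" for x c
      using that G.unit_ss by (simp add: src_def)
    show "P 0 B (\<lambda>x. x)" if B: "B \<in> CL" for B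
    proof -
      obtain B' where B': "B = j ` B'" "G.clop B'" using B by (auto simp: CL_def)
      have "src 0 x = x \<and> G.rr x = x" if "x \<in> B'" for x
        using that B'(2) s0[of x 0] la_0 G.units_iff[of x] by (auto simp: G.clop_def)
      then show ?thesis using B' G.cob_clop by (intro P_I[of B']) auto
    qed
    show "P c (B \<union> C) f" if P: "P c B f" "P c C f" and inj: "inj_on f (B \<union> C)" and dis:
      "B \<inter> C = {}" for c B C f
    proof -
      obtain V where V: "G.cob V" "B = j ` src c ` V" "\<And>v. v \<in> V \<Longrightarrow> f (j (src c v)) = j (G.rr v)"
        using P(1) unfolding P_def by auto
      obtain W where W: "G.cob W" "C = j ` src c ` W" "\<And>v. v \<in> W \<Longrightarrow> f (j (src c v)) = j (G.rr v)"
        using P(2) unfolding P_def by auto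
      have n: "src c v \<noteq> src c w" if "v \<in> V" "w \<in> W" for v w using dis that V(2) W(2) by auto
      have "G.ss v \<noteq> G.ss w" if "v \<in> V" "w \<in> W" for v w using n[OF that] by (auto simp: src_def)
      then have "G.ss ` V \<inter> G.ss ` W = {}" by auto
      moreover have "G.rr v \<noteq> G.rr w" if vw: "v \<in> V" "w \<in> W" for v w
      proof
        assume "G.rr v = G.rr w"
        then have "f (j (src c v)) = f (j (src c w))" using V(3) W(3) vw by simp
        moreover have "j (src c v) \<in> B \<union> C" "j (src c w) \<in> B \<union> C" using vw V(2) W(2) by auto
        ultimately have "j (src c v) = j (src c w)" using inj_onD[OF inj] by blast
        then show False using n[OF vw] by simp
      qed
      then have "G.rr ` V \<inter> G.rr ` W = {}" by auto
      ultimately have "G.cob (V \<union> W)" by (rule G.cob_Un[OF V(1) W(1)])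
      then show ?thesis using V W by (intro P_I[of "V \<union> W"]) auto
    qed
    show "P d B f" if "P c B f" "int p dvd c - d" for c d B f
      using that(1) src_cong[OF that(2)] unfolding P_def by simp
    show "int p dvd c - d" if "P c B f" "P d B f" "B \<noteq> {}" for c d B f
      using P_unique[OF that] .
    show "\<exists>C f. x \<in> C \<and> P 0 C f \<and> f x \<in> B" if "x \<in> X" "B \<in> CL" "B \<noteq> {}" for x B
      using P_minimal[OF that] .
    have LX: "L a (j x) = j (la a x)" if "x \<in> G.U0" for a x using that by (simp add: L_def X_def)
      (simp add: j_def)
    have U0A: "x \<in> G.A" if "x \<in> G.U0" for x using that G.units_subset by auto
    have surj: "la a ` G.U0 = G.U0" for a
    proof
      show "G.U0 \<subseteq> la a ` G.U0"
      proof
        fix x assume x: "x \<in> G.U0"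
        then show "x \<in> la a ` G.U0" using la_minus(2)[OF U0A[OF x], of a] la_unit[OF x, of "- a"]
          by (metis imageI)
      qed
    qed (use la_unit in auto)
    show "P a X (L a)" for a
    proof (rule P_I[OF G.cob_clop[OF G.clop_U0]])
      have "src a ` G.U0 = la (- a) ` G.U0" using s0 by (intro image_cong) auto
      then show "X = j ` src a ` G.U0" using surj[of "- a"] by (simp add: X_def)
      show "L a (j (src a v)) = j (G.rr v)" if v: "v \<in> G.U0" for v
        using LX[OF la_unit[OF v]] s0[OF v] la_minus(2)[OF U0A[OF v]] G.units_iff v by auto
    qed
    show "L a \<in> extensional X" for a by (simp add: L_def)
    show "L a ` X = X" for a
    proof -
      have "L a ` X = j ` la a ` G.U0" unfolding X_def image_image using LX by (intro image_cong)
        auto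
      then show ?thesis using surj by (simp add: X_def)
    qed
    fix x a assume "x \<in> X"
    then obtain y where y: "x = j y" "y \<in> G.U0" by (auto simp: X_def)
    note yA = U0A[OF y(2)]
    show "L (a + b) x = L a (L b x)" for b
      using y LX la_unit la_add[OF yA] by simp
    show "L 0 x = x" using y LX la_0[OF yA] by simp
    show "int p dvd a" if "L a x = x"
    proof -
      have "la a y = y" using that y LX by simp
      then have "a mod int p = 0"
        using free y(2) unfolding free_on_units_def by (metis mod_in_Zp one_integer_mod_group)
      then show ?thesis by (simp add: dvd_eq_mod_eq_0)
    qed
    show "L a x = x" if "int p dvd a"
    proof -
      have "a mod int p = 0 mod int p" using that by (simp add: dvd_eq_mod_eq_0)
      then show ?thesis using y LX la_0[OF yA] by simp
    qed
  qed
qed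

end

section \<open>The groupoid structure of the semidirect product and its full group\<close>

context semidirect_setting
begin

lemma mult_H:
  assumes "a \<in> carrier Zp" "b \<in> carrier Zp"
  shows "gmult H (g, a) (h, b) = (G.mu g (la a h), (a + b) mod int p)"
  using mod_Zp[OF assms(1)] by (simp add: H_def semidirect_def)

lemma inv_H:
  assumes "a \<in> carrier Zp"
  shows "ginv H (g, a) = (la (- a) (G.iv g), (- a) mod int p)"
  using assms by (simp add: H_def semidirect_def Let_def)

lemma rng_H: "\<lbrakk>g \<in> G.A; a \<in> carrier Zp\<rbrakk> \<Longrightarrow> grng H (g, a) = j (G.rr g)"
  and src_H: "\<lbrakk>g \<in> G.A; a \<in> carrier Zp\<rbrakk> \<Longrightarrow> gsrc H (g, a) = j (src a g)"
  using semidirect_facts[of g a] by (simp_all add: mod_Zp)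

lemma composable_H:
  assumes "g \<in> G.A" "h \<in> G.A" "a \<in> carrier Zp" "b \<in> carrier Zp" "gsrc H (g, a) = grng H (h, b)"
  shows "G.ss g = G.rr (la a h)"
proof -
  have "la (- a) (G.ss g) = G.rr h" using assms rng_H src_H by (simp add: src_def)
  then show ?thesis using la_minus(2)[OF G.ss_closed[OF assms(1)], of a] la_rr[OF assms(2)] by simp
qed

lemma groupoid_H: "groupoid H"
  unfolding groupoid_def
proof (intro conjI ballI allI impI)
  fix u assume "u \<in> garrows H"
  then obtain g a where u: "u = (g, a)" "g \<in> G.A" "a \<in> carrier Zp" by (auto simp: arrows_H)
  have i: "ginv H u = (la (- a) (G.iv g), (- a) mod int p)" using inv_H u by simp
  show "ginv H u \<in> garrows H" unfolding i using u la_A G.iv_closed by (simp add: arrows_H)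
  have "ginv H (ginv H u) = (la (- ((- a) mod int p)) (G.iv (la (- a) (G.iv g))), (- ((- a) mod
    int p)) mod int p)"
    unfolding i by (rule inv_H) simp
  also have "\<dots> = (la a (la (- a) g), a)"
    using u mod_Zp[OF u(3)] la_iv[OF G.iv_closed[OF u(2)]] G.iv_iv by (simp add: mod_minus_eq)
  finally show "ginv H (ginv H u) = u" using u la_minus(2) by simp
next
  fix u assume "u \<in> composable H"
  then obtain g a h b where u: "u = ((g, a), (h, b))" "g \<in> G.A" "a \<in> carrier Zp" "h \<in> G.A"
    "b \<in> carrier Zp"
    "gsrc H (g, a) = grng H (h, b)" by (auto simp: composable_def arrows_H)
  have c: "G.ss g = G.rr (la a h)" using composable_H u by simp
  have A: "la a h \<in> G.A" using la_A u by simp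
  note m = G.mu_facts[OF u(2) A c]
  have e: "gmult H (g, a) (h, b) = (G.mu g (la a h), (a + b) mod int p)" using mult_H u by simp
  have 1: "gmult H (g, a) (h, b) \<in> garrows H" unfolding e using m(1) by (simp add: arrows_H)
  have "src ((a + b) mod int p) (G.mu g (la a h)) = la (- (a + b)) (la a (G.ss h))"
    using m(2) la_ss[OF u(4)] by (simp add: src_def mod_minus_eq)
  also have "\<dots> = src b h" using la_add[OF G.ss_closed[OF u(4)], of "- (a + b)" a] by (simp add:
    src_def)
  finally have 2: "gsrc H (gmult H (g, a) (h, b)) = gsrc H (h, b)"
    unfolding e using src_H[OF m(1) mod_in_Zp[of "a + b"]] src_H[OF u(4,5)] by simp
  have 3: "grng H (gmult H (g, a) (h, b)) = grng H (g, a)"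
    unfolding e using rng_H[OF m(1) mod_in_Zp[of "a + b"]] rng_H[OF u(2,3)] m(3) by simp
  have ig: "ginv H (g, a) = (la (- a) (G.iv g), (- a) mod int p)" using inv_H u by simp
  have "gmult H (ginv H (g, a)) (gmult H (g, a) (h, b)) =
      (G.mu (la (- a) (G.iv g)) (la (- a) (G.mu g (la a h))), (- a + (a + b)) mod int p)"
    unfolding e ig by (subst mult_H) (simp_all add: mod_add_eq)
  also have "G.mu (la (- a) (G.iv g)) (la (- a) (G.mu g (la a h))) = la (- a) (G.mu (G.iv g) (G.mu
    g (la a h)))"
    using la_mu[OF G.iv_closed[OF u(2)] m(1)] G.ss_iv[OF u(2)] m(3) by simp
  also have "\<dots> = h" using m(4) la_minus(1)[OF u(4)] by simp
  finally have 4: "gmult H (ginv H (g, a)) (gmult H (g, a) (h, b)) = (h, b)" using mod_Zp[OF u(5)]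
    by simp
  have ih: "ginv H (h, b) = (la (- b) (G.iv h), (- b) mod int p)" using inv_H u by simp
  have "la (a + b) (la (- b) (G.iv h)) = G.iv (la a h)"
    using la_add[OF G.iv_closed[OF u(4)], of "a + b" "- b"] la_iv[OF u(4)] by simp
  then have "gmult H (gmult H (g, a) (h, b)) (ginv H (h, b)) = (G.mu (G.mu g (la a h)) (G.iv (la a
    h)), (a + b + - b) mod int p)"
    unfolding e ih by (subst mult_H) (simp_all add: mod_add_eq mod_diff_left_eq mod_diff_right_eq)
  then have 5: "gmult H (gmult H (g, a) (h, b)) (ginv H (h, b)) = (g, a)"
    using m(5) mod_Zp[OF u(3)] by simp
  show "case u of (g, h) \<Rightarrow> gmult H g h \<in> garrows H \<and> gsrc H (gmult H g h) = gsrc H h \<and>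
    grng H (gmult H g h) = grng H g \<and> gmult H (ginv H g) (gmult H g h) = h \<and> gmult H (gmult H g h)
      (ginv H h) = g"
    using 1 2 3 4 5 u(1) by simp
next
  fix x y z assume "(x, y) \<in> composable H \<and> (y, z) \<in> composable H"
  then obtain g a h b k c where u: "x = (g, a)" "y = (h, b)" "z = (k, c)" "g \<in> G.A" "a \<in> carrier Zp"
    "h \<in> G.A" "b \<in> carrier Zp" "k \<in> G.A" "c \<in> carrier Zp"
    "gsrc H (g, a) = grng H (h, b)" "gsrc H (h, b) = grng H (k, c)" by (auto simp: composable_def
      arrows_H)
  have c1: "G.ss g = G.rr (la a h)" and c2: "G.ss h = G.rr (la b k)" using composable_H u by auto
  have A: "la a h \<in> G.A" "la b k \<in> G.A" using la_A u by auto
  have "la a (G.ss h) = la a (G.rr (la b k))" using c2 by simp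
  then have c3: "G.ss (la a h) = G.rr (la a (la b k))" using la_ss[OF u(6)] la_rr[OF A(2)] by simp
  have 1: "G.mu (G.mu g (la a h)) (la (a + b) k) = G.mu g (la a (G.mu h (la b k)))"
    using G.mu_assoc[OF u(4) A(1) la_A[OF A(2)] c1 c3] la_mu[OF u(6) A(2) c2] la_add[OF u(8)] by
      simp
  have "gmult H (gmult H x y) z = (G.mu (G.mu g (la a h)) (la (a + b) k), (a + b + c) mod int p)"
    unfolding u(1,2,3) mult_H[OF u(5,7)] by (subst mult_H) (simp_all add: u mod_add_left_eq)
  moreover have "gmult H x (gmult H y z) = (G.mu g (la a (G.mu h (la b k))), (a + (b + c)) mod int
    p)"
    unfolding u(1,2,3) mult_H[OF u(7,9)] by (subst mult_H) (simp_all add: u mod_add_right_eq)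
  ultimately show "gmult H (gmult H x y) z = gmult H x (gmult H y z)" using 1 by (simp add:
    add.assoc)
qed

sublocale Hg: abstract_groupoid H
  by unfold_locales (rule groupoid_H)

text \<open>As a space \<open>H\<close> is a disjoint union of \<open>p\<close> clopen copies of
  \<open>G\<close>; slices reduce questions about its bisections to \<open>G\<close>.\<close>

definition slice :: "('g \<times> int) set \<Rightarrow> int \<Rightarrow> 'g set" where
  "slice U c = {g. (g, c) \<in> U}"

lemma slice_open: "openin (gtop H) U \<Longrightarrow> openin G.T (slice U c)"
proof (cases "c \<in> carrier Zp")
  case True
  assume U: "openin (gtop H) U"
  have "continuous_map G.T (gtop H) (\<lambda>g. (g, c))"
    unfolding gtop_H using True by (intro continuous_map_pairedI) auto
  from openin_continuous_map_preimage[OF this U]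
  have "openin G.T {g \<in> G.A. (g, c) \<in> U}" .
  moreover have "{g \<in> G.A. (g, c) \<in> U} = slice U c"
    using openin_subset[OF U] unfolding slice_def arrows_H by auto
  ultimately show ?thesis by simp
next
  case False
  assume U: "openin (gtop H) U"
  then have "slice U c = {}" using openin_subset[OF U] False unfolding slice_def arrows_H by auto
  then show ?thesis by simp
qed

lemma slice_compact:
  assumes U: "compactin (gtop H) U"
  shows "compactin G.T (slice U c)"
proof -
  have "closedin (gtop H) (G.A \<times> ({c} \<inter> carrier Zp))"
    unfolding gtop_H closedin_prod_Times_iff by simp
  then have "compactin (gtop H) (U \<inter> G.A \<times> ({c} \<inter> carrier Zp))" using U by (simp add:
    compact_Int_closedin)
  then have "compactin G.T (fst ` (U \<inter> G.A \<times> ({c} \<inter> carrier Zp)))"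
    by (rule image_compactin) (simp add: gtop_H continuous_map_fst)
  moreover have "U \<subseteq> G.A \<times> carrier Zp" using compactin_subset_topspace[OF U] arrows_H by simp
  then have "fst ` (U \<inter> G.A \<times> ({c} \<inter> carrier Zp)) = slice U c" unfolding slice_def by force
  ultimately show ?thesis by simp
qed

abbreviation "cobH \<equiv> compact_open_bisection H"

lemma cobH_iff: "cobH U \<longleftrightarrow> openin (gtop H) U \<and> compactin (gtop H) U \<and> inj_on (grng H) U \<and> inj_on
  (gsrc H) U"
  unfolding compact_open_bisection_def bisection_def using openin_subset by blast

lemma slice_cob:
  assumes U: "cobH U" and c: "c \<in> carrier Zp"
  shows "G.cob (slice U c)"
proof -
  have UA: "U \<subseteq> G.A \<times> carrier Zp" using U openin_subset unfolding cobH_iff arrows_H[symmetric] by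
    blast
  have "inj_on G.rr (slice U c)"
  proof (rule inj_onI)
    fix g h assume "g \<in> slice U c" "h \<in> slice U c" and e: "G.rr g = G.rr h"
    then have gh: "(g, c) \<in> U" "(h, c) \<in> U" "g \<in> G.A" "h \<in> G.A" using UA by (auto simp: slice_def)
    then have "grng H (g, c) = grng H (h, c)" using rng_H c e by simp
    then have "(g, c) = (h, c)" using U gh unfolding cobH_iff inj_on_def by blast
    then show "g = h" by simp
  qed
  moreover have "inj_on G.ss (slice U c)"
  proof (rule inj_onI)
    fix g h assume "g \<in> slice U c" "h \<in> slice U c" and e: "G.ss g = G.ss h"
    then have gh: "(g, c) \<in> U" "(h, c) \<in> U" "g \<in> G.A" "h \<in> G.A" using UA by (auto simp: slice_def)
    then have "gsrc H (g, c) = gsrc H (h, c)" using src_H c e by (simp add: src_def)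
    then have "(g, c) = (h, c)" using U gh unfolding cobH_iff inj_on_def by blast
    then show "g = h" by simp
  qed
  ultimately show ?thesis using U slice_open slice_compact by (simp add: cobH_iff G.cob_iff)
qed

text \<open>A compact open bisection of \<open>H\<close> is the union of its finitely many slices,
  and on each of them the degree is constant.\<close>

lemma cobH_Q:
  assumes U: "cobH U" and f: "\<And>u. u \<in> U \<Longrightarrow> f (gsrc H u) = grng H u"
  shows "M.Q (gsrc H ` U) f"
proof -
  have UA: "U \<subseteq> G.A \<times> carrier Zp" using U openin_subset unfolding cobH_iff arrows_H[symmetric] by
    blast
  have P: "P c (gsrc H ` (slice U c \<times> {c})) f" if c: "c \<in> carrier Zp" for c
  proof (rule P_I[OF slice_cob[OF U c]])
    have "v \<in> G.A" if "v \<in> slice U c" for v using UA that by (auto simp: slice_def)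
    then show "gsrc H ` (slice U c \<times> {c}) = j ` src c ` slice U c" using src_H c by (force simp:
      image_iff)
    fix v assume v: "v \<in> slice U c"
    then have "(v, c) \<in> U" "v \<in> G.A" using UA by (auto simp: slice_def)
    then show "f (j (src c v)) = j (G.rr v)" using f[of "(v, c)"] src_H rng_H c by simp
  qed
  have U_eq: "gsrc H ` U = \<Union>((\<lambda>c. gsrc H ` (slice U c \<times> {c})) ` carrier Zp)"
    using UA by (force simp: slice_def image_iff)
  have "gsrc H ` U \<in> CL"
    unfolding U_eq by (rule M.CL_Union) (use M.P_clopen[OF P] carrier_Zp in auto)
  moreover have "inj_on f (gsrc H ` U)"
    using U f unfolding cobH_iff inj_on_def by auto
  moreover have "\<exists>c. M.deg_at c f x" if x: "x \<in> gsrc H ` U" for x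
  proof -
    obtain c where c: "c \<in> carrier Zp" "x \<in> gsrc H ` (slice U c \<times> {c})" using x U_eq by blast
    then show ?thesis using M.P_imp_deg_at[OF P[OF c(1)] c(2)] by blast
  qed
  ultimately show ?thesis by (simp add: M.Q_def)
qed

lemma P_cobH:
  assumes "P c B f"
  shows "\<exists>U. cobH U \<and> gsrc H ` U = B \<and> (\<forall>u \<in> U. f (gsrc H u) = grng H u)"
proof -
  obtain V where V: "G.cob V" "B = j ` src c ` V" "\<And>v. v \<in> V \<Longrightarrow> f (j (src c v)) = j (G.rr v)"
    using assms unfolding P_def by auto
  have VA: "V \<subseteq> G.A" using G.cob_subset[OF V(1)] .
  let ?U = "V \<times> {c mod int p}"
  have r: "grng H (v, c mod int p) = j (G.rr v)" "gsrc H (v, c mod int p) = j (src c v)" if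
    "v \<in> V" for v
    using semidirect_facts VA that by auto
  have "openin (gtop H) ?U" "compactin (gtop H) ?U"
    using V(1) unfolding gtop_H openin_prod_Times_iff compactin_Times by (auto simp: G.cob_iff)
  moreover have "inj_on (grng H) ?U"
    using V(1) r unfolding G.cob_iff inj_on_def by auto
  moreover have "inj_on (gsrc H) ?U"
    using V(1) r src_inj VA unfolding G.cob_iff inj_on_def by (auto simp: subset_iff)
  ultimately have "cobH ?U" by (simp add: cobH_iff)
  moreover have "gsrc H ` ?U = B" unfolding V(2) using r by (force simp: image_iff)
  moreover have "\<forall>u \<in> ?U. f (gsrc H u) = grng H u" using r V(3) by auto
  ultimately show ?thesis by blast
qed

text \<open>Locally \<open>P_cobH\<close> provides a bisection. Over disjoint domains these can be
  united: sources are then disjoint, and so are ranges because \<open>f\<close> is injective on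
  \<open>B\<close>.\<close>

lemma Q_cobH:
  assumes Q: "M.Q B f"
  shows "\<exists>U. cobH U \<and> gsrc H ` U = B \<and> (\<forall>u \<in> U. f (gsrc H u) = grng H u)"
proof -
  define R where "R N \<longleftrightarrow> (\<forall>C \<in> CL. C \<subseteq> N \<longrightarrow> (\<exists>U. cobH U \<and> gsrc H ` U = C \<and>
    (\<forall>u \<in> U. f (gsrc H u) = grng H u)))" for N
  have "R B" using M.Q_clopen[OF Q]
  proof (induction rule: M.clopen_induct)
    case empty
    have "cobH {}" by (simp add: cobH_iff)
    then show ?case unfolding R_def by (auto intro!: exI[of _ "{}"])
  next
    case (local x)
    then obtain c where "M.deg_at c f x" using M.Q_deg_at[OF Q] by blast
    from M.deg_at_nbhd[OF this M.Q_clopen[OF Q] local]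
    obtain N where N: "x \<in> N" "N \<subseteq> B" "N \<in> CL" "P c N f" by blast
    have "R N" unfolding R_def using P_cobH M.P_restrict[OF N(4)] by blast
    then show ?case using N by blast
  next
    case (mono C D)
    then show ?case unfolding R_def by auto
  next
    case (union C D)
    show ?case unfolding R_def
    proof (intro ballI impI)
      fix S assume S: "S \<in> CL" "S \<subseteq> C \<union> D"
      have SC: "S \<inter> C \<in> CL" "S \<inter> D \<in> CL" using M.CL_Int S(1) union by auto
      obtain U where U: "cobH U" "gsrc H ` U = S \<inter> C" "\<forall>u \<in> U. f (gsrc H u) = grng H u"
        using union(6) SC(1) unfolding R_def by blast
      obtain W where W: "cobH W" "gsrc H ` W = S \<inter> D" "\<forall>u \<in> W. f (gsrc H u) = grng H u"
        using union(7) SC(2) unfolding R_def by blast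
      have "(S \<inter> C) \<inter> (S \<inter> D) = {}" using union by auto
      then have inj: "inj_on (gsrc H) (U \<union> W)"
        using U(1,2) W(1,2) unfolding cobH_iff inj_on_Un by blast
      have im: "gsrc H ` (U \<union> W) = S" unfolding image_Un U(2) W(2) using S(2) by blast
      have ff: "\<forall>u \<in> U \<union> W. f (gsrc H u) = grng H u" using U(3) W(3) by auto
      have "inj_on f S" using M.Q_inj[OF Q] S(2) union by (auto intro: inj_on_subset)
      then have "inj_on (f \<circ> gsrc H) (U \<union> W)" using comp_inj_on[OF inj] im by simp
      then have "inj_on (grng H) (U \<union> W)" using inj_on_cong[of "U \<union> W" "f \<circ> gsrc H" "grng H"] ff
        by simp
      then have "cobH (U \<union> W)"
        using U(1) W(1) inj compactin_Un[of "gtop H" U W] unfolding cobH_iff by auto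
      then show "\<exists>U. cobH U \<and> gsrc H ` U = S \<and> (\<forall>u \<in> U. f (gsrc H u) = grng H u)"
        using im ff by blast
    qed
  qed
  then show ?thesis unfolding R_def using M.Q_clopen[OF Q] by blast
qed

lemma carrier_full_group_H: "carrier (full_group H) = M.F"
proof
  show "carrier (full_group H) \<subseteq> M.F"
  proof
    fix f assume "f \<in> carrier (full_group H)"
    then obtain U where U: "full_bisection H U" "f = bisection_map H U" unfolding full_group_def
      by auto
    have c: "cobH U" "gsrc H ` U = X" "grng H ` U = X" using U(1) by (auto simp:
      full_bisection_def gunits_H)
    have f: "f (gsrc H u) = grng H u" if "u \<in> U" for u
    proof -
      have "gsrc H u \<in> X" "the_inv_into U (gsrc H) (gsrc H u) = u"
        using c that by (auto simp: cobH_iff the_inv_into_f_f)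
      then show ?thesis unfolding U(2) bisection_map_def gunits_H by simp
    qed
    have Q: "M.Q X f" using cobH_Q[OF c(1) f] c(2) by simp
    have "f ` X = grng H ` U" unfolding c(2)[symmetric] image_image using f by (intro image_cong)
      auto
    then have "bij_betw f X X" using M.Q_inj[OF Q] c(3) by (simp add: bij_betw_def)
    moreover have "f \<in> extensional X" unfolding U(2) bisection_map_def gunits_H by simp
    ultimately show "f \<in> M.F" using M.Q_deg_at[OF Q] by (simp add: M.F_def)
  qed
  show "M.F \<subseteq> carrier (full_group H)"
  proof
    fix f assume f: "f \<in> M.F"
    obtain U where U: "cobH U" "gsrc H ` U = X" "\<forall>u \<in> U. f (gsrc H u) = grng H u"
      using Q_cobH[OF M.F_Q[OF f M.CL_X]] by blast
    have bij: "bij_betw f X X" "f \<in> extensional X" using f by (auto simp: M.F_def)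
    have "grng H ` U = f ` gsrc H ` U" unfolding image_image using U(3) by (intro image_cong) auto
    then have "grng H ` U = X" using U(2) bij(1) by (simp add: bij_betw_def)
    then have fb: "full_bisection H U" using U by (simp add: full_bisection_def gunits_H)
    have "f = bisection_map H U"
    proof (rule extensionalityI[OF bij(2)])
      show "bisection_map H U \<in> extensional X" unfolding bisection_map_def gunits_H by simp
      fix x assume x: "x \<in> X"
      then have "x \<in> gsrc H ` U" using U(2) by simp
      then obtain u where u: "u \<in> U" "x = gsrc H u" by blast
      then have "the_inv_into U (gsrc H) x = u" using U(1) by (simp add: cobH_iff the_inv_into_f_f)
      then show "f x = bisection_map H U x" using U(3) u x unfolding bisection_map_def gunits_H by
        simp
    qed
    then show "f \<in> carrier (full_group H)" using fb unfolding full_group_def by auto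
  qed
qed

lemma full_group_H: "full_group H = M.FG"
proof -
  have "full_group H = BijGroup X\<lparr>carrier := carrier (full_group H)\<rparr>"
    by (simp add: full_group_def gunits_H)
  then show ?thesis by (simp add: carrier_full_group_H M.FG_def)
qed

section \<open>The inclusion of the full group of \<open>G\<close>\<close>

abbreviation "\<iota> \<equiv> lift_units p G lam"

lemma iota_eq: "\<iota> f = (\<lambda>y\<in>X. (f (fst y), snd y))"
  using gunits_H by (simp add: lift_units_def H_def)

lemma iota_j: "x \<in> G.U0 \<Longrightarrow> \<iota> f (j x) = j (f x)"
  by (simp add: iota_eq X_def) (simp add: j_def)

lemma src_0: "v \<in> G.A \<Longrightarrow> src 0 v = G.ss v"
  using la_0 G.ss_closed by (simp add: src_def)

text \<open>Membership in \<open>F0\<close> is a condition at each point; \<open>P_iff\<close> glues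
  it to one bisection of degree 0 over the whole unit space, that is, to a full bisection of
  \<open>G\<close>.\<close>

lemma iota_full_group: "\<iota> ` carrier (full_group G) = M.F0"
proof
  show "\<iota> ` carrier (full_group G) \<subseteq> M.F0"
  proof
    fix f assume "f \<in> \<iota> ` carrier (full_group G)"
    then obtain V where V: "full_bisection G V" "f = \<iota> (bisection_map G V)" unfolding
      full_group_def by auto
    have c: "G.cob V" "G.ss ` V = G.U0" "G.rr ` V = G.U0" using V(1) by (auto simp:
      full_bisection_def)
    have VA: "V \<subseteq> G.A" using G.cob_subset[OF c(1)] .
    have f: "f (j (src 0 v)) = j (G.rr v)" if "v \<in> V" for v
    proof -
      have "G.ss v \<in> G.U0" "the_inv_into V G.ss (G.ss v) = v"
        using c that by (auto simp: G.cob_iff the_inv_into_f_f)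
      then show ?thesis using that VA src_0[of v] by (auto simp: V(2) iota_j bisection_map_def)
    qed
    have s: "src 0 ` V = G.U0" using src_0 VA c(2) by (metis (no_types, lifting) image_cong subsetD)
    have P: "P 0 X f" by (rule P_I[OF c(1) _ f]) (simp add: s X_def)
    have "f ` X = j ` G.rr ` V" unfolding X_def s[symmetric] image_image using f by (intro
      image_cong) auto
    then have "bij_betw f X X" using P_inj[OF P] c(3) by (simp add: bij_betw_def X_def)
    moreover have "f \<in> extensional X" unfolding V(2) iota_eq by simp
    ultimately show "f \<in> M.F0" using M.P_imp_deg_at[OF P] by (auto simp: M.F_def M.F0_def)
  qed
  show "M.F0 \<subseteq> \<iota> ` carrier (full_group G)"
  proof
    fix f assume f: "f \<in> M.F0"
    then have bij: "bij_betw f X X" "f \<in> extensional X" by (auto simp: M.F_def M.F0_def)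
    have "X \<in> CL \<and> inj_on f X \<and> (\<forall>x \<in> X. M.deg_at 0 f x)"
      using f bij(1) by (auto simp: M.F0_def bij_betw_def)
    then have "P 0 X f" by (rule M.P_iff[THEN iffD2])
    then obtain V where V: "G.cob V" "X = j ` src 0 ` V" "\<And>v. v \<in> V \<Longrightarrow> f (j (src 0 v)) = j (G.rr v)"
      unfolding P_def by auto
    have VA: "V \<subseteq> G.A" using G.cob_subset[OF V(1)] .
    have s: "src 0 ` V = G.U0" using V(2) by (simp add: X_def j_image_eq)
    have ss: "G.ss ` V = G.U0" using src_0 VA s by (metis (no_types, lifting) image_cong subsetD)
    have "f ` X = j ` G.rr ` V" unfolding X_def s[symmetric] image_image using V(3) by (intro
      image_cong) auto
    then have "G.rr ` V = G.U0" using bij(1) by (simp add: bij_betw_def X_def j_image_eq)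
    then have "full_bisection G V" using V(1) ss by (simp add: full_bisection_def)
    moreover have "f = \<iota> (bisection_map G V)"
    proof (rule extensionalityI[OF bij(2)])
      show "\<iota> (bisection_map G V) \<in> extensional X" unfolding iota_eq by simp
      fix x assume "x \<in> X"
      then obtain v where v: "v \<in> V" "x = j (src 0 v)" using V(2) by auto
      have "G.ss v \<in> G.U0" "the_inv_into V G.ss (G.ss v) = v"
        using ss V(1) v(1) by (auto simp: G.cob_iff the_inv_into_f_f)
      then show "f x = \<iota> (bisection_map G V) x"
        using V(3)[OF v(1)] v src_0[of v] VA by (auto simp: iota_j bisection_map_def)
    qed
    ultimately show "f \<in> \<iota> ` carrier (full_group G)" unfolding full_group_def by auto
  qed
qed

lemma clopen_unit_top_H:
  assumes "B \<in> CL"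
  shows "openin (unit_top H) B" "closedin (unit_top H) B"
proof -
  obtain B' where B': "B = j ` B'" "G.clop B'" using assms by (auto simp: CL_def)
  have e: "B = B' \<times> {0}" unfolding B'(1) by (auto simp: j_def)
  have BX: "B \<subseteq> gunits H" using M.CL_subset[OF assms] gunits_H by simp
  have "openin (gtop H) B" unfolding e gtop_H openin_prod_Times_iff using B'(2) by (simp add:
    G.clop_def)
  then show "openin (unit_top H) B" unfolding openin_subtopology using BX by blast
  have "closedin (gtop H) B" unfolding e gtop_H closedin_prod_Times_iff
    using G.compact_closed B'(2) by (simp add: G.clop_def)
  then show "closedin (unit_top H) B" unfolding closedin_subtopology using BX by blast
qed

lemma purely_infinite_paradoxical:
  assumes pi: "purely_infinite H"
  shows M.paradoxical
  unfolding M.paradoxical_def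
proof
  fix B assume B: "B \<in> CL"
  obtain U V where UV: "cobH U" "cobH V" "gsrc H ` U = B" "gsrc H ` V = B"
    "grng H ` U \<inter> grng H ` V = {}" "grng H ` U \<union> grng H ` V \<subseteq> B"
    using pi clopen_unit_top_H[OF B] unfolding purely_infinite_def by meson
  have ex: "\<exists>f. M.Q B f \<and> f ` B = grng H ` W" if W: "cobH W" "gsrc H ` W = B" for W
  proof -
    let ?f = "\<lambda>x. grng H (the_inv_into W (gsrc H) x)"
    have f: "?f (gsrc H w) = grng H w" if "w \<in> W" for w
      using W(1) that by (simp add: cobH_iff the_inv_into_f_f)
    have "M.Q B ?f" using cobH_Q[OF W(1) f] W(2) by simp
    moreover have "?f ` B = grng H ` W" unfolding W(2)[symmetric] image_image using f by (intro
      image_cong) auto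
    ultimately show ?thesis by blast
  qed
  obtain f where f: "M.Q B f" "f ` B = grng H ` U" using ex[OF UV(1,3)] by auto
  obtain g where g: "M.Q B g" "g ` B = grng H ` V" using ex[OF UV(2,4)] by auto
  show "\<exists>f g. M.Q B f \<and> M.Q B g \<and> f ` B \<subseteq> B \<and> g ` B \<subseteq> B \<and> f ` B \<inter> g ` B = {}"
    using f g UV(5,6) by (intro exI[of _ f] exI[of _ g]) auto
qed

end

context semidirect_setting
begin

subsection \<open>Almost finiteness\<close>

lemma compact_open_pieces:
  assumes S: "openin (gtop H) S" "compactin (gtop H) S"
  shows "\<exists>\<V>. finite \<V> \<and> (\<forall>(V, c) \<in> \<V>. G.cob V \<and> c \<in> carrier Zp) \<and> S = (\<Union>(V, c) \<in> \<V>. V \<times> {c})"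
proof -
  have "\<exists>\<W>. finite \<W> \<and> (\<forall>V \<in> \<W>. G.cob V \<and> V \<subseteq> slice S c) \<and> slice S c \<subseteq> \<Union>\<W>" for c
    using G.compact_cover_cob[OF slice_compact[OF S(2)] slice_open[OF S(1)] subset_refl] .
  then obtain \<W> where \<W>: "\<And>c. finite (\<W> c)" "\<And>c V. V \<in> \<W> c \<Longrightarrow> G.cob V \<and> V \<subseteq> slice S c"
    "\<And>c. slice S c \<subseteq> \<Union>(\<W> c)" by metis
  let ?\<V> = "\<Union>c \<in> carrier Zp. (\<lambda>V. (V, c)) ` \<W> c"
  have "finite ?\<V>" using \<W>(1) carrier_Zp by auto
  moreover have "\<forall>(V, c) \<in> ?\<V>. G.cob V \<and> c \<in> carrier Zp" using \<W>(2) by auto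
  moreover have "S = (\<Union>(V, c) \<in> ?\<V>. V \<times> {c})"
  proof (intro equalityI subsetI)
    fix u assume u: "u \<in> S"
    obtain g c where g: "u = (g, c)" by (cases u)
    have c: "c \<in> carrier Zp" using u g openin_subset[OF S(1)] arrows_H by auto
    have "g \<in> slice S c" using u g by (simp add: slice_def)
    then obtain V where "V \<in> \<W> c" "g \<in> V" using \<W>(3)[of c] by auto
    then show "u \<in> (\<Union>(V, c) \<in> ?\<V>. V \<times> {c})" using c g by auto
  next
    fix u assume "u \<in> (\<Union>(V, c) \<in> ?\<V>. V \<times> {c})"
    then obtain c V where "V \<in> \<W> c" "u \<in> V \<times> {c}" by auto
    then show "u \<in> S" using \<W>(2) by (force simp: slice_def)
  qed
  ultimately show ?thesis by blast
qed

text \<open>Each of finitely many bisections contributes at most one arrow. Finiteness is essential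
  for the counting below: \<open>card\<close> is 0 on infinite sets, so without it the estimate in
  \<open>almost_finite\<close> would bound nothing.\<close>

lemma finite_fibre:
  assumes S: "openin (gtop H) S" "compactin (gtop H) S"
  shows "finite {k \<in> S. gsrc H k = x}"
proof -
  obtain \<V> where \<V>: "finite \<V>" "\<And>V c. (V, c) \<in> \<V> \<Longrightarrow> G.cob V \<and> c \<in> carrier Zp"
    "S = (\<Union>(V, c) \<in> \<V>. V \<times> {c})" using compact_open_pieces[OF S] by blast
  have "finite {k \<in> V \<times> {c}. gsrc H k = x}" if "(V, c) \<in> \<V>" for V c
  proof -
    have V: "G.cob V" "c \<in> carrier Zp" using \<V>(2)[OF that] by auto
    have "k = k'" if k: "k \<in> {k \<in> V \<times> {c}. gsrc H k = x}" "k' \<in> {k \<in> V \<times> {c}. gsrc H k = x}" for k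
      k'
    proof -
      obtain v v' where v: "k = (v, c)" "k' = (v', c)" "v \<in> V" "v' \<in> V" using k by auto
      then have "v \<in> G.A" "v' \<in> G.A" using G.cob_subset[OF V(1)] by auto
      moreover have "gsrc H (v, c) = gsrc H (v', c)" using k v(1,2) by simp
      ultimately have "G.ss v = G.ss v'" using src_H[OF _ V(2)] src_inj by simp
      then show ?thesis using V(1) v unfolding G.cob_iff inj_on_def by auto
    qed
    then have "is_singleton {k \<in> V \<times> {c}. gsrc H k = x} \<or> {k \<in> V \<times> {c}. gsrc H k = x} = {}"
      by (meson is_singletonI')
    then show ?thesis by (elim disjE is_singletonE) (simp_all only: finite.emptyI finite_insert)
  qed
  then have "finite (\<Union>(V, c) \<in> \<V>. {k \<in> V \<times> {c}. gsrc H k = x})" using \<V>(1) by auto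
  moreover have "{k \<in> S. gsrc H k = x} \<subseteq> (\<Union>(V, c) \<in> \<V>. {k \<in> V \<times> {c}. gsrc H k = x})"
    unfolding \<V>(3) by auto
  ultimately show ?thesis by (rule rev_finite_subset)
qed

text \<open>A nonempty clopen remainder \<open>R\<close> is carried through the induction, so that
  the next set can be cut out of it with something left over.\<close>

lemma disjoint_clopens:
  "\<exists>B :: nat \<Rightarrow> ('g \<times> int) set. (\<forall>i < n. B i \<in> CL \<and> B i \<noteq> {}) \<and> (\<forall>i < n. \<forall>k < n. i \<noteq> k \<longrightarrow> B i \<inter> B k
    = {})"
proof -
  have "\<exists>B R. R \<in> CL \<and> R \<noteq> {} \<and> (\<forall>i < n. B i \<in> CL \<and> B i \<noteq> {} \<and> B i \<inter> R = {}) \<and>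
    (\<forall>i < n. \<forall>k < n. i \<noteq> k \<longrightarrow> B i \<inter> B k = ({} :: ('g \<times> int) set))"
  proof (induction n)
    case 0
    show ?case using M.CL_X M.X_nonempty by (intro exI[of _ "\<lambda>_. {}"] exI[of _ X]) auto
  next
    case (Suc n)
    then obtain B R where B: "R \<in> CL" "R \<noteq> {}" "\<forall>i < n. B i \<in> CL \<and> B i \<noteq> {} \<and> B i \<inter> R = {}"
      "\<forall>i < n. \<forall>k < n. i \<noteq> k \<longrightarrow> B i \<inter> B k = ({} :: ('g \<times> int) set)" by blast
    obtain r where r: "r \<in> R" using B(2) by auto
    obtain C where C: "C \<in> CL" "C \<noteq> {}" "C \<subseteq> R" "C \<inter> {r} = {}"
      using M.clopen_avoiding[OF B(1,2), of "{r}"] by auto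
    let ?B = "B(n := C)"
    have "\<forall>i < Suc n. ?B i \<in> CL \<and> ?B i \<noteq> {} \<and> ?B i \<inter> (R - C) = {}"
      using B(3) C by (auto simp: less_Suc_eq)
    moreover have "\<forall>i < Suc n. \<forall>k < Suc n. i \<noteq> k \<longrightarrow> ?B i \<inter> ?B k = {}"
    proof -
      have "B i \<inter> C = {}" if "i < n" for i using B(3) C(3) that by blast
      then show ?thesis using B(4) by (auto simp: less_Suc_eq Int_commute)
    qed
    moreover have "R - C \<in> CL" "R - C \<noteq> {}" using M.CL_Diff[OF B(1) C(1)] r C(4) by auto
    ultimately show ?case by blast
  qed
  then obtain B R where "\<forall>i < n. B i \<in> CL \<and> B i \<noteq> {} \<and> B i \<inter> R = {}"
    "\<forall>i < n. \<forall>k < n. i \<noteq> k \<longrightarrow> B i \<inter> B k = ({} :: ('g \<times> int) set)" by (elim exE conjE)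
  then show ?thesis by (intro exI[of _ B]) simp
qed

text \<open>Applied to many disjoint sets, this yields a compact set with many arrows starting at
  each unit, which forces the classes of a nearly invariant elementary subgroupoid to be
  large.\<close>

lemma arrows_into_clopen:
  assumes B: "B \<in> CL" "B \<noteq> {}"
  shows "\<exists>S. openin (gtop H) S \<and> compactin (gtop H) S \<and> (\<forall>x \<in> X. \<exists>u \<in> S. gsrc H u = x \<and> grng H u \<in>
    B)"
proof -
  define R where "R N \<longleftrightarrow> (\<exists>S. openin (gtop H) S \<and> compactin (gtop H) S \<and>
    (\<forall>x \<in> N. \<exists>u \<in> S. gsrc H u = x \<and> grng H u \<in> B))" for N
  have "R X" using M.CL_X
  proof (induction rule: M.clopen_induct)
    case empty
    then show ?case unfolding R_def by (auto intro: exI[of _ "{}"])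
  next
    case (local x)
    obtain C f where f: "x \<in> C" "P 0 C f" "f x \<in> B" using P_minimal[OF local B] by blast
    obtain U where U: "cobH U" "gsrc H ` U = C" "\<forall>u \<in> U. f (gsrc H u) = grng H u"
      using P_cobH[OF f(2)] by blast
    let ?N = "{y \<in> C. f y \<in> B}"
    have N: "?N \<in> CL" using M.P_preimage[OF f(2) B(1)] .
    have "\<exists>u \<in> U. gsrc H u = y \<and> grng H u \<in> B" if y: "y \<in> ?N" for y
    proof -
      obtain u where "u \<in> U" "y = gsrc H u" using y U(2) by blast
      then show ?thesis using U(3) y by auto
    qed
    then have "R ?N" unfolding R_def using U(1) by (auto simp: cobH_iff)
    then show ?case using N f M.CL_subset[OF N] by (intro bexI[of _ ?N]) auto
  next
    case (mono C D)
    then show ?case unfolding R_def by (meson subsetD)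
  next
    case (union C D)
    obtain S S' where "openin (gtop H) S" "compactin (gtop H) S"
      "\<forall>x \<in> C. \<exists>u \<in> S. gsrc H u = x \<and> grng H u \<in> B"
      "openin (gtop H) S'" "compactin (gtop H) S'" "\<forall>x \<in> D. \<exists>u \<in> S'. gsrc H u = x \<and> grng H u \<in> B"
      using union(6,7) unfolding R_def by blast
    then show ?case unfolding R_def
      by (intro exI[of _ "S \<union> S'"]) (simp add: openin_Un compactin_Un, blast)
  qed
  then show ?thesis unfolding R_def .
qed

lemma Hausdorff_H: "Hausdorff_space (gtop H)"
  unfolding gtop_H using G.Hausdorff_T by (simp add: Hausdorff_space_prod_topology)

lemma units_H_clopen: "openin (gtop H) X" "closedin (gtop H) X"
proof -
  have e: "X = G.U0 \<times> {0}" unfolding X_def by (auto simp: j_def)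
  show "openin (gtop H) X" "closedin (gtop H) X"
    unfolding e gtop_H openin_prod_Times_iff closedin_prod_Times_iff
    using G.units_open G.compact_closed[OF G.compact_U0] by auto
qed

text \<open>A single compact set contains the bisections of both elements and the arrows into the
  sets \<open>B i\<close>. The elementary subgroupoid for it and 1/10 therefore has large classes
  and is nearly invariant under both elements, as \<open>finite_relation\<close> requires.\<close>

lemma almost_finite_commute_mod:
  assumes af: "almost_finite H" and f1: "f1 \<in> M.F" and f2: "f2 \<in> M.F"
  shows "M.commute_mod f1 f2"
proof -
  have ex: "\<exists>U. cobH U \<and> gsrc H ` U = X \<and> (\<forall>u \<in> U. f (gsrc H u) = grng H u)" if "f \<in> M.F" for f
    using Q_cobH[OF M.F_Q[OF that M.CL_X]] .
  obtain U1 where U1: "cobH U1" "gsrc H ` U1 = X" "\<forall>u \<in> U1. f1 (gsrc H u) = grng H u" using ex[OF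
    f1] by auto
  obtain U2 where U2: "cobH U2" "gsrc H ` U2 = X" "\<forall>u \<in> U2. f2 (gsrc H u) = grng H u" using ex[OF
    f2] by auto
  \<comment> \<open>The forty sets \<open>B i\<close> make the classes of the elementary subgroupoid have at least 20 points, so that
    a swap moving at most two points of every class is small.\<close>
  obtain B :: "nat \<Rightarrow> ('g \<times> int) set" where B: "\<forall>i < 40. B i \<in> CL \<and> B i \<noteq> {}"
    "\<forall>i < 40. \<forall>k < 40. i \<noteq> k \<longrightarrow> B i \<inter> B k = {}" using disjoint_clopens[of 40] by auto
  have "\<forall>i < 40. \<exists>S. openin (gtop H) S \<and> compactin (gtop H) S \<and> (\<forall>x \<in> X. \<exists>u \<in> S. gsrc H u = x \<and>
    grng H u \<in> B i)"
    using arrows_into_clopen B(1) by simp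
  then obtain S where S: "\<forall>i < 40. openin (gtop H) (S i) \<and> compactin (gtop H) (S i) \<and>
    (\<forall>x \<in> X. \<exists>u \<in> S i. gsrc H u = x \<and> grng H u \<in> B i)" by metis
  let ?C = "U1 \<union> U2 \<union> (\<Union>i < (40::nat). S i)"
  have "compactin (gtop H) (\<Union>(S ` {..<40}))" by (rule compactin_Union) (use S in auto)
  then have Cc: "compactin (gtop H) ?C"
    using U1(1) U2(1) by (intro compactin_Un) (auto simp: cobH_iff)
  have Co: "openin (gtop H) ?C" using U1(1) U2(1) S by (intro openin_Un openin_Union) (auto simp:
    cobH_iff)
  have CA: "?C \<subseteq> garrows H" using openin_subset[OF Co] .
  obtain K where K: "elementary_subgroupoid H K"
    "\<forall>x \<in> gunits H. let Kx = {k \<in> K. gsrc H k = x};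
      CKx = {gmult H c k | c k. c \<in> ?C \<and> k \<in> Kx \<and> (c, k) \<in> composable H}
      in real (card (CKx - Kx)) / real (card Kx) < 1 / 10"
    using af[unfolded almost_finite_def, rule_format, of ?C "1 / 10"] Cc by auto
  have Ko: "openin (gtop H) K" and Kc: "compactin (gtop H) K" and sub: "subgroupoid H K"
    and pr: "principal (restrict_groupoid H K)" and un: "gunits (restrict_groupoid H K) = gunits H"
    using K(1) by (auto simp: elementary_subgroupoid_def)
  have KA: "K \<subseteq> garrows H" and K_inv: "\<And>k. k \<in> K \<Longrightarrow> ginv H k \<in> K"
    and K_mult: "\<And>k l. \<lbrakk>k \<in> K; l \<in> K; gsrc H k = grng H l\<rbrakk> \<Longrightarrow> gmult H k l \<in> K"
    using sub by (auto simp: subgroupoid_def composable_def subset_iff)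
  have rs: "grng (restrict_groupoid H K) = grng H" "gsrc (restrict_groupoid H K) = gsrc H"
    by (auto simp: restrict_groupoid_def grng_def gsrc_def fun_eq_iff)
  have "garrows (restrict_groupoid H K) = K" using KA by (auto simp: restrict_groupoid_def)
  then have iso: "{k \<in> K. grng H k = gsrc H k} = X"
    using pr un gunits_H by (simp add: principal_def isotropy_def rs)
  have X_K: "x \<in> K" "grng H x = x" "gsrc H x = x" if "x \<in> X" for x
  proof -
    show "x \<in> K" using iso that by auto
    have "x \<in> gunits H" using that gunits_H by simp
    then show "grng H x = x" "gsrc H x = x" using Hg.units_iff Hg.unit_ss by auto
  qed
  define E where "E = {(gsrc H k, grng H k) | k. k \<in> K}"
  define Kx where "Kx x = {k \<in> K. gsrc H k = x}" for x
  define CK where "CK x = {gmult H c k | c k. c \<in> ?C \<and> k \<in> Kx x \<and> (c, k) \<in> composable H}" for x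
  have E_cls: "E `` {x} = grng H ` Kx x" for x unfolding E_def Kx_def by auto
  \<comment> \<open>Two arrows of \<open>K\<close> with the same source and range differ by an
    isotropy arrow, which is a unit as \<open>K\<close> is principal. So classes may be counted as
    source fibres.\<close>
  have Kx_inj: "inj_on (grng H) (Kx x)" for x
  proof (rule inj_onI)
    fix k l assume k: "k \<in> Kx x" "l \<in> Kx x" "grng H k = grng H l"
    then have A: "k \<in> garrows H" "l \<in> garrows H" "k \<in> K" "l \<in> K" "gsrc H k = gsrc H l" using KA by
      (auto simp: Kx_def)
    have c: "gsrc H (ginv H l) = grng H k" using Hg.ss_iv A k(3) by simp
    note m = Hg.mu_facts[OF Hg.iv_closed[OF A(2)] A(1) c]
    have "gmult H (ginv H l) k \<in> {k \<in> K. grng H k = gsrc H k}"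
      using K_mult[OF K_inv[OF A(4)] A(3) c] m(2,3) Hg.rr_iv[OF A(2)] A(5) by simp
    then have "gmult H (ginv H l) k = grng H (gmult H (ginv H l) k)" using iso X_K by simp
    then have "gmult H (ginv H l) k = grng H (ginv H l)" using m(3) by simp
    from Hg.iv_unique[OF Hg.iv_closed[OF A(2)] A(1) c this] show "k = l" using Hg.iv_iv A by simp
  qed
  have Kx_fin: "finite (Kx x)" for x unfolding Kx_def by (rule finite_fibre[OF Ko Kc])
  have card_cls: "card (E `` {x}) = card (Kx x)" for x unfolding E_cls by (rule card_image[OF
    Kx_inj])
  have CK_fin: "finite (CK x)" for x
  proof -
    have "CK x \<subseteq> (\<Union>k \<in> Kx x. (\<lambda>c. gmult H c k) ` {c \<in> ?C. gsrc H c = grng H k})"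
      unfolding CK_def by (auto simp: composable_def)
    moreover have "finite (\<Union>k \<in> Kx x. (\<lambda>c. gmult H c k) ` {c \<in> ?C. gsrc H c = grng H k})"
      using Kx_fin finite_fibre[OF Co Cc] by blast
    ultimately show ?thesis by (rule finite_subset)
  qed
  have bound: "10 * card (CK x - Kx x) < card (Kx x)" if x: "x \<in> X" for x
  proof -
    have "x \<in> Kx x" using X_K[OF x] by (simp add: Kx_def)
    then have pos: "0 < card (Kx x)" using Kx_fin by (auto simp: card_gt_0_iff)
    have "real (card (CK x - Kx x)) / real (card (Kx x)) < 1 / 10"
      using K(2)[unfolded Let_def, rule_format, of x] x gunits_H unfolding CK_def Kx_def by simp
    then show ?thesis using pos by (simp add: divide_simps)
  qed
  have CK_I: "gmult H c k \<in> CK x" if "c \<in> ?C" "k \<in> Kx x" "gsrc H c = grng H k" for c k x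
  proof -
    have "(c, k) \<in> composable H" using that CA KA by (auto simp: composable_def Kx_def)
    then show ?thesis using that(1,2) unfolding CK_def by blast
  qed
  have large: "20 \<le> card (E `` {x})" if x: "x \<in> X" for x
  proof -
    have xK: "x \<in> Kx x" using X_K[OF x] by (simp add: Kx_def)
    have "\<forall>i < 40. \<exists>u \<in> S i. gsrc H u = x \<and> grng H u \<in> B i" using S x by blast
    then obtain u where u: "\<And>i. i < 40 \<Longrightarrow> u i \<in> S i \<and> gsrc H (u i) = x \<and> grng H (u i) \<in> B i" by metis
    have "inj_on u {..<40}"
    proof (rule inj_onI)
      fix i k :: nat assume ik: "i \<in> {..<40}" "k \<in> {..<40}" "u i = u k"
      then have "grng H (u i) \<in> B i \<inter> B k" using u[of i] u[of k] by auto
      then show "i = k" using B(2) ik by auto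
    qed
    then have "card (u ` {..<40}) = 40" by (simp add: card_image)
    moreover have "u ` {..<40} \<subseteq> CK x"
    proof
      fix g assume "g \<in> u ` {..<40}"
      then obtain i where i: "i < 40" "g = u i" by auto
      have gC: "g \<in> ?C" "gsrc H g = x" using u[OF i(1)] i by auto
      then have "gmult H g x \<in> CK x" using CK_I[OF _ xK] X_K[OF x] by simp
      then show "g \<in> CK x" using Hg.mu_ss[of g] gC CA by auto
    qed
    ultimately have "40 \<le> card (CK x)" using card_mono[OF CK_fin] by metis
    also have "card (CK x) \<le> card (Kx x \<union> (CK x - Kx x))" by (rule card_mono) (use CK_fin Kx_fin
      in auto)
    also have "\<dots> \<le> card (Kx x) + card (CK x - Kx x)" by (rule card_Un_le)
    \<comment> \<open>The fibre of \<open>K\<close>, enlarged by less than a tenth, has at least 40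
      elements; so it has more than 36, well above 20.\<close>
    finally show ?thesis using bound[OF x] unfolding card_cls by linarith
  qed
  \<comment> \<open>The maps in \<open>J\<close> must move every point, so units are removed from
    \<open>K\<close>; openness and compactness persist because the unit space is clopen in
    \<open>H\<close>.\<close>
  have KX: "openin (gtop H) (K - X)" "compactin (gtop H) (K - X)"
  proof -
    show "openin (gtop H) (K - X)" using Ko units_H_clopen by blast
    have "K - X = K \<inter> (topspace (gtop H) - X)" using KA by auto
    moreover have "closedin (gtop H) (topspace (gtop H) - X)"
      using closedin_diff[OF closedin_topspace units_H_clopen(1)] .
    ultimately show "compactin (gtop H) (K - X)" using compact_Int_closedin[OF Kc] by metis
  qed
  obtain \<V> where \<V>: "finite \<V>" "\<forall>(V, c) \<in> \<V>. G.cob V \<and> c \<in> carrier Zp"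
    "K - X = (\<Union>(V, c) \<in> \<V>. V \<times> {c})" using compact_open_pieces[OF KX] by (elim exE conjE)
  have \<V>cob: "G.cob V" if "(V, c) \<in> \<V>" for V c using \<V>(2) that by auto
  let ?g = "\<lambda>V c (x :: 'g \<times> int). j (G.rr (the_inv_into V (src c) (fst x)))"
  define J where "J = (\<lambda>(V, c). (j ` src c ` V, ?g V c)) ` \<V>"
  have g: "?g V c (j (src c v)) = j (G.rr v)" if V: "(V, c) \<in> \<V>" "v \<in> V" for V c v
  proof -
    have cV: "G.cob V" using \<V>cob[OF V(1)] .
    have "inj_on (src c) V"
    proof (rule inj_onI)
      fix v w assume vw: "v \<in> V" "w \<in> V" "src c v = src c w"
      then have "v \<in> G.A" "w \<in> G.A" using G.cob_subset[OF cV] by auto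
      then have "G.ss v = G.ss w" using src_inj vw(3) by simp
      then show "v = w" using cV vw(1,2) by (auto simp: G.cob_iff inj_on_def)
    qed
    then show ?thesis using V(2) by (simp add: the_inv_into_f_f)
  qed
  have VK: "(v, c) \<in> K" "(v, c) \<notin> X" "gsrc H (v, c) = j (src c v)" "grng H (v, c) = j (G.rr v)"
    if V: "(V, c) \<in> \<V>" "v \<in> V" for V c v
  proof -
    have "(v, c) \<in> K - X" unfolding \<V>(3) using V by blast
    then show 1: "(v, c) \<in> K" "(v, c) \<notin> X" by auto
    then have "v \<in> G.A" "c \<in> carrier Zp" using KA arrows_H by auto
    then show "gsrc H (v, c) = j (src c v)" "grng H (v, c) = j (G.rr v)" using src_H rng_H by auto
  qed
  interpret R: finite_relation X CL p P L E J
  proof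
    show "equiv X E"
    proof (rule equivI)
      show "E \<subseteq> X \<times> X" unfolding E_def using KA Hg.ss_unit Hg.rr_unit gunits_H by blast
      show "refl_on X E"
      proof (rule refl_onI)
        fix x assume x: "x \<in> X"
        then show "(x, x) \<in> E" unfolding E_def
          by (intro CollectI exI[of _ x]) (simp add: X_K[OF x])
      qed
      show "sym E"
      proof (rule symI)
        fix x y assume "(x, y) \<in> E"
        then obtain k where k: "k \<in> K" "x = gsrc H k" "y = grng H k" unfolding E_def by auto
        then have "k \<in> garrows H" using KA by auto
        then have "y = gsrc H (ginv H k)" "x = grng H (ginv H k)" using Hg.ss_iv Hg.rr_iv k by
          simp_all
        then show "(y, x) \<in> E" unfolding E_def using K_inv[OF k(1)] by blast
      qed
      show "trans E"
      proof (rule transI)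
        fix x y z assume "(x, y) \<in> E" "(y, z) \<in> E"
        then obtain k l where k: "k \<in> K" "x = gsrc H k" "y = grng H k" "l \<in> K" "y = gsrc H l"
          "z = grng H l"
          unfolding E_def by auto
        have c: "gsrc H l = grng H k" using k by simp
        have "k \<in> garrows H" "l \<in> garrows H" using k KA by auto
        note m = Hg.mu_facts[OF this(2,1) c]
        have "x = gsrc H (gmult H l k)" "z = grng H (gmult H l k)" using m(2,3) k by auto
        then show "(x, z) \<in> E" unfolding E_def using K_mult[OF k(4,1) c] by blast
      qed
    qed
    show "finite (E `` {x})" for x unfolding E_cls using Kx_fin by simp
    show "20 \<le> card (E `` {x})" if "x \<in> X" for x using large[OF that] .
    show "finite J" unfolding J_def using \<V>(1) by simp
    show "M.Q C h" if Ch: "(C, h) \<in> J" for C h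
    proof -
      obtain V c where V: "(V, c) \<in> \<V>" "C = j ` src c ` V" "h = ?g V c" using Ch unfolding J_def
        by auto
      have "P c C h" by (rule P_I[OF \<V>cob[OF V(1)] V(2)]) (simp only: V(3) g[OF V(1)])
      then show ?thesis by (rule M.P_imp_Q)
    qed
    show "(x, h x) \<in> E \<and> h x \<noteq> x" if Ch: "(C, h) \<in> J" "x \<in> C" for C h x
    proof -
      obtain V c where V: "(V, c) \<in> \<V>" "C = j ` src c ` V" "h = ?g V c" using Ch unfolding J_def
        by auto
      obtain v where v: "v \<in> V" "x = j (src c v)" using V(2) Ch(2) by auto
      have hx: "h x = grng H (v, c)" "x = gsrc H (v, c)"
        using g[OF V(1) v(1)] VK(3,4)[OF V(1) v(1)] V(3) v(2) by simp_all
      have "grng H (v, c) \<noteq> gsrc H (v, c)" using VK(1,2)[OF V(1) v(1)] iso by auto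
      moreover have "(gsrc H (v, c), grng H (v, c)) \<in> E" unfolding E_def using VK(1)[OF V(1) v(1)]
        by blast
      ultimately show ?thesis using hx by simp
    qed
    show "\<exists>(C, h) \<in> J. x \<in> C \<and> h x = y" if xy: "(x, y) \<in> E" "x \<noteq> y" for x y
    proof -
      obtain k where k: "k \<in> K" "x = gsrc H k" "y = grng H k" using xy(1) unfolding E_def by auto
      have "k \<notin> X" using X_K k xy(2) by metis
      then have "k \<in> (\<Union>(V, c) \<in> \<V>. V \<times> {c})" using k(1) \<V>(3) by blast
      then obtain V c v where V: "(V, c) \<in> \<V>" "v \<in> V" "k = (v, c)" by auto
      have "(j ` src c ` V, ?g V c) \<in> J" unfolding J_def using V(1) by force
      moreover have "x \<in> j ` src c ` V" "?g V c x = y" using VK(3,4)[OF V(1,2)] g[OF V(1,2)] k V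
        by simp_all
      ultimately show ?thesis by (intro bexI[of _ "(j ` src c ` V, ?g V c)"]) simp_all
    qed
  qed
  have approx: "\<exists>N \<in> CL. (\<forall>x \<in> N. (x, f x) \<in> E) \<and> (\<forall>x \<in> X. 10 * card (E `` {x} - N) \<le> card (E ``
    {x}))"
    if f: "f \<in> M.F" and U: "cobH U" "gsrc H ` U = X" "\<forall>u \<in> U. f (gsrc H u) = grng H u" "U \<subseteq> ?C"
      for f U
  proof -
    \<comment> \<open>The points at which \<open>f\<close> is implemented by an arrow of
      \<open>K\<close>, hence stays within its class.\<close>
    let ?N = "gsrc H ` (U \<inter> K)"
    have "closedin (gtop H) K" using compactin_imp_closedin[OF Hausdorff_H Kc] .
    then have "cobH (U \<inter> K)" using U(1) Ko
      unfolding cobH_iff by (auto intro: compact_Int_closedin inj_on_subset)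
    then have "?N \<in> CL" using M.Q_clopen[OF cobH_Q[of "U \<inter> K" f]] U(3) by auto
    moreover have "(x, f x) \<in> E" if x: "x \<in> ?N" for x
    proof -
      obtain u where "u \<in> U" "u \<in> K" "x = gsrc H u" using x by auto
      then show ?thesis unfolding E_def using U(3) by (intro CollectI exI[of _ u]) simp
    qed
    moreover have "10 * card (E `` {x} - ?N) \<le> card (E `` {x})" if x: "x \<in> X" for x
    proof -
      \<comment> \<open>A point \<open>y\<close> of the class outside \<open>?N\<close> is the range
        of some \<open>k\<close> in \<open>Kx x\<close>. The arrow of \<open>U\<close> at
        \<open>y\<close> is not in \<open>K\<close>, so its product with \<open>k\<close> lies in
        \<open>CK x - Kx x\<close>, and \<open>?h\<close> recovers \<open>y\<close> from this
        product. Hence there are few such \<open>y\<close>.\<close>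
      let ?h = "\<lambda>z. (inv\<^bsub>M.FG\<^esub> f) (grng H z)"
      have "E `` {x} - ?N \<subseteq> ?h ` (CK x - Kx x)"
      proof
        fix y assume y: "y \<in> E `` {x} - ?N"
        then obtain k where k: "k \<in> Kx x" "y = grng H k" unfolding E_cls by auto
        have kK: "k \<in> K" "k \<in> garrows H" "gsrc H k = x" using k KA by (auto simp: Kx_def)
        have yX: "y \<in> X" using Hg.rr_unit[OF kK(2)] k(2) gunits_H by simp
        then have "y \<in> gsrc H ` U" using U(2) by simp
        then obtain u where u: "u \<in> U" "y = gsrc H u" by blast
        have uC: "u \<in> ?C" using u(1) U(4) by (rule subsetD[rotated])
        then have uA: "u \<in> garrows H" using CA by (rule subsetD[rotated])
        have c: "gsrc H u = grng H k" using u k by simp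
        note m = Hg.mu_facts[OF uA kK(2) c]
        have "gmult H u k \<in> CK x" using CK_I[OF uC k(1) c] .
        moreover have "gmult H u k \<notin> Kx x"
        proof
          assume "gmult H u k \<in> Kx x"
          then have "gmult H (gmult H u k) (ginv H k) \<in> K"
            using K_mult[OF _ K_inv[OF kK(1)]] m(2) Hg.rr_iv[OF kK(2)] by (simp add: Kx_def)
          then have "u \<in> K" using m(5) by simp
          then show False using u y by auto
        qed
        moreover have "?h (gmult H u k) = y" 
        proof -
          have "grng H (gmult H u k) = f y" using m(3) U(3) u by simp
          then show ?thesis using M.FG_inv_apply(1)[OF f yX] by simp
        qed
        ultimately show "y \<in> ?h ` (CK x - Kx x)" by force
      qed
      then have "card (E `` {x} - ?N) \<le> card (CK x - Kx x)"
        using CK_fin by (intro surj_card_le) auto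
      then show ?thesis using bound[OF x] unfolding card_cls by linarith
    qed
    ultimately show ?thesis by blast
  qed
  obtain N1 where N1: "N1 \<in> CL" "\<forall>x \<in> N1. (x, f1 x) \<in> E"
    "\<forall>x \<in> X. 10 * card (E `` {x} - N1) \<le> card (E `` {x})"
    using approx[OF f1 U1] by auto
  obtain N2 where N2: "N2 \<in> CL" "\<forall>x \<in> N2. (x, f2 x) \<in> E"
    "\<forall>x \<in> X. 10 * card (E `` {x} - N2) \<le> card (E `` {x})"
    using approx[OF f2 U2] by auto
  show ?thesis
    by (rule R.almost_orbit_preserving_commute_mod[OF f1 N1(1) _ _ f2 N2(1)]) (use N1 N2 in auto)
qed

lemma D_subset_Alt:
  assumes "almost_finite H \<or> purely_infinite H"
  shows "M.D \<subseteq> M.Alt"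
  using assms M.paradoxical_D_subset_Alt[OF purely_infinite_paradoxical]
    M.D_subset_Alt[OF almost_finite_commute_mod] by auto

end

section \<open>Abelianizations and the main theorem\<close>

text \<open>The map sends the coset of \<open>g\<close> to the coset of \<open>\<phi> g\<close>,
  since commutators go to commutators. Injectivity then amounts to a trivial kernel.\<close>

lemma inj_on_H1_map_iff:
  assumes "group \<Gamma>" "group \<Delta>" and \<phi>: "\<phi> \<in> hom \<Gamma> \<Delta>"
  shows "inj_on (H1_map \<Gamma> \<Delta> \<phi>) (carrier (H1 \<Gamma>)) \<longleftrightarrow>
    (\<forall>g \<in> carrier \<Gamma>. \<phi> g \<in> commutator_subgroup \<Delta> \<longrightarrow> g \<in> commutator_subgroup \<Gamma>)"
proof -
  interpret \<Gamma>: group \<Gamma> by fact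
  interpret \<Delta>: group \<Delta> by fact
  interpret \<phi>: group_hom \<Gamma> \<Delta> \<phi> by unfold_locales (rule \<phi>)
  let ?N = "commutator_subgroup \<Gamma>" and ?M = "commutator_subgroup \<Delta>"
  interpret N: normal ?N \<Gamma> unfolding commutator_subgroup_def by (rule \<Gamma>.derived_self_is_normal)
  interpret M: normal ?M \<Delta> unfolding commutator_subgroup_def by (rule \<Delta>.derived_self_is_normal)
  have NM: "\<phi> n \<in> ?M" if "n \<in> ?N" for n
  proof -
    have "\<phi> n \<in> derived \<Delta> (\<phi> ` carrier \<Gamma>)"
      unfolding \<phi>.derived_img[OF subset_refl] using that unfolding commutator_subgroup_def by blast
    also have "\<dots> \<subseteq> ?M" unfolding commutator_subgroup_def by (rule \<Delta>.mono_derived) (use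
      \<phi>.hom_closed in auto)
    finally show ?thesis .
  qed
  have car: "carrier (H1 \<Gamma>) = {?N #>\<^bsub>\<Gamma>\<^esub> g | g. g \<in> carrier \<Gamma>}"
    by (auto simp: H1_def FactGroup_def RCOSETS_def)
  have val: "H1_map \<Gamma> \<Delta> \<phi> (?N #>\<^bsub>\<Gamma>\<^esub> g) = ?M #>\<^bsub>\<Delta>\<^esub> \<phi> g" if g: "g \<in> carrier \<Gamma>" for g
  proof -
    have "?M <#>\<^bsub>\<Delta>\<^esub> \<phi> ` (?N #>\<^bsub>\<Gamma>\<^esub> g) = ?M #>\<^bsub>\<Delta>\<^esub> \<phi> g"
    proof (intro equalityI subsetI)
      fix x assume "x \<in> ?M <#>\<^bsub>\<Delta>\<^esub> \<phi> ` (?N #>\<^bsub>\<Gamma>\<^esub> g)"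
      then obtain m n where mn: "m \<in> ?M" "n \<in> ?N" "x = m \<otimes>\<^bsub>\<Delta>\<^esub> \<phi> (n \<otimes>\<^bsub>\<Gamma>\<^esub> g)"
        unfolding set_mult_def r_coset_def by auto
      have "m \<otimes>\<^bsub>\<Delta>\<^esub> \<phi> n \<in> ?M" using M.m_closed mn(1) NM[OF mn(2)] by simp
      moreover have "x = (m \<otimes>\<^bsub>\<Delta>\<^esub> \<phi> n) \<otimes>\<^bsub>\<Delta>\<^esub> \<phi> g"
        using mn g N.subset M.subset \<phi>.hom_closed by (auto simp: \<Delta>.m_assoc subset_iff)
      ultimately show "x \<in> ?M #>\<^bsub>\<Delta>\<^esub> \<phi> g" unfolding r_coset_def by blast
    next
      fix x assume "x \<in> ?M #>\<^bsub>\<Delta>\<^esub> \<phi> g"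
      then obtain m where m: "m \<in> ?M" "x = m \<otimes>\<^bsub>\<Delta>\<^esub> \<phi> g" unfolding r_coset_def by auto
      have "\<one>\<^bsub>\<Gamma>\<^esub> \<otimes>\<^bsub>\<Gamma>\<^esub> g \<in> ?N #>\<^bsub>\<Gamma>\<^esub> g" unfolding r_coset_def using N.one_closed by blast
      then have "\<phi> g \<in> \<phi> ` (?N #>\<^bsub>\<Gamma>\<^esub> g)" using g by simp
      then show "x \<in> ?M <#>\<^bsub>\<Delta>\<^esub> \<phi> ` (?N #>\<^bsub>\<Gamma>\<^esub> g)" unfolding set_mult_def using m by blast
    qed
    moreover have "?N #>\<^bsub>\<Gamma>\<^esub> g \<in> carrier (H1 \<Gamma>)" using car g by auto
    ultimately show ?thesis by (simp add: H1_map_def)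
  qed
  show ?thesis
  proof (intro iffI ballI impI)
    fix g assume inj: "inj_on (H1_map \<Gamma> \<Delta> \<phi>) (carrier (H1 \<Gamma>))" and g: "g \<in> carrier \<Gamma>" "\<phi> g \<in> ?M"
    have "?M #>\<^bsub>\<Delta>\<^esub> \<phi> g = ?M #>\<^bsub>\<Delta>\<^esub> \<phi> \<one>\<^bsub>\<Gamma>\<^esub>"
      using \<Delta>.coset_join2[OF _ M.subgroup_axioms g(2)] \<Delta>.coset_mult_one[OF M.subset] g(1) by simp
    then have "?N #>\<^bsub>\<Gamma>\<^esub> g = ?N #>\<^bsub>\<Gamma>\<^esub> \<one>\<^bsub>\<Gamma>\<^esub>"
      using inj_onD[OF inj, of "?N #>\<^bsub>\<Gamma>\<^esub> g" "?N #>\<^bsub>\<Gamma>\<^esub> \<one>\<^bsub>\<Gamma>\<^esub>"] val g(1) car by auto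
    then have "?N #>\<^bsub>\<Gamma>\<^esub> g = ?N" using \<Gamma>.coset_mult_one[OF N.subset] by simp
    then show "g \<in> ?N" using \<Gamma>.coset_join1[OF _ g(1) N.subgroup_axioms] by simp
  next
    assume ker: "\<forall>g \<in> carrier \<Gamma>. \<phi> g \<in> ?M \<longrightarrow> g \<in> ?N"
    show "inj_on (H1_map \<Gamma> \<Delta> \<phi>) (carrier (H1 \<Gamma>))"
    proof (rule inj_onI)
      fix A B assume A: "A \<in> carrier (H1 \<Gamma>)" and B: "B \<in> carrier (H1 \<Gamma>)"
        and eq: "H1_map \<Gamma> \<Delta> \<phi> A = H1_map \<Gamma> \<Delta> \<phi> B"
      obtain f g where f: "A = ?N #>\<^bsub>\<Gamma>\<^esub> f" "f \<in> carrier \<Gamma>" and g: "B = ?N #>\<^bsub>\<Gamma>\<^esub> g" "g \<in> carrier \<Gamma>"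
        using A B car by auto
      have "?M #>\<^bsub>\<Delta>\<^esub> \<phi> f = ?M #>\<^bsub>\<Delta>\<^esub> \<phi> g" using eq f g val by simp
      then have "\<phi> f \<in> ?M #>\<^bsub>\<Delta>\<^esub> \<phi> g" using \<Delta>.rcos_self[OF _ M.subgroup_axioms] f(2) \<phi>.hom_closed
        by metis
      then have "\<phi> f \<otimes>\<^bsub>\<Delta>\<^esub> inv\<^bsub>\<Delta>\<^esub> \<phi> g \<in> ?M" using M.rcos_module[OF \<Delta>.is_group] f(2) g(2) by simp
      then have "\<phi> (f \<otimes>\<^bsub>\<Gamma>\<^esub> inv\<^bsub>\<Gamma>\<^esub> g) \<in> ?M" using f(2) g(2) by simp
      then have "f \<otimes>\<^bsub>\<Gamma>\<^esub> inv\<^bsub>\<Gamma>\<^esub> g \<in> ?N" using ker f(2) g(2) by simp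
      then have "f \<in> ?N #>\<^bsub>\<Gamma>\<^esub> g" using N.rcos_module[OF \<Gamma>.is_group] f(2) g(2) by simp
      then show "A = B" using \<Gamma>.repr_independence[OF _ g(2) N.subgroup_axioms] f(1) g(1) by simp
    qed
  qed
qed

section \<open>Transport of the group structure to the full group of \<open>G\<close>\<close>

context semidirect_setting
begin

text \<open>Inverse to \<open>\<iota>\<close> by \<open>iota_kappa\<close> and
  \<open>kappa_iota\<close>. Being a homomorphism on all of \<open>F\<close>, it presents the full
  group of \<open>G\<close> as the image of the subgroup \<open>F0\<close>, which supplies the group
  axioms.\<close>

definition \<kappa> :: "('g \<times> int \<Rightarrow> 'g \<times> int) \<Rightarrow> 'g \<Rightarrow> 'g" where
  "\<kappa> f = (\<lambda>x\<in>G.U0. fst (f (j x)))"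

lemma F_j: "\<lbrakk>f \<in> M.F; x \<in> G.U0\<rbrakk> \<Longrightarrow> f (j x) = j (\<kappa> f x) \<and> \<kappa> f x \<in> G.U0"
  using M.F_in_X[of f "j x"] by (auto simp: X_def \<kappa>_def)

lemma iota_kappa:
  assumes f: "f \<in> M.F"
  shows "\<iota> (\<kappa> f) = f"
proof (rule extensionalityI)
  show "\<iota> (\<kappa> f) \<in> extensional X" by (simp add: iota_eq)
  show "f \<in> extensional X" using f by (simp add: M.F_def)
  fix y assume "y \<in> X"
  then obtain x where "y = j x" "x \<in> G.U0" by (auto simp: X_def)
  then show "\<iota> (\<kappa> f) y = f y" using F_j[OF f, of x] by (simp add: iota_j)
qed

lemma kappa_iota: "f \<in> extensional G.U0 \<Longrightarrow> \<kappa> (\<iota> f) = f"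
  by (rule extensionalityI[of _ G.U0]) (auto simp: \<kappa>_def iota_j)

lemma full_group_extensional: "f \<in> carrier (full_group G) \<Longrightarrow> f \<in> extensional G.U0"
  by (auto simp: full_group_def bisection_map_def)

lemma carrier_full_group_G: "carrier (full_group G) = \<kappa> ` M.F0"
  unfolding iota_full_group[symmetric] image_image
  using kappa_iota[OF full_group_extensional] by simp

lemma kappa_Bij:
  assumes f: "f \<in> M.F"
  shows "\<kappa> f \<in> Bij G.U0"
proof -
  have "inj_on (\<kappa> f) G.U0"
  proof (rule inj_onI)
    fix x y assume x: "x \<in> G.U0" "y \<in> G.U0" "\<kappa> f x = \<kappa> f y"
    then have "f (j x) = f (j y)" using F_j[OF f] by simp
    then show "x = y" using M.F_inj[OF f, of "j x" "j y"] x by (simp add: X_def)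
  qed
  moreover have "\<kappa> f ` G.U0 = G.U0"
  proof
    show "G.U0 \<subseteq> \<kappa> f ` G.U0"
    proof
      fix y assume "y \<in> G.U0"
      then have "j y \<in> X" by (simp add: X_def)
      from M.F_surj[OF f this] obtain x where "x \<in> G.U0" "f (j x) = j y" by (auto simp: X_def)
      then show "y \<in> \<kappa> f ` G.U0" using F_j[OF f, of x] by (intro image_eqI[of _ _ x]) auto
    qed
  qed (use F_j[OF f] in auto)
  ultimately show ?thesis by (simp add: Bij_def bij_betw_def \<kappa>_def)
qed

lemma kappa_hom: "\<kappa> \<in> hom M.FG (BijGroup G.U0)"
proof (rule homI)
  show "\<kappa> f \<in> carrier (BijGroup G.U0)" if "f \<in> carrier M.FG" for f
    using kappa_Bij that by (simp add: BijGroup_def)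
  fix f g assume "f \<in> carrier M.FG" "g \<in> carrier M.FG"
  then have fg: "f \<in> M.F" "g \<in> M.F" by auto
  have "compose G.U0 (\<kappa> f) (\<kappa> g) = \<kappa> (f \<otimes>\<^bsub>M.FG\<^esub> g)"
  proof (rule extensionalityI[of _ G.U0])
    fix x assume x: "x \<in> G.U0"
    have "j x \<in> X" using x by (simp add: X_def)
    then have "(f \<otimes>\<^bsub>M.FG\<^esub> g) (j x) = f (g (j x))" using fg by simp
    also have "\<dots> = j (\<kappa> f (\<kappa> g x))" using F_j[OF fg(2) x] F_j[OF fg(1)] by simp
    finally show "compose G.U0 (\<kappa> f) (\<kappa> g) x = \<kappa> (f \<otimes>\<^bsub>M.FG\<^esub> g) x"
      using x by (simp add: compose_def \<kappa>_def)
  qed (simp_all add: \<kappa>_def)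
  then show "\<kappa> (f \<otimes>\<^bsub>M.FG\<^esub> g) = \<kappa> f \<otimes>\<^bsub>BijGroup G.U0\<^esub> \<kappa> g"
    using kappa_Bij fg by (simp add: BijGroup_def)
qed

interpretation \<kappa>: group_hom M.FG "BijGroup G.U0" \<kappa>
  by (intro group_hom.intro group_hom_axioms.intro M.FG.is_group group_BijGroup kappa_hom)

lemma full_group_G_eq: "full_group G = BijGroup G.U0\<lparr>carrier := \<kappa> ` M.F0\<rparr>"
  using carrier_full_group_G by (simp add: full_group_def)

lemma subgroup_kappa_F0: "subgroup (\<kappa> ` M.F0) (BijGroup G.U0)"
  by (rule \<kappa>.subgroup_img_is_subgroup[OF M.subgroup_F0])

lemma group_full_group_G: "group (full_group G)"
  unfolding full_group_G_eq by (rule group.subgroup_imp_group[OF group_BijGroup subgroup_kappa_F0])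

lemma iota_hom: "\<iota> \<in> hom (full_group G) M.FG"
proof (rule homI)
  fix f assume "f \<in> carrier (full_group G)"
  then show "\<iota> f \<in> carrier M.FG" using iota_full_group M.F0_subset by auto
next
  fix f g assume "f \<in> carrier (full_group G)" "g \<in> carrier (full_group G)"
  then obtain f' g' where fg: "f = \<kappa> f'" "f' \<in> M.F" "g = \<kappa> g'" "g' \<in> M.F"
    unfolding carrier_full_group_G using M.F0_subset by auto
  have e: "f \<otimes>\<^bsub>full_group G\<^esub> g = \<kappa> (f' \<otimes>\<^bsub>M.FG\<^esub> g')"
    unfolding full_group_G_eq using fg \<kappa>.hom_mult by simp
  show "\<iota> (f \<otimes>\<^bsub>full_group G\<^esub> g) = \<iota> f \<otimes>\<^bsub>M.FG\<^esub> \<iota> g"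
    unfolding e using fg iota_kappa[of "f' \<otimes>\<^bsub>M.FG\<^esub> g'"] iota_kappa[of f'] iota_kappa[of g'] by simp
qed

lemma iota_commutator_subgroup: "\<iota> ` commutator_subgroup (full_group G) = M.D0"
proof -
  interpret \<iota>: group_hom "full_group G" M.FG \<iota>
    by (intro group_hom.intro group_hom_axioms.intro M.FG.is_group group_full_group_G iota_hom)
  show ?thesis
    unfolding commutator_subgroup_def \<iota>.derived_img[OF subset_refl, symmetric] iota_full_group
      M.D0_def ..
qed

lemma commutator_subgroup_H: "commutator_subgroup (full_group H) = M.D"
  by (simp add: commutator_subgroup_def full_group_H M.D_def)

lemma commutator_full_group_H: "commutator_full_group H = M.FD"
  by (simp add: commutator_full_group_def commutator_subgroup_H) (simp add: full_group_H)

lemma L_eq_iota: "L a = \<iota> (la a)"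
  by (simp add: L_def iota_eq)

lemma range_L: "{\<iota> (lam a) | a. a \<in> carrier Zp} = range L"
proof (intro equalityI subsetI)
  fix f assume "f \<in> {\<iota> (lam a) | a. a \<in> carrier Zp}"
  then obtain a where "f = \<iota> (lam a)" "a \<in> carrier Zp" by auto
  then have "f = L a" using L_eq_iota[of a] mod_Zp by simp
  then show "f \<in> range L" by blast
qed (use L_eq_iota mod_in_Zp in blast)

lemma internal_semidirect_eq: "internal_semidirect p G lam S = generate M.FG (S \<union> range L)"
  unfolding internal_semidirect_def range_L H_def[symmetric] full_group_H ..

lemma lam_in_D_iff: "(\<forall>a \<in> carrier Zp. \<iota> (lam a) \<in> M.D) \<longleftrightarrow> (\<forall>a. L a \<in> M.D)"
  using L_eq_iota mod_in_Zp mod_Zp by metis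

lemma inj_on_H1_map_iota_iff:
  "inj_on (H1_map (full_group G) (full_group H) \<iota>) (carrier (H1 (full_group G))) \<longleftrightarrow> M.F0 \<inter> M.D \<subseteq>
    M.D0"
proof -
  have "(\<forall>g \<in> carrier (full_group G). \<iota> g \<in> M.D \<longrightarrow> g \<in> commutator_subgroup (full_group G)) \<longleftrightarrow>
    M.F0 \<inter> M.D \<subseteq> M.D0"
  proof (intro iffI subsetI ballI impI)
    fix f assume k: "\<forall>g \<in> carrier (full_group G). \<iota> g \<in> M.D \<longrightarrow> g \<in> commutator_subgroup (full_group
      G)"
      and f: "f \<in> M.F0 \<inter> M.D"
    then obtain g where "g \<in> carrier (full_group G)" "f = \<iota> g" unfolding
      iota_full_group[symmetric] by auto
    then show "f \<in> M.D0" using k f iota_commutator_subgroup by auto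
  next
    fix g assume k: "M.F0 \<inter> M.D \<subseteq> M.D0" and g: "g \<in> carrier (full_group G)" "\<iota> g \<in> M.D"
    have "\<iota> g \<in> M.F0" using g(1) iota_full_group by auto
    then have "\<iota> g \<in> \<iota> ` commutator_subgroup (full_group G)" using k g(2) iota_commutator_subgroup
      by auto
    then obtain h where h: "h \<in> commutator_subgroup (full_group G)" "\<iota> g = \<iota> h" by auto
    interpret FGG: group "full_group G" by (rule group_full_group_G)
    have "h \<in> carrier (full_group G)"
      using h(1) FGG.derived_in_carrier[OF subset_refl] unfolding commutator_subgroup_def by auto
    then have "g = h" using h(2) kappa_iota[OF full_group_extensional] g(1) by metis
    then show "g \<in> commutator_subgroup (full_group G)" using h by simp
  qed
  then show ?thesis
    using inj_on_H1_map_iff[OF group_full_group_G M.FG.is_group iota_hom] commutator_subgroup_H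
    by (simp add: full_group_H)
qed

end

theorem theorem5p13:
  fixes p :: nat
    and G :: "'g top_groupoid"
    and lam :: "int \<Rightarrow> 'g \<Rightarrow> 'g"
    and H :: "('g \<times> int) top_groupoid"
    and \<iota> :: "('g \<Rightarrow> 'g) \<Rightarrow> ('g \<times> int) \<Rightarrow> ('g \<times> int)"
    and FG DG DH
  assumes "prime p"
    and "ample G"
    and "cantor_space (unit_top G)"
    and "groupoid_action p G lam"
    and "free_on_units p G lam"
    and H_def: "H = semidirect p G lam"
    and "effective G" "effective H"
    and "minimal_groupoid G" "minimal_groupoid H"
    and "almost_finite G \<or> purely_infinite G"
    and "almost_finite H \<or> purely_infinite H"
    and incl_def: "\<iota> = lift_units p G lam"
    and FG_def: "FG = carrier (full_group G)"
    and DG_def: "DG = commutator_subgroup (full_group G)"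
    and DH_def: "DH = commutator_subgroup (full_group H)"
  shows "(p \<ge> 3 \<longrightarrow> (\<forall>a \<in> carrier (integer_mod_group p). \<iota> (lam a) \<in> DH)) \<and>
    ((\<forall>a \<in> carrier (integer_mod_group p). \<iota> (lam a) \<in> DH) \<longrightarrow>
      normalizer (commutator_full_group H) (\<iota> ` DG) =
        internal_semidirect p G lam (\<iota> ` FG \<inter> DH) \<and>
      (inj_on (H1_map (full_group G) (full_group H) \<iota>) (carrier (H1 (full_group G))) \<longleftrightarrow>
        normalizer (commutator_full_group H) (\<iota> ` DG) =
          internal_semidirect p G lam (\<iota> ` DG)) \<and>
      (normalizer (commutator_full_group H) (\<iota> ` DG) =
          internal_semidirect p G lam (\<iota> ` DG) \<longleftrightarrow>
        maximal_subgroup (internal_semidirect p G lam (\<iota> ` DG)) (commutator_full_group H)))"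
proof -
  interpret S: semidirect_setting p G lam
    using assms by unfold_locales auto
  have H: "H = S.H" unfolding H_def S.H_def ..
  have D: "DH = S.M.D" unfolding DH_def H by (rule S.commutator_subgroup_H)
  have D0: "\<iota> ` DG = S.M.D0" unfolding incl_def DG_def by (rule S.iota_commutator_subgroup)
  have F0: "\<iota> ` FG = S.M.F0" unfolding incl_def FG_def by (rule S.iota_full_group)
  have Alt: "S.M.D \<subseteq> S.M.Alt" using S.D_subset_Alt assms(12) H by simp
  show ?thesis
    unfolding D D0 F0
    unfolding incl_def S.lam_in_D_iff H S.commutator_full_group_H S.internal_semidirect_eq
      S.inj_on_H1_map_iota_iff
    using S.M.L_in_D S.M.normalizer_eq S.M.normalizer_eq_iff S.M.maximal_iff[OF _ Alt] by simp
qed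

end
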